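(* Let $(E,\tau,M,\rho)$ be a Lie algebroid over a smooth manifold $M$. There exists a unique graded ($\mathbb R$-linear) endomorphism of degree $1$ of the exterior algebra of forms $\Omega(M,E)$, called the $\Omega(M,E)$-valued exterior derivative and denoted by $d_\rho$, which satisfies: (i) for $f\in\Omega^0(M,E)=C^\infty(M,\mathbb R)$, $d_\rho f$ is the unique element of $\Omega^1(M,E)$ such that, for each $V\in A^1(M,E)$, $$\langle d_\rho f,V\rangle=\mathcal L_\rho(V)f=\langle df,\rho\circ V\rangle=\langle{}^t\!\rho\circ df,V\rangle,$$ where $d$ is the usual exterior derivative of smooth functions on $M$ and ${}^t\!\rho:T^*M\to E^*$ is the transpose of the anchor $\rho$; (ii) for $p\ge1$ and $\eta\in\Omega^p(M,E)$, $d_\rho\eta$ is the unique element of $\Omega^{p+1}(M,E)$ such that, for all $V_0,\dots,V_p\in A^1(M,E)$, $$d_\rho\eta(V_0,\dots,V_p)=\sum_{i=0}^p(-1)^i\mathcal L_\rho(V_i)\bigl(\eta(V_0,\dots,\widehat V_i,\dots,V_p)\bigr)+\sum_{0\le i<j\le p}(-1)^{i+j}\eta\bigl(\{V_i,V_j\},V_0,\dots,\widehat V_i,\dots,\widehat V_j,\dots,V_p\bigr),$$ where the symbol $\widehat{\ }$ over a term means that it is omitted.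
   Context: A Lie algebroid $(E,\tau,M,\rho)$ is a smooth real vector bundle $\tau:E\to M$ of finite rank over a smooth manifold, with a real Lie algebra bracket $\{\ ,\ \}$ on its smooth sections and a smooth vector bundle map $\rho:E\to TM$ over $\mathrm{id}_M$ (anchor) such that $\{s_1,fs_2\}=f\{s_1,s_2\}+(\mathcal L(\rho\circ s_1)f)s_2$. $A^1(M,E)$ is the space of smooth sections of $E$; $\Omega^p(M,E)$ the space of smooth sections of $\bigwedge^pE^*$ ($C^\infty(M,\mathbb R)$ for $p=0$, $\{0\}$ for $p<0$), identified with alternating $C^\infty(M,\mathbb R)$-multilinear forms on $A^1(M,E)$; $\Omega(M,E)=\bigoplus_p\Omega^p(M,E)$. For a function $f$ and $V\in A^1(M,E)$, $\mathcal L_\rho(V)f=\mathcal L(\rho\circ V)f=\langle df,\rho\circ V\rangle$. A graded endomorphism of degree $1$ is a linear map sending $\Omega^p(M,E)$ into $\Omega^{p+1}(M,E)$ for all $p$. *)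

theory Defs
  imports "HOL-Analysis.Analysis"
begin

text \<open>
  The model spaces are finite-dimensional inner product spaces. They are taken from the class
  \<open>real_inner\<close> with an explicit finiteness condition, and not from \<open>euclidean_space\<close>, because the
  latter excludes dimension 0: manifolds of dimension 0 (a Lie algebra is a Lie algebroid over a
  point) and bundles of rank 0 have to be admitted. The instance for \<open>unit\<close> provides the space of
  dimension 0.
\<close>

instantiation unit :: real_inner
begin

definition plus_unit :: "unit \<Rightarrow> unit \<Rightarrow> unit" where "plus_unit x y = ()"
definition zero_unit :: unit where "zero_unit = ()"
definition scaleR_unit :: "real \<Rightarrow> unit \<Rightarrow> unit" where "scaleR_unit a x = ()"
definition inner_unit :: "unit \<Rightarrow> unit \<Rightarrow> real" where "inner_unit x y = 0"
definition norm_unit :: "unit \<Rightarrow> real" where "norm_unit x = 0"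
definition dist_unit :: "unit \<Rightarrow> unit \<Rightarrow> real" where "dist_unit x y = 0"
definition sgn_unit :: "unit \<Rightarrow> unit" where "sgn_unit x = ()"
definition uniformity_unit :: "(unit \<times> unit) filter"
  where "uniformity_unit = (INF e\<in>{0<..}. principal {(x, y). dist x y < e})"
definition open_unit :: "unit set \<Rightarrow> bool"
  where "open_unit S \<longleftrightarrow> (\<forall>x\<in>S. \<forall>\<^sub>F (x', y) in uniformity. x' = x \<longrightarrow> y \<in> S)"

instance
  by standard (auto simp: norm_unit_def inner_unit_def dist_unit_def uniformity_unit_def open_unit_def)

end

primrec Ck_on :: "nat \<Rightarrow> 'a::real_normed_vector set \<Rightarrow> ('a \<Rightarrow> 'b::real_normed_vector) \<Rightarrow> bool" where
  "Ck_on 0 S f \<longleftrightarrow> continuous_on S f"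
| "Ck_on (Suc k) S f \<longleftrightarrow> (\<forall>x\<in>S. f differentiable at x) \<and>
     (\<forall>v. Ck_on k S (\<lambda>x. frechet_derivative f (at x) v))"

text \<open>
  For open \<open>S\<close> in a finite-dimensional space, which is the only case used below, this is smoothness in
  the usual sense.
\<close>

definition smooth_on :: "'a::real_normed_vector set \<Rightarrow> ('a \<Rightarrow> 'b::real_normed_vector) \<Rightarrow> bool" where
  "smooth_on S f \<longleftrightarrow> (\<forall>k. Ck_on k S f)"

text \<open>
  A manifold is given by an atlas (not necessarily maximal); its underlying set is the union of the
  chart domains and its topology is the one for which all charts are homeomorphisms onto open sets.
\<close>

type_synonym ('m, 'a) chart = "'m set \<times> ('m \<Rightarrow> 'a)"

definition points :: "('m, 'a) chart set \<Rightarrow> 'm set" where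
  "points A = (\<Union>(U, \<phi>)\<in>A. U)"

definition atlas_topology :: "('m, 'a::topological_space) chart set \<Rightarrow> 'm topology" where
  "atlas_topology A = topology_generated_by {U \<inter> \<phi> -` T |U \<phi> T. (U, \<phi>) \<in> A \<and> open T}"

definition smooth_atlas :: "('m, 'a::real_inner) chart set \<Rightarrow> bool" where
  "smooth_atlas A \<longleftrightarrow>
     (\<forall>(U, \<phi>)\<in>A. inj_on \<phi> U \<and> open (\<phi> ` U)) \<and>
     (\<forall>(U, \<phi>)\<in>A. \<forall>(V, \<psi>)\<in>A. open (\<phi> ` (U \<inter> V)) \<and>
        smooth_on (\<phi> ` (U \<inter> V)) (\<lambda>y. \<psi> (inv_into U \<phi> y)))"

definition smooth_manifold :: "('m, 'a::real_inner) chart set \<Rightarrow> bool" where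
  "smooth_manifold A \<longleftrightarrow>
     (\<exists>B::'a set. finite B \<and> span B = UNIV) \<and> smooth_atlas A \<and>
     Hausdorff_space (atlas_topology A) \<and> second_countable (atlas_topology A)"

definition smooth_map ::
  "('m, 'a::real_inner) chart set \<Rightarrow> ('n, 'b::real_inner) chart set \<Rightarrow> ('m \<Rightarrow> 'n) \<Rightarrow> bool" where
  "smooth_map A B f \<longleftrightarrow>
     continuous_map (atlas_topology A) (atlas_topology B) f \<and>
     (\<forall>(U, \<phi>)\<in>A. \<forall>(V, \<psi>)\<in>B.
        smooth_on (\<phi> ` (U \<inter> f -` V)) (\<lambda>y. \<psi> (f (inv_into U \<phi> y))))"

definition diffeomorphism ::
  "('m, 'a::real_inner) chart set \<Rightarrow> ('n, 'b::real_inner) chart set \<Rightarrow> ('m \<Rightarrow> 'n) \<Rightarrow> bool" where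
  "diffeomorphism A B f \<longleftrightarrow>
     bij_betw f (points A) (points B) \<and> smooth_map A B f \<and>
     smooth_map B A (inv_into (points A) f)"

definition std_atlas :: "('a, 'a) chart set" where
  "std_atlas = {(UNIV, \<lambda>x. x)}"

definition restrict_atlas :: "('m, 'a) chart set \<Rightarrow> 'm set \<Rightarrow> ('m, 'a) chart set" where
  "restrict_atlas A W = (\<lambda>(U, \<phi>). (U \<inter> W, \<phi>)) ` A"

definition product_atlas ::
  "('m, 'a) chart set \<Rightarrow> ('n, 'b) chart set \<Rightarrow> ('m \<times> 'n, 'a \<times> 'b) chart set" where
  "product_atlas A B = {(U \<times> V, map_prod \<phi> \<psi>) |U \<phi> V \<psi>. (U, \<phi>) \<in> A \<and> (V, \<psi>) \<in> B}"

definition smooth_functions :: "('m, 'a::real_inner) chart set \<Rightarrow> ('m \<Rightarrow> real) set" where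
  "smooth_functions A = {f. smooth_map A std_atlas f}"

text \<open>
  A tangent vector at \<open>x\<close> is a pair \<open>(x, t)\<close> where \<open>t\<close> assigns to every chart of the atlas around
  \<open>x\<close> a vector of the model space, these vectors being related by the derivatives of the changes of
  charts. The value of \<open>t\<close> at anything else is 0, so that the representation is unique.
\<close>

type_synonym ('m, 'a) tangent = "'m \<times> (('m, 'a) chart \<Rightarrow> 'a)"

definition charts_at :: "('m, 'a) chart set \<Rightarrow> 'm \<Rightarrow> ('m, 'a) chart set" where
  "charts_at A x = {c \<in> A. x \<in> fst c}"

definition tangent_bundle :: "('m, 'a::real_inner) chart set \<Rightarrow> ('m, 'a) tangent set" where
  "tangent_bundle A = {(x, t). x \<in> points A \<and>
     (\<forall>(U, \<phi>)\<in>charts_at A x. \<forall>(V, \<psi>)\<in>charts_at A x.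
        t (V, \<psi>) = frechet_derivative (\<lambda>y. \<psi> (inv_into U \<phi> y)) (at (\<phi> x)) (t (U, \<phi>))) \<and>
     (\<forall>c. c \<notin> charts_at A x \<longrightarrow> t c = 0)}"

definition tangent_atlas ::
  "('m, 'a::real_inner) chart set \<Rightarrow> (('m, 'a) tangent, 'a \<times> 'a) chart set" where
  "tangent_atlas A =
     (\<lambda>(U, \<phi>). ({v \<in> tangent_bundle A. fst v \<in> U}, \<lambda>(x, t). (\<phi> x, t (U, \<phi>)))) ` A"

text \<open>
  \<open>differential A f x\<close> is the covector \<open>df\<close> at \<open>x\<close>, a linear form on the tangent space at \<open>x\<close>. Its
  value on a tangent vector does not depend on the chart that is used to compute it.
\<close>

definition differential ::
  "('m, 'a::real_inner) chart set \<Rightarrow> ('m \<Rightarrow> real) \<Rightarrow> 'm \<Rightarrow> ('m, 'a) tangent \<Rightarrow> real" where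
  "differential A f x v =
     (let c = (SOME c. c \<in> charts_at A x) in
      frechet_derivative (\<lambda>y. f (inv_into (fst c) (snd c) y)) (at (snd c x)) (snd v c))"

definition lie_derivative ::
  "('m, 'a::real_inner) chart set \<Rightarrow> ('m \<Rightarrow> ('m, 'a) tangent) \<Rightarrow> ('m \<Rightarrow> real) \<Rightarrow> 'm \<Rightarrow> real" where
  "lie_derivative A X f x = differential A f x (X x)"

record ('m, 'a, 'e, 'f) bundle_data =
  base_atlas :: "('m, 'a) chart set"
  total_atlas :: "('e, 'a \<times> 'f) chart set"
  proj :: "'e \<Rightarrow> 'm"
  fzero :: "'m \<Rightarrow> 'e"
  fadd :: "'e \<Rightarrow> 'e \<Rightarrow> 'e"
  fscale :: "real \<Rightarrow> 'e \<Rightarrow> 'e"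

definition fibre :: "('m, 'a, 'e, 'f, 'z) bundle_data_scheme \<Rightarrow> 'm \<Rightarrow> 'e set" where
  "fibre E x = {e \<in> points (total_atlas E). proj E e = x}"

definition real_vector_space_on ::
  "'e set \<Rightarrow> 'e \<Rightarrow> ('e \<Rightarrow> 'e \<Rightarrow> 'e) \<Rightarrow> (real \<Rightarrow> 'e \<Rightarrow> 'e) \<Rightarrow> bool" where
  "real_vector_space_on S z add smul \<longleftrightarrow>
     z \<in> S \<and> (\<forall>u\<in>S. \<forall>v\<in>S. add u v \<in> S) \<and> (\<forall>a. \<forall>u\<in>S. smul a u \<in> S) \<and>
     (\<forall>u\<in>S. \<forall>v\<in>S. \<forall>w\<in>S. add (add u v) w = add u (add v w)) \<and>
     (\<forall>u\<in>S. \<forall>v\<in>S. add u v = add v u) \<and>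
     (\<forall>u\<in>S. add z u = u) \<and>
     (\<forall>u\<in>S. \<exists>v\<in>S. add u v = z) \<and>
     (\<forall>a. \<forall>u\<in>S. \<forall>v\<in>S. smul a (add u v) = add (smul a u) (smul a v)) \<and>
     (\<forall>a b. \<forall>u\<in>S. smul (a + b) u = add (smul a u) (smul b u)) \<and>
     (\<forall>a b. \<forall>u\<in>S. smul a (smul b u) = smul (a * b) u) \<and>
     (\<forall>u\<in>S. smul 1 u = u)"

text \<open>
  \<open>h\<close> is the second component of the trivialisation \<open>e \<mapsto> (proj E e, h e)\<close> over \<open>U\<close>.
\<close>

definition local_trivialisation ::
  "('m, 'a::real_inner, 'e, 'f::real_inner, 'z) bundle_data_scheme \<Rightarrow> 'm set \<Rightarrow> ('e \<Rightarrow> 'f) \<Rightarrow> bool" where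
  "local_trivialisation E U h \<longleftrightarrow>
     openin (atlas_topology (base_atlas E)) U \<and>
     diffeomorphism
       (restrict_atlas (total_atlas E) (proj E -` U))
       (product_atlas (restrict_atlas (base_atlas E) U) std_atlas)
       (\<lambda>e. (proj E e, h e)) \<and>
     (\<forall>x\<in>U. \<forall>u\<in>fibre E x. \<forall>v\<in>fibre E x. h (fadd E u v) = h u + h v) \<and>
     (\<forall>x\<in>U. \<forall>u\<in>fibre E x. \<forall>a. h (fscale E a u) = a *\<^sub>R h u)"

definition vector_bundle ::
  "('m, 'a::real_inner, 'e, 'f::real_inner, 'z) bundle_data_scheme \<Rightarrow> bool" where
  "vector_bundle E \<longleftrightarrow>
     smooth_manifold (base_atlas E) \<and> smooth_manifold (total_atlas E) \<and>
     smooth_map (total_atlas E) (base_atlas E) (proj E) \<and>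
     (\<forall>x\<in>points (base_atlas E). real_vector_space_on (fibre E x) (fzero E x) (fadd E) (fscale E)) \<and>
     (\<forall>x\<in>points (base_atlas E). \<exists>U h. x \<in> U \<and> local_trivialisation E U h)"

text \<open>Sections are functions on the base; outside it they take the value \<open>undefined\<close>.\<close>

definition sections ::
  "('m, 'a::real_inner, 'e, 'f::real_inner, 'z) bundle_data_scheme \<Rightarrow> ('m \<Rightarrow> 'e) set" where
  "sections E = {s \<in> extensional (points (base_atlas E)).
     smooth_map (base_atlas E) (total_atlas E) s \<and> (\<forall>x\<in>points (base_atlas E). proj E (s x) = x)}"

definition sec_zero :: "('m, 'a, 'e, 'f, 'z) bundle_data_scheme \<Rightarrow> 'm \<Rightarrow> 'e" where
  "sec_zero E = (\<lambda>x\<in>points (base_atlas E). fzero E x)"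

definition sec_add ::
  "('m, 'a, 'e, 'f, 'z) bundle_data_scheme \<Rightarrow> ('m \<Rightarrow> 'e) \<Rightarrow> ('m \<Rightarrow> 'e) \<Rightarrow> 'm \<Rightarrow> 'e" where
  "sec_add E s t = (\<lambda>x\<in>points (base_atlas E). fadd E (s x) (t x))"

definition sec_mult ::
  "('m, 'a, 'e, 'f, 'z) bundle_data_scheme \<Rightarrow> ('m \<Rightarrow> real) \<Rightarrow> ('m \<Rightarrow> 'e) \<Rightarrow> 'm \<Rightarrow> 'e" where
  "sec_mult E f s = (\<lambda>x\<in>points (base_atlas E). fscale E (f x) (s x))"

text \<open>
  An element of the \<open>p\<close>-th exterior power of the dual of the fibre over \<open>x\<close> is an alternating
  \<open>p\<close>-linear form on that fibre, written as a function on lists that vanishes on every list which is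
  not a \<open>p\<close>-tuple of elements of the fibre.
\<close>

definition alternating_forms ::
  "('m, 'a, 'e, 'f, 'z) bundle_data_scheme \<Rightarrow> nat \<Rightarrow> 'm \<Rightarrow> ('e list \<Rightarrow> real) set" where
  "alternating_forms E p x = {\<alpha>.
     (\<forall>vs. \<not> (length vs = p \<and> set vs \<subseteq> fibre E x) \<longrightarrow> \<alpha> vs = 0) \<and>
     (\<forall>vs i u v a b. length vs = p \<and> set vs \<subseteq> fibre E x \<and> i < p \<and>
        u \<in> fibre E x \<and> v \<in> fibre E x \<longrightarrow>
        \<alpha> (vs[i := fadd E (fscale E a u) (fscale E b v)]) = a * \<alpha> (vs[i := u]) + b * \<alpha> (vs[i := v])) \<and>
     (\<forall>vs. length vs = p \<and> set vs \<subseteq> fibre E x \<and> \<not> distinct vs \<longrightarrow> \<alpha> vs = 0)}"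

text \<open>
  Smooth sections of the \<open>p\<close>-th exterior power of the dual bundle. A trivialisation \<open>h\<close> of the bundle
  over \<open>U\<close> induces one of this exterior power, in which a section is smooth iff its components, i.e.
  its values on the local sections \<open>x \<mapsto> inv_into (fibre E x) h b\<close> with \<open>b\<close> a fixed vector of the
  typical fibre, are smooth on \<open>U\<close>. Outside the base a form is 0.
\<close>

definition forms ::
  "('m, 'a::real_inner, 'e, 'f::real_inner, 'z) bundle_data_scheme \<Rightarrow> nat \<Rightarrow> ('m \<Rightarrow> 'e list \<Rightarrow> real) set" where
  "forms E p = {\<omega>.
     (\<forall>x\<in>points (base_atlas E). \<omega> x \<in> alternating_forms E p x) \<and>
     (\<forall>x. x \<notin> points (base_atlas E) \<longrightarrow> (\<forall>vs. \<omega> x vs = 0)) \<and>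
     (\<forall>U h bs. local_trivialisation E U h \<and> length bs = p \<longrightarrow>
        (\<lambda>x. \<omega> x (map (inv_into (fibre E x) h) bs)) \<in> smooth_functions (restrict_atlas (base_atlas E) U))}"

definition form_eval :: "('m \<Rightarrow> 'e list \<Rightarrow> real) \<Rightarrow> ('m \<Rightarrow> 'e) list \<Rightarrow> 'm \<Rightarrow> real" where
  "form_eval \<omega> Vs x = \<omega> x (map (\<lambda>V. V x) Vs)"

definition form_of_fun ::
  "('m, 'a, 'e, 'f, 'z) bundle_data_scheme \<Rightarrow> ('m \<Rightarrow> real) \<Rightarrow> 'm \<Rightarrow> 'e list \<Rightarrow> real" where
  "form_of_fun E f = (\<lambda>x vs. if x \<in> points (base_atlas E) \<and> vs = [] then f x else 0)"

text \<open>
  The direct sum of the spaces of forms of all degrees: families with finitely many nonzero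
  components. As there are no nonzero forms of negative degree, degrees are natural numbers.
\<close>

type_synonym ('m, 'e) graded_form = "nat \<Rightarrow> 'm \<Rightarrow> 'e list \<Rightarrow> real"

definition all_forms ::
  "('m, 'a::real_inner, 'e, 'f::real_inner, 'z) bundle_data_scheme \<Rightarrow> ('m, 'e) graded_form set" where
  "all_forms E = {\<omega>. (\<forall>p. \<omega> p \<in> forms E p) \<and> finite {p. \<omega> p \<noteq> (\<lambda>x vs. 0)}}"

definition homogeneous :: "nat \<Rightarrow> ('m \<Rightarrow> 'e list \<Rightarrow> real) \<Rightarrow> ('m, 'e) graded_form" where
  "homogeneous p \<eta> = (\<lambda>q. if q = p then \<eta> else (\<lambda>x vs. 0))"

definition graded_endomorphism ::
  "('m, 'a::real_inner, 'e, 'f::real_inner, 'z) bundle_data_scheme \<Rightarrow> nat \<Rightarrow>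
     (('m, 'e) graded_form \<Rightarrow> ('m, 'e) graded_form) \<Rightarrow> bool" where
  "graded_endomorphism E k d \<longleftrightarrow>
     d \<in> all_forms E \<rightarrow>\<^sub>E all_forms E \<and>
     (\<forall>\<omega>\<in>all_forms E. \<forall>\<theta>\<in>all_forms E. \<forall>a b.
        d (\<lambda>p x vs. a * \<omega> p x vs + b * \<theta> p x vs) = (\<lambda>p x vs. a * d \<omega> p x vs + b * d \<theta> p x vs)) \<and>
     (\<forall>p. d ` homogeneous p ` forms E p \<subseteq> homogeneous (p + k) ` forms E (p + k))"

record ('m, 'a, 'e, 'f) anchored_bundle = "('m, 'a, 'e, 'f) bundle_data" +
  anchor :: "'e \<Rightarrow> ('m, 'a) tangent"
  bracket :: "('m \<Rightarrow> 'e) \<Rightarrow> ('m \<Rightarrow> 'e) \<Rightarrow> 'm \<Rightarrow> 'e"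

definition bundle_map_to_tangent ::
  "('m, 'a::real_inner, 'e, 'f::real_inner, 'z) bundle_data_scheme \<Rightarrow> ('e \<Rightarrow> ('m, 'a) tangent) \<Rightarrow> bool" where
  "bundle_map_to_tangent E \<rho> \<longleftrightarrow>
     smooth_map (total_atlas E) (tangent_atlas (base_atlas E)) \<rho> \<and>
     (\<forall>e\<in>points (total_atlas E). fst (\<rho> e) = proj E e) \<and>
     (\<forall>x\<in>points (base_atlas E). \<forall>u\<in>fibre E x. \<forall>v\<in>fibre E x. \<forall>c.
        snd (\<rho> (fadd E u v)) c = snd (\<rho> u) c + snd (\<rho> v) c) \<and>
     (\<forall>x\<in>points (base_atlas E). \<forall>u\<in>fibre E x. \<forall>a c.
        snd (\<rho> (fscale E a u)) c = a *\<^sub>R snd (\<rho> u) c)"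

definition lie_bracket_on_sections ::
  "('m, 'a::real_inner, 'e, 'f::real_inner, 'z) bundle_data_scheme \<Rightarrow>
     (('m \<Rightarrow> 'e) \<Rightarrow> ('m \<Rightarrow> 'e) \<Rightarrow> 'm \<Rightarrow> 'e) \<Rightarrow> bool" where
  "lie_bracket_on_sections E br \<longleftrightarrow>
     (\<forall>s\<in>sections E. \<forall>t\<in>sections E. br s t \<in> sections E) \<and>
     (\<forall>s\<in>sections E. \<forall>t\<in>sections E. \<forall>u\<in>sections E.
        br (sec_add E s t) u = sec_add E (br s u) (br t u) \<and>
        br u (sec_add E s t) = sec_add E (br u s) (br u t)) \<and>
     (\<forall>a. \<forall>s\<in>sections E. \<forall>t\<in>sections E.
        br (sec_mult E (\<lambda>_. a) s) t = sec_mult E (\<lambda>_. a) (br s t) \<and>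
        br s (sec_mult E (\<lambda>_. a) t) = sec_mult E (\<lambda>_. a) (br s t)) \<and>
     (\<forall>s\<in>sections E. br s s = sec_zero E) \<and>
     (\<forall>s\<in>sections E. \<forall>t\<in>sections E. \<forall>u\<in>sections E.
        sec_add E (br s (br t u)) (sec_add E (br t (br u s)) (br u (br s t))) = sec_zero E)"

definition rho_derivative ::
  "('m, 'a::real_inner, 'e, 'f, 'z) anchored_bundle_scheme \<Rightarrow> ('m \<Rightarrow> 'e) \<Rightarrow> ('m \<Rightarrow> real) \<Rightarrow> 'm \<Rightarrow> real" where
  "rho_derivative E V f = lie_derivative (base_atlas E) (anchor E \<circ> V) f"

definition transpose_anchor ::
  "('m, 'a, 'e, 'f, 'z) anchored_bundle_scheme \<Rightarrow> (('m, 'a) tangent \<Rightarrow> real) \<Rightarrow> 'e \<Rightarrow> real" where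
  "transpose_anchor E \<xi> e = \<xi> (anchor E e)"

definition lie_algebroid ::
  "('m, 'a::real_inner, 'e, 'f::real_inner, 'z) anchored_bundle_scheme \<Rightarrow> bool" where
  "lie_algebroid E \<longleftrightarrow>
     vector_bundle E \<and> bundle_map_to_tangent E (anchor E) \<and>
     lie_bracket_on_sections E (bracket E) \<and>
     (\<forall>s\<in>sections E. \<forall>t\<in>sections E. \<forall>f\<in>smooth_functions (base_atlas E).
        bracket E s (sec_mult E f t) =
        sec_add E (sec_mult E f (bracket E s t)) (sec_mult E (rho_derivative E s f) t))"

definition unique_such_that :: "('x \<Rightarrow> bool) \<Rightarrow> 'x \<Rightarrow> bool" where
  "unique_such_that P w \<longleftrightarrow> P w \<and> (\<forall>w'. P w' \<longrightarrow> w' = w)"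

end

theory Submission
  imports Defs "HOL-Library.Function_Algebras"
begin

text \<open>
  Since global sections take all values in every fibre (this needs bump functions), a form is
  determined by its values on sections, which gives all the uniqueness claims. For existence, the
  right-hand side \<open>F(V\<^sub>0,\<dots>,V\<^sub>p)\<close> of the formula is characterised by Cartan's recursion
  \<open>i\<^sub>V d = L\<^sub>V - d i\<^sub>V\<close>, from which it follows by induction on \<open>p\<close> that \<open>F\<close> is alternating and linear
  over smooth functions. A section vanishing at \<open>x\<close> is near \<open>x\<close> a
  combination of sections with coefficients vanishing at \<open>x\<close>, so linearity over functions makes
  \<open>F(V\<^sub>0,\<dots>,V\<^sub>p)(x)\<close> depend only on the values \<open>V\<^sub>i(x)\<close>, and \<open>F\<close> comes from a form. That form is smooth
  because local frames agree near any given point with global sections.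
\<close>

text \<open>Checking on the explicit formula that F is alternating and linear over functions means
  cancelling signed double sums whose single terms are not linear for p \<ge> 1. In the recursion,
  L_V \<eta> and, by induction, d(i_V \<eta>) are already alternating and linear in the remaining
  arguments, so only the first argument is left. Additivity in it and vanishing on V, V, ... are
  direct. Linearity over functions is not, since V \<mapsto> L_V \<eta> lacks it; it comes from
  exchanging the first argument with the second. Hence alternation precedes linearity, and degree 0,
  which has no second argument, rests on the linearity of the anchor.

  The second obstacle: linearity concerns global functions and sections, coordinates are local.
  Multiplying a section by \<kappa>^2, with \<kappa> a bump function, makes its coordinates and the
  frame global, at the price of one factor \<kappa> each.\<close>

section \<open>Smooth maps between finite-dimensional spaces\<close>

text \<open>A frame may contain 0, whose coefficient is 0 because \<open>x / 0 = 0\<close>.\<close>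

definition frame :: "'a::real_inner set \<Rightarrow> bool" where
  "frame C \<longleftrightarrow> finite C \<and> (\<forall>x. (\<Sum>c\<in>C. ((x \<bullet> c) / (c \<bullet> c)) *\<^sub>R c) = x)"

text \<open>Gram-Schmidt without normalisation: in an orthogonal spanning set the coefficient of x
  at c is \<open>(x \<bullet> c) / (c \<bullet> c)\<close>.\<close>

lemma frame_exists:
  assumes "finite B" and "span B = (UNIV :: 'a::real_inner set)"
  shows "\<exists>C::'a set. frame C"
proof -
  obtain C where C: "finite C" "span C = span B" "pairwise orthogonal C"
    using basis_orthogonal[OF assms(1)] by blast
  have "(\<Sum>c\<in>C. ((x \<bullet> c) / (c \<bullet> c)) *\<^sub>R c) = x" for x
  proof -
    have "x \<in> span C" using C(2) assms(2) by simp
    then obtain u where u: "x = (\<Sum>v\<in>C. u v *\<^sub>R v)"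
      using span_finite[OF C(1)] by auto
    have "((x \<bullet> c) / (c \<bullet> c)) *\<^sub>R c = u c *\<^sub>R c" if "c \<in> C" for c
    proof -
      have "x \<bullet> c = (\<Sum>v\<in>C. u v * (v \<bullet> c))"
        by (simp add: u inner_sum_left)
      also have "\<dots> = (\<Sum>v\<in>C. if v = c then u c * (c \<bullet> c) else 0)"
        using C(3) that by (intro sum.cong) (auto simp: pairwise_def orthogonal_def)
      also have "\<dots> = u c * (c \<bullet> c)" using C(1) that by simp
      finally show ?thesis by simp
    qed
    then have "(\<Sum>c\<in>C. ((x \<bullet> c) / (c \<bullet> c)) *\<^sub>R c) = (\<Sum>c\<in>C. u c *\<^sub>R c)"
      by (rule sum.cong[OF refl])
    then show ?thesis using u by metis
  qed
  then show ?thesis using C(1) unfolding frame_def by blast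
qed

text \<open>The source of all later expansions of derivatives in their direction and of forms in one
  of their arguments.\<close>

lemma frame_image_sum:
  assumes "frame C" and "linear l"
  shows "(\<Sum>c\<in>C. ((x \<bullet> c) / (c \<bullet> c)) *\<^sub>R l c) = l x"
proof -
  have "l x = l (\<Sum>c\<in>C. ((x \<bullet> c) / (c \<bullet> c)) *\<^sub>R c)" using assms by (simp add: frame_def)
  also have "\<dots> = (\<Sum>c\<in>C. ((x \<bullet> c) / (c \<bullet> c)) *\<^sub>R l c)"
    using assms(2) by (simp add: linear_sum linear_cmul)
  finally show ?thesis ..
qed

lemma frame_Times:
  assumes "frame (C :: 'a::real_inner set)" and "frame (D :: 'b::real_inner set)"
  shows "\<exists>F :: ('a \<times> 'b) set. frame F"
proof (rule frame_exists)
  show "finite ((\<lambda>c. (c, 0)) ` C \<union> (\<lambda>d. (0, d)) ` D)" (is "finite ?B")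
    using assms by (simp add: frame_def)
  have "(x, y) \<in> span ?B" for x :: 'a and y :: 'b
  proof -
    have "(\<Sum>c\<in>C. ((x \<bullet> c) / (c \<bullet> c)) *\<^sub>R (c, 0::'b)) \<in> span ?B"
      by (intro span_sum span_scale span_base) auto
    moreover have "(\<Sum>c\<in>C. ((x \<bullet> c) / (c \<bullet> c)) *\<^sub>R (c, 0::'b)) = (x, 0)"
      by (rule frame_image_sum[OF assms(1)])
        (auto intro!: bounded_linear.linear bounded_linear_Pair bounded_linear_ident bounded_linear_zero)
    moreover have "(\<Sum>d\<in>D. ((y \<bullet> d) / (d \<bullet> d)) *\<^sub>R (0::'a, d)) \<in> span ?B"
      by (intro span_sum span_scale span_base) auto
    moreover have "(\<Sum>d\<in>D. ((y \<bullet> d) / (d \<bullet> d)) *\<^sub>R (0::'a, d)) = (0, y)"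
      by (rule frame_image_sum[OF assms(2)])
        (auto intro!: bounded_linear.linear bounded_linear_Pair bounded_linear_ident bounded_linear_zero)
    ultimately have "(x, 0) + (0, y) \<in> span ?B" by (metis span_add)
    then show ?thesis by simp
  qed
  then show "span ?B = UNIV" by auto
qed

text \<open>False in infinite dimension, so the frame has to enter: the ball lies in a set of
  combinations with bounded coefficients, which is contained in a compact set. Bump functions get
  their closed supports from this.\<close>

lemma compact_cball_frame:
  assumes "frame (C :: 'a::real_inner set)"
  shows "compact (cball (a::'a) r)"
proof -
  \<comment> \<open>The compact set is built one coefficient at a time, as a continuous image of an
    interval times the previous compact set.\<close>
  have *: "\<exists>K. compact K \<and> (\<forall>t. (\<forall>c\<in>F. \<bar>t c\<bar> \<le> R) \<longrightarrow> (\<Sum>c\<in>F. t c *\<^sub>R c) \<in> K)"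
    if "finite F" for F :: "'a set" and R :: real
    using that
  proof induction
    case empty
    show ?case by (rule exI[of _ "{0}"]) auto
  next
    case (insert c F)
    then obtain K where K: "compact K" "\<And>t. (\<forall>c\<in>F. \<bar>t c\<bar> \<le> R) \<Longrightarrow> (\<Sum>c\<in>F. t c *\<^sub>R c) \<in> K" by blast
    let ?K = "(\<lambda>(t, y). t *\<^sub>R c + y) ` ({-R..R} \<times> K)"
    have "compact ?K" using K(1)
      by (intro compact_continuous_image compact_Times)
        (auto simp: case_prod_unfold intro!: continuous_intros)
    moreover have "(\<Sum>c\<in>insert c F. t c *\<^sub>R c) \<in> ?K" if "\<forall>c\<in>insert c F. \<bar>t c\<bar> \<le> R" for t
    proof -
      have "(t c, \<Sum>c\<in>F. t c *\<^sub>R c) \<in> {-R..R} \<times> K" using that K(2)[of t] by auto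
      then show ?thesis using insert.hyps by (force intro: image_eqI)
    qed
    ultimately show ?case by blast
  qed
  have fC: "finite C" using assms by (simp add: frame_def)
  \<comment> \<open>Points of the ball have norm at most R, and Cauchy-Schwarz bounds the
    coefficient at c by the summand of R'; the sum dominates all these bounds at once. The absolute
    value keeps the summands nonnegative even if r is so negative that R < 0.\<close>
  define R where "R = r + norm a"
  define R' where "R' = (\<Sum>c\<in>C. \<bar>R\<bar> * norm c / (c \<bullet> c))"
  obtain K where K: "compact K" "\<And>t. (\<forall>c\<in>C. \<bar>t c\<bar> \<le> R') \<Longrightarrow> (\<Sum>c\<in>C. t c *\<^sub>R c) \<in> K"
    using *[OF fC, of R'] by blast
  have "cball a r \<subseteq> K"
  proof
    fix x assume "x \<in> cball a r"
    then have "norm (x - a) \<le> r" by (simp add: dist_norm norm_minus_commute)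
    then have nx: "norm x \<le> \<bar>R\<bar>" unfolding R_def using norm_triangle_sub[of x a] by linarith
    have "\<bar>(x \<bullet> c) / (c \<bullet> c)\<bar> \<le> R'" if "c \<in> C" for c
    proof -
      have "\<bar>x \<bullet> c\<bar> \<le> \<bar>R\<bar> * norm c"
        using Cauchy_Schwarz_ineq2[of x c] mult_right_mono[OF nx, of "norm c"] by simp
      then have "\<bar>(x \<bullet> c) / (c \<bullet> c)\<bar> \<le> \<bar>R\<bar> * norm c / (c \<bullet> c)"
        by (simp add: abs_divide divide_right_mono)
      also have "\<dots> \<le> R'" unfolding R'_def using fC that by (intro member_le_sum) auto
      finally show ?thesis .
    qed
    then have "(\<Sum>c\<in>C. ((x \<bullet> c) / (c \<bullet> c)) *\<^sub>R c) \<in> K" by (intro K(2)) auto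
    then show "x \<in> K" using assms by (simp add: frame_def)
  qed
  then have "compact (K \<inter> cball a r)" using K(1) by (intro compact_Int_closed) auto
  with \<open>cball a r \<subseteq> K\<close> show ?thesis by (simp add: Int_absorb1)
qed

section \<open>Calculus of C^k maps, by induction on the order\<close>

lemma frechet_derivative_cong_open:
  assumes "open S" and "x \<in> S" and eq: "\<And>y. y \<in> S \<Longrightarrow> f y = g y"
  shows "frechet_derivative f (at x) = frechet_derivative g (at x)"
    and "f differentiable at x \<longleftrightarrow> g differentiable at x"
proof -
  have iff: "(f has_derivative D) (at x) \<longleftrightarrow> (g has_derivative D) (at x)" for D
    using has_derivative_transform_within_open[of f D x UNIV S g]
      has_derivative_transform_within_open[of g D x UNIV S f] assms by auto
  show "frechet_derivative f (at x) = frechet_derivative g (at x)"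
    by (simp add: frechet_derivative_def iff)
  show "f differentiable at x \<longleftrightarrow> g differentiable at x"
    by (simp add: differentiable_def iff)
qed

lemma Ck_on_cong:
  assumes "Ck_on k S f" and "open S" and "\<And>x. x \<in> S \<Longrightarrow> f x = g x"
  shows "Ck_on k S g"
  using assms
proof (induction k arbitrary: f g)
  case 0
  then show ?case using continuous_on_cong by force
next
  case (Suc k)
  have "Ck_on k S (\<lambda>x. frechet_derivative g (at x) v)" for v
  proof (rule Suc.IH)
    show "Ck_on k S (\<lambda>x. frechet_derivative f (at x) v)" using Suc.prems by simp
    show "frechet_derivative f (at x) v = frechet_derivative g (at x) v" if "x \<in> S" for x
      using frechet_derivative_cong_open(1)[OF \<open>open S\<close> that, of f g] Suc.prems(3) by simp
  qed (rule \<open>open S\<close>)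
  moreover have "g differentiable at x" if "x \<in> S" for x
    using frechet_derivative_cong_open(2)[OF \<open>open S\<close> that, of f g] Suc.prems that by simp
  ultimately show ?case by simp
qed

lemma Ck_on_subset: "Ck_on k S f \<Longrightarrow> T \<subseteq> S \<Longrightarrow> Ck_on k T f"
  by (induction k arbitrary: f) (auto intro: continuous_on_subset)

lemma Ck_on_Suc_imp: "Ck_on (Suc k) S f \<Longrightarrow> Ck_on k S f"
proof (induction k arbitrary: f)
  case 0
  then show ?case
    by (auto intro!: continuous_at_imp_continuous_on differentiable_imp_continuous_within)
next
  case (Suc k)
  then show ?case by (metis Ck_on.simps(2))
qed

lemma Ck_on_local:
  assumes "\<And>x. x \<in> S \<Longrightarrow> \<exists>T. open T \<and> x \<in> T \<and> Ck_on k T f"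
  shows "Ck_on k S f"
  using assms
proof (induction k arbitrary: f)
  case 0
  then show ?case
    by (auto intro!: continuous_at_imp_continuous_on simp: continuous_on_eq_continuous_at)
      (metis continuous_on_eq_continuous_at)
next
  case (Suc k)
  have "Ck_on k S (\<lambda>x. frechet_derivative f (at x) v)" for v
    by (rule Suc.IH) (metis Suc.prems Ck_on.simps(2))
  moreover have "\<forall>x\<in>S. f differentiable at x" by (metis Suc.prems Ck_on.simps(2))
  ultimately show ?case by simp
qed

text \<open>\<open>Ck_on\<close> speaks of \<open>frechet_derivative\<close>, a choice. With an
  explicit derivative D, each rule below reduces to closure properties of \<open>Ck_on k\<close> for
  the formula that defines D.\<close>

lemma Ck_on_SucI:
  assumes "open S" and "\<And>x. x \<in> S \<Longrightarrow> (f has_derivative D x) (at x)"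
    and "\<And>v. Ck_on k S (\<lambda>x. D x v)"
  shows "Ck_on (Suc k) S f"
proof -
  have "Ck_on k S (\<lambda>x. frechet_derivative f (at x) v)" for v
    using assms(3)[of v] assms(1)
    by (rule Ck_on_cong) (metis assms(2) frechet_derivative_at)
  then show ?thesis using assms(2) by (auto simp: differentiable_def)
qed

lemma Ck_on_SucD:
  assumes "Ck_on (Suc k) S f"
  shows "x \<in> S \<Longrightarrow> (f has_derivative frechet_derivative f (at x)) (at x)"
    and "Ck_on k S (\<lambda>x. frechet_derivative f (at x) v)"
  using assms by (auto simp: frechet_derivative_works)

lemma Ck_on_const: "open S \<Longrightarrow> Ck_on k S (\<lambda>x. a)"
  by (induction k arbitrary: a) (auto intro: Ck_on_SucI[where D = "\<lambda>_ _. 0"])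

lemma Ck_on_add:
  "open S \<Longrightarrow> Ck_on k S f \<Longrightarrow> Ck_on k S g \<Longrightarrow> Ck_on k S (\<lambda>x. f x + g x)"
proof (induction k arbitrary: f g)
  case 0
  then show ?case by (auto intro: continuous_intros)
next
  case (Suc k)
  show ?case
  proof (rule Ck_on_SucI[OF Suc.prems(1)])
    show "((\<lambda>x. f x + g x) has_derivative
        (\<lambda>v. frechet_derivative f (at x) v + frechet_derivative g (at x) v)) (at x)" if "x \<in> S" for x
      using Ck_on_SucD(1)[OF Suc.prems(2) that] Ck_on_SucD(1)[OF Suc.prems(3) that]
      by (rule has_derivative_add)
    show "Ck_on k S (\<lambda>x. frechet_derivative f (at x) v + frechet_derivative g (at x) v)" for v
      using Suc.IH[OF Suc.prems(1)] Ck_on_SucD(2)[OF Suc.prems(2)] Ck_on_SucD(2)[OF Suc.prems(3)]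
      by blast
  qed
qed

lemma Ck_on_linear:
  assumes "bounded_linear l"
  shows "open S \<Longrightarrow> Ck_on k S f \<Longrightarrow> Ck_on k S (\<lambda>x. l (f x))"
proof (induction k arbitrary: f)
  case 0
  then show ?case using assms by (auto intro: bounded_linear.continuous_on)
next
  case (Suc k)
  show ?case
  proof (rule Ck_on_SucI[OF Suc.prems(1)])
    show "((\<lambda>x. l (f x)) has_derivative (\<lambda>v. l (frechet_derivative f (at x) v))) (at x)"
      if "x \<in> S" for x
      using bounded_linear.has_derivative[OF assms Ck_on_SucD(1)[OF Suc.prems(2) that]] .
    show "Ck_on k S (\<lambda>x. l (frechet_derivative f (at x) v))" for v
      by (rule Suc.IH[OF Suc.prems(1)]) (rule Ck_on_SucD(2)[OF Suc.prems(2)])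
  qed
qed

text \<open>By the product rule the derivative is a sum of two terms of the same bilinear shape, to
  which the induction hypothesis applies.\<close>

lemma Ck_on_bilinear:
  assumes "bounded_bilinear b"
  shows "open S \<Longrightarrow> Ck_on k S f \<Longrightarrow> Ck_on k S g \<Longrightarrow> Ck_on k S (\<lambda>x. b (f x) (g x))"
proof (induction k arbitrary: f g)
  case 0
  then show ?case using assms by (auto intro: bounded_bilinear.continuous_on)
next
  case (Suc k)
  show ?case
  proof (rule Ck_on_SucI[OF Suc.prems(1)])
    show "((\<lambda>x. b (f x) (g x)) has_derivative
        (\<lambda>v. b (f x) (frechet_derivative g (at x) v) + b (frechet_derivative f (at x) v) (g x))) (at x)"
      if "x \<in> S" for x
      using bounded_bilinear.FDERIV[OF assms Ck_on_SucD(1)[OF Suc.prems(2) that]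
          Ck_on_SucD(1)[OF Suc.prems(3) that]] .
    show "Ck_on k S (\<lambda>x. b (f x) (frechet_derivative g (at x) v) + b (frechet_derivative f (at x) v) (g x))"
      for v
      using Suc.prems
      by (intro Ck_on_add Suc.IH) (auto intro: Ck_on_SucD(2) Ck_on_Suc_imp simp del: Ck_on.simps)
  qed
qed

lemma Ck_on_sum:
  assumes "open S" and "\<And>i. i \<in> I \<Longrightarrow> Ck_on k S (f i)"
  shows "Ck_on k S (\<lambda>x. \<Sum>i\<in>I. f i x)"
  using assms(2)
  by (induction I rule: infinite_finite_induct) (auto intro: Ck_on_const Ck_on_add assms(1))

text \<open>In the chain rule \<open>D f (g x) (D g x v)\<close> the direction varies with x, while
  \<open>Ck_on\<close> controls derivatives in fixed directions only. Expanding the direction in a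
  frame of the middle space leaves fixed directions with C^k coefficients.\<close>

lemma Ck_on_compose:
  assumes "frame (C :: 'b::real_inner set)" and "open S" and "open T"
  shows "Ck_on k S g \<Longrightarrow> Ck_on k T f \<Longrightarrow> g ` S \<subseteq> T \<Longrightarrow> Ck_on k S (\<lambda>x. f (g x :: 'b))"
proof (induction k arbitrary: f)
  case 0
  then show ?case by (auto intro: continuous_on_compose2)
next
  case (Suc k)
  let ?D = "\<lambda>f x. frechet_derivative f (at x)"
  show ?case
  proof (rule Ck_on_SucI[OF assms(2)])
    show "((\<lambda>x. f (g x)) has_derivative (\<lambda>v. ?D f (g x) (?D g x v))) (at x)" if "x \<in> S" for x
      using Suc.prems that
      by (intro has_derivative_compose[of g _ x UNIV f] Ck_on_SucD(1)) auto
    show "Ck_on k S (\<lambda>x. ?D f (g x) (?D g x v))" for v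
    proof (rule Ck_on_cong[OF _ assms(2)])
      show "Ck_on k S (\<lambda>x. \<Sum>c\<in>C. ((?D g x v \<bullet> c) / (c \<bullet> c)) *\<^sub>R ?D f (g x) c)"
      proof (intro Ck_on_sum[OF assms(2)] Ck_on_bilinear[OF bounded_bilinear_scaleR] assms(2))
        fix c assume "c \<in> C"
        show "Ck_on k S (\<lambda>x. (?D g x v \<bullet> c) / (c \<bullet> c))"
          by (rule Ck_on_linear[OF _ assms(2) Ck_on_SucD(2)[OF Suc.prems(1)]])
            (rule bounded_linear_compose[OF bounded_linear_divide bounded_linear_inner_left])
        show "Ck_on k S (\<lambda>x. ?D f (g x) c)"
          by (rule Suc.IH[OF Ck_on_Suc_imp[OF Suc.prems(1)] Ck_on_SucD(2)[OF Suc.prems(2)] Suc.prems(3)])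
      qed
      show "(\<Sum>c\<in>C. ((?D g x v \<bullet> c) / (c \<bullet> c)) *\<^sub>R ?D f (g x) c) = ?D f (g x) (?D g x v)"
        if "x \<in> S" for x
      proof (rule frame_image_sum[OF assms(1)])
        have "g x \<in> T" using that Suc.prems(3) by auto
        then show "linear (?D f (g x))"
          using Ck_on_SucD(1)[OF Suc.prems(2)] by (metis has_derivative_linear)
      qed
    qed
  qed
qed

text \<open>The derivative of 1/x in direction v is -v (1/x)(1/x), a product of functions that are
  C^k by induction.\<close>

lemma Ck_on_inverse: "Ck_on k (- {0::real}) inverse"
proof (induction k)
  case 0
  then show ?case by (auto intro: continuous_intros)
next
  case (Suc k)
  show ?case
  proof (rule Ck_on_SucI)
    show "(inverse has_derivative (\<lambda>h. - (inverse x * h * inverse x))) (at x)"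
      if "x \<in> - {0}" for x :: real
      using that by (intro has_derivative_inverse') auto
    show "Ck_on k (- {0}) (\<lambda>x. - (inverse x * v * inverse x))" for v :: real
    proof -
      have "Ck_on k (- {0}) (\<lambda>x. - v * (inverse x * inverse x))"
        using Suc.IH
        by (intro Ck_on_bilinear[OF bounded_bilinear_mult]) (auto intro!: Ck_on_const)
      then show ?thesis by (rule Ck_on_cong) auto
    qed
  qed auto
qed

section \<open>The same rules for smooth maps\<close>

lemma smooth_on_imp_continuous: "smooth_on S f \<Longrightarrow> continuous_on S f"
  unfolding smooth_on_def using Ck_on.simps(1) by blast

lemma smooth_on_cong:
  "smooth_on S f \<Longrightarrow> open S \<Longrightarrow> (\<And>x. x \<in> S \<Longrightarrow> f x = g x) \<Longrightarrow> smooth_on S g"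
  unfolding smooth_on_def using Ck_on_cong by blast

lemma smooth_on_subset: "smooth_on S f \<Longrightarrow> T \<subseteq> S \<Longrightarrow> smooth_on T f"
  unfolding smooth_on_def using Ck_on_subset by blast

lemma smooth_on_local:
  assumes "\<And>x. x \<in> S \<Longrightarrow> \<exists>T. open T \<and> x \<in> T \<and> smooth_on T f"
  shows "smooth_on S f"
  unfolding smooth_on_def
  by (intro allI Ck_on_local) (meson assms smooth_on_def)

lemma smooth_on_derivative:
  assumes "smooth_on S f"
  shows "x \<in> S \<Longrightarrow> (f has_derivative frechet_derivative f (at x)) (at x)"
    and "smooth_on S (\<lambda>x. frechet_derivative f (at x) v)"
  using assms Ck_on_SucD unfolding smooth_on_def by blast+

lemma smooth_on_const: "open S \<Longrightarrow> smooth_on S (\<lambda>x. a)"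
  unfolding smooth_on_def using Ck_on_const by blast

lemma smooth_on_add:
  "open S \<Longrightarrow> smooth_on S f \<Longrightarrow> smooth_on S g \<Longrightarrow> smooth_on S (\<lambda>x. f x + g x)"
  unfolding smooth_on_def using Ck_on_add by blast

lemma smooth_on_linear:
  "bounded_linear l \<Longrightarrow> open S \<Longrightarrow> smooth_on S f \<Longrightarrow> smooth_on S (\<lambda>x. l (f x))"
  unfolding smooth_on_def using Ck_on_linear by blast

lemma smooth_on_bilinear:
  "bounded_bilinear b \<Longrightarrow> open S \<Longrightarrow> smooth_on S f \<Longrightarrow> smooth_on S g \<Longrightarrow>
    smooth_on S (\<lambda>x. b (f x) (g x))"
  unfolding smooth_on_def using Ck_on_bilinear by blast

lemma smooth_on_compose:
  "frame (C :: 'b::real_inner set) \<Longrightarrow> open S \<Longrightarrow> open T \<Longrightarrow> smooth_on S g \<Longrightarrow> smooth_on T f \<Longrightarrow>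
    g ` S \<subseteq> T \<Longrightarrow> smooth_on S (\<lambda>x. f (g x :: 'b))"
  unfolding smooth_on_def using Ck_on_compose by blast

lemma smooth_on_id: "open S \<Longrightarrow> smooth_on S (\<lambda>x. x)"
proof -
  assume "open S"
  have "Ck_on k S (\<lambda>x. x)" for k
  proof (cases k)
    case (Suc n)
    show ?thesis unfolding Suc
      by (rule Ck_on_SucI[OF \<open>open S\<close>, where D = "\<lambda>_ v. v"]) (auto intro: Ck_on_const \<open>open S\<close>)
  qed auto
  then show ?thesis by (simp add: smooth_on_def)
qed

lemma smooth_on_Pair:
  assumes "open S" and "smooth_on S f" and "smooth_on S g"
  shows "smooth_on S (\<lambda>x. (f x, g x))"
proof -
  have "smooth_on S (\<lambda>x. (f x, 0) + (0, g x))"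
    using assms
    by (intro smooth_on_add smooth_on_linear[where l = "\<lambda>y. (y, 0)"] smooth_on_linear[where l = "\<lambda>y. (0, y)"])
      (auto intro: bounded_linear_Pair bounded_linear_ident bounded_linear_zero)
  then show ?thesis by simp
qed

lemma frame_real: "frame {1::real}"
  by (simp add: frame_def)

subsection \<open>A cutoff function on the line\<close>

text \<open>The powers of 1/t make the family closed under differentiation up to linear
  combinations, so one induction on k covers all n. Only \<open>flat 0\<close>, the function
  exp(-1/t), is used afterwards.\<close>

definition flat :: "nat \<Rightarrow> real \<Rightarrow> real" where
  "flat n t = (if t > 0 then inverse t ^ n * exp (- inverse t) else 0)"

lemma flat_limit: "((\<lambda>t. inverse t ^ n * exp (- inverse t)) \<longlongrightarrow> 0) (at_right (0::real))"
proof -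
  have "((\<lambda>x. x ^ n * exp (- x)) \<longlongrightarrow> (0::real)) at_top"
    using tendsto_power_div_exp_0[of n] by (simp add: exp_minus field_simps)
  then show ?thesis
    by (rule filterlim_compose) (rule filterlim_inverse_at_top_right)
qed

lemma flat_deriv: "(flat n has_real_derivative (flat (n + 2) t - n * flat (n + 1) t)) (at t)"
proof (cases "t = 0")
  case False
  have *: "((\<lambda>t. inverse t ^ n * exp (- inverse t)) has_real_derivative
      (inverse t ^ (n + 2) * exp (- inverse t) - n * (inverse t ^ (n + 1) * exp (- inverse t)))) (at t)"
    using False
  proof -
    have "((\<lambda>t. inverse t ^ n * exp (- inverse t)) has_real_derivative
      (n * (inverse t ^ (n - Suc 0) * (- (inverse t * inverse t))) * exp (- inverse t)
        + inverse t ^ n * (exp (- inverse t) * (inverse t * inverse t)))) (at t)"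
      using False by (auto intro!: derivative_eq_intros simp del: power_Suc)
    \<comment> \<open>The exponent \<open>n - Suc 0\<close> truncates at n = 0, where the factor n
      removes the term.\<close>
    then show ?thesis by (cases n) (simp_all add: algebra_simps)
  qed
  show ?thesis
  proof (cases "t > 0")
    case True
    have "(flat n has_real_derivative
      (inverse t ^ (n + 2) * exp (- inverse t) - n * (inverse t ^ (n + 1) * exp (- inverse t)))) (at t)"
      by (rule has_field_derivative_transform_within_open[OF *, of "{0<..}"])
        (use True in \<open>auto simp: flat_def\<close>)
    then show ?thesis using True by (simp add: flat_def)
  next
    case F2: False
    have "(flat n has_real_derivative 0) (at t)"
      by (rule has_field_derivative_transform_within_open[where f = "\<lambda>_. 0" and S = "{..<0}"])
        (use False F2 in \<open>auto simp: flat_def\<close>)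
    then show ?thesis using F2 by (simp add: flat_def)
  qed
next
  case True
  \<comment> \<open>To the right of 0 the difference quotient is \<open>flat (Suc n) t\<close>, to
    the left it is 0.\<close>
  have "((\<lambda>t. flat n t / t) \<longlongrightarrow> 0) (at_right 0)"
    by (rule Lim_transform_eventually[OF flat_limit[of "Suc n"]])
      (auto simp: eventually_at_right_field flat_def field_simps intro!: exI[of _ 1])
  moreover have "((\<lambda>t. flat n t / t) \<longlongrightarrow> 0) (at_left 0)"
    by (rule Lim_transform_eventually[OF tendsto_const])
      (auto simp: eventually_at_left_field flat_def intro!: exI[of _ "-1"])
  ultimately have "((\<lambda>t. flat n t / t) \<longlongrightarrow> 0) (at 0)"
    by (simp add: filterlim_split_at)
  then show ?thesis using True by (simp add: has_field_derivative_iff flat_def)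
qed

lemma smooth_on_flat: "smooth_on UNIV (flat n)"
proof -
  have "Ck_on k UNIV (flat n)" for k n
  proof (induction k arbitrary: n)
    case 0
    show ?case
      using flat_deriv by (auto intro!: continuous_at_imp_continuous_on DERIV_isCont)
  next
    case (Suc k)
    show ?case
    proof (rule Ck_on_SucI)
      show "(flat n has_derivative (\<lambda>h. (flat (n + 2) t - n * flat (n + 1) t) * h)) (at t)" for t
        using flat_deriv[of n t] by (simp add: has_field_derivative_def)
      have "Ck_on k UNIV (\<lambda>x. v * flat (n + 2) x + (- v * n) * flat (n + 1) x)" for v
        using Suc.IH
        by (intro Ck_on_add Ck_on_linear[where l = "\<lambda>y. v * y"]
            Ck_on_linear[where l = "\<lambda>y. (- v * n) * y"] bounded_linear_mult_right) auto
      then show "Ck_on k UNIV (\<lambda>t. (flat (n + 2) t - n * flat (n + 1) t) * v)" for v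
        by (rule Ck_on_cong) (auto simp: algebra_simps)
    qed auto
  qed
  then show ?thesis by (simp add: smooth_on_def)
qed

lemma cutoff_exists:
  fixes a b :: real
  assumes "a < b"
  obtains \<theta> :: "real \<Rightarrow> real"
  where "smooth_on UNIV \<theta>" and "\<And>t. t \<le> a \<Longrightarrow> \<theta> t = 1" and "\<And>t. t \<ge> b \<Longrightarrow> \<theta> t = 0"
proof -
  let ?u = "\<lambda>t. flat 0 (b - t)" and ?v = "\<lambda>t. flat 0 (t - a)"
  \<comment> \<open>The quotient u / (u + v): v vanishes for t \<le> a and u for t \<ge> b. As a <
    b, they never vanish together and the denominator is positive.\<close>
  let ?\<theta> = "\<lambda>t. ?u t * inverse (?u t + ?v t)"
  have pos: "?u t + ?v t > 0" for t
    using assms by (cases "t < b"; cases "t > a") (auto simp: flat_def add_pos_pos)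
  have minus: "smooth_on UNIV (\<lambda>t. b - t)" "smooth_on UNIV (\<lambda>t. t - a)" for a b :: real
  proof -
    have "smooth_on UNIV (\<lambda>t. b + - t)"
      by (rule smooth_on_add[OF open_UNIV smooth_on_const[OF open_UNIV]
          smooth_on_linear[OF bounded_linear_minus[OF bounded_linear_ident] open_UNIV smooth_on_id[OF open_UNIV]]])
    moreover have "smooth_on UNIV (\<lambda>t. t + - a)"
      by (rule smooth_on_add[OF open_UNIV smooth_on_id[OF open_UNIV] smooth_on_const[OF open_UNIV]])
    ultimately show "smooth_on UNIV (\<lambda>t. b - t)" "smooth_on UNIV (\<lambda>t. t - a)" by simp_all
  qed
  have u: "smooth_on UNIV ?u" and v: "smooth_on UNIV ?v"
    by (rule smooth_on_compose[OF frame_real open_UNIV open_UNIV minus(1) smooth_on_flat]; simp)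
      (rule smooth_on_compose[OF frame_real open_UNIV open_UNIV minus(2) smooth_on_flat]; simp)
  have "smooth_on (- {0}) (inverse :: real \<Rightarrow> real)"
    using Ck_on_inverse by (simp add: smooth_on_def)
  then have "smooth_on UNIV (\<lambda>t. inverse (?u t + ?v t))"
    by (intro smooth_on_compose[OF frame_real _ _ smooth_on_add[OF _ u v], of "- {0}"])
      (use pos in \<open>auto simp: less_imp_neq[THEN not_sym]\<close>)
  then have "smooth_on UNIV ?\<theta>"
    by (intro smooth_on_bilinear[OF bounded_bilinear_mult] u) auto
  moreover have "?\<theta> t = 1" if "t \<le> a" for t
    using pos[of t] that by (simp add: flat_def)
  moreover have "?\<theta> t = 0" if "t \<ge> b" for t
    using that by (simp add: flat_def)
  ultimately show ?thesis by (rule that[of ?\<theta>])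
qed

section \<open>Smooth maps between manifolds\<close>

text \<open>The hypothesis under which smooth maps are handled. It passes at once to open subsets
  and to products, which are the sources and targets of trivialisations.\<close>

definition fd_atlas :: "('m, 'a::real_inner) chart set \<Rightarrow> bool" where
  "fd_atlas A \<longleftrightarrow> smooth_atlas A \<and> (\<exists>C::'a set. frame C)"

text \<open>Smoothness for functions into a normed space, on an arbitrary set W and with the charts
  of the whole manifold; it avoids both \<open>std_atlas\<close> and
  \<open>restrict_atlas\<close>.\<close>

definition smooth_fun_on ::
  "('m, 'a::real_inner) chart set \<Rightarrow> 'm set \<Rightarrow> ('m \<Rightarrow> 'b::real_normed_vector) \<Rightarrow> bool" where
  "smooth_fun_on A W f \<longleftrightarrow> (\<forall>(U, \<phi>)\<in>A. smooth_on (\<phi> ` (U \<inter> W)) (\<lambda>y. f (inv_into U \<phi> y)))"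

lemma fd_atlas_smooth: "fd_atlas A \<Longrightarrow> smooth_atlas A"
  by (simp add: fd_atlas_def)

lemma smooth_manifold_fd_atlas: "smooth_manifold A \<Longrightarrow> fd_atlas A"
  unfolding smooth_manifold_def fd_atlas_def using frame_exists by blast

lemma topspace_atlas [simp]: "topspace (atlas_topology A) = points A"
proof -
  have "U \<in> {U \<inter> \<phi> -` T |U \<phi> T. (U, \<phi>) \<in> A \<and> open T}" if "(U, \<phi>) \<in> A" for U \<phi>
    using that open_UNIV by (metis (mono_tags, lifting) CollectI Int_UNIV_right vimage_UNIV)
  then show ?thesis
    unfolding atlas_topology_def points_def topology_generated_by_topspace by blast
qed

lemma points_chart: "(U, \<phi>) \<in> A \<Longrightarrow> U \<subseteq> points A"
  by (auto simp: points_def)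

lemma points_obtain_chart:
  assumes "x \<in> points A" obtains U \<phi> where "(U, \<phi>) \<in> A" and "x \<in> U"
  using assms by (auto simp: points_def)

lemma openin_chart_domain:
  assumes "(U, \<phi>) \<in> A" shows "openin (atlas_topology A) U"
proof -
  have "U \<in> {U \<inter> \<phi> -` T |U \<phi> T. (U, \<phi>) \<in> A \<and> open T}"
    using assms open_UNIV by (metis (mono_tags, lifting) CollectI Int_UNIV_right vimage_UNIV)
  then show ?thesis unfolding atlas_topology_def by (rule topology_generated_by_Basis)
qed

lemma smooth_atlasD:
  assumes "smooth_atlas A" and "(U, \<phi>) \<in> A"
  shows "inj_on \<phi> U" and "open (\<phi> ` U)"
    and "(V, \<psi>) \<in> A \<Longrightarrow> open (\<phi> ` (U \<inter> V))"
    and "(V, \<psi>) \<in> A \<Longrightarrow> smooth_on (\<phi> ` (U \<inter> V)) (\<lambda>y. \<psi> (inv_into U \<phi> y))"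
  using assms unfolding smooth_atlas_def by fastforce+

lemma inv_chart [simp]:
  assumes "smooth_atlas A" and "(U, \<phi>) \<in> A" and "x \<in> U"
  shows "inv_into U \<phi> (\<phi> x) = x"
  using assms smooth_atlasD(1) by (metis inv_into_f_f)

text \<open>The topology is given by generators only. Openness of chart images survives finite
  intersections because charts are injective, and holds for a generator from another chart because
  the change of charts is continuous. Conversely, W is the union of the sets U \<inter> W, and each
  of these is a generator.\<close>

lemma openin_atlas_iff:
  assumes A: "smooth_atlas A"
  shows "openin (atlas_topology A) W \<longleftrightarrow> W \<subseteq> points A \<and> (\<forall>(U, \<phi>)\<in>A. open (\<phi> ` (U \<inter> W)))"
proof
  assume L: "openin (atlas_topology A) W"
  have "generate_topology_on {U \<inter> \<phi> -` T |U \<phi> T. (U, \<phi>) \<in> A \<and> open T} W"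
    using L unfolding atlas_topology_def by (simp add: openin_topology_generated_by)
  then have "\<forall>(U, \<phi>)\<in>A. open (\<phi> ` (U \<inter> W))"
  proof induction
    case Empty
    then show ?case by auto
  next
    case (Int a b)
    show ?case
    proof (clarify)
      fix U \<phi> assume c: "(U, \<phi>) \<in> A"
      have "\<phi> ` (U \<inter> (a \<inter> b)) = \<phi> ` (U \<inter> a) \<inter> \<phi> ` (U \<inter> b)"
        using smooth_atlasD(1)[OF A c] by (auto simp: inj_on_def)
      then show "open (\<phi> ` (U \<inter> (a \<inter> b)))" using Int.IH c by (metis (mono_tags, lifting) case_prodD open_Int)
    qed
  next
    case (UN K)
    show ?case
    proof (clarify)
      fix U \<phi> assume c: "(U, \<phi>) \<in> A"
      have "\<phi> ` (U \<inter> \<Union> K) = (\<Union>k\<in>K. \<phi> ` (U \<inter> k))" by auto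
      moreover have "open (\<phi> ` (U \<inter> k))" if "k \<in> K" for k using UN.IH[OF that] c by auto
      ultimately show "open (\<phi> ` (U \<inter> \<Union> K))" by (simp add: open_UN)
    qed
  next
    case (Basis s)
    then obtain V \<psi> T where s: "s = V \<inter> \<psi> -` T" "(V, \<psi>) \<in> A" "open T" by auto
    show ?case
    proof (clarify)
      fix U \<phi> assume c: "(U, \<phi>) \<in> A"
      have "\<phi> ` (U \<inter> s) = \<phi> ` (U \<inter> V) \<inter> (\<lambda>y. \<psi> (inv_into U \<phi> y)) -` T"
        using inv_chart[OF A c] by (auto simp: s)
      then show "open (\<phi> ` (U \<inter> s))"
        using continuous_open_preimage[OF smooth_on_imp_continuous[OF smooth_atlasD(4)[OF A c s(2)]]
            smooth_atlasD(3)[OF A c s(2)] s(3)] by simp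
    qed
  qed
  then show "W \<subseteq> points A \<and> (\<forall>(U, \<phi>)\<in>A. open (\<phi> ` (U \<inter> W)))"
    using openin_subset[OF L] by auto
next
  assume R: "W \<subseteq> points A \<and> (\<forall>(U, \<phi>)\<in>A. open (\<phi> ` (U \<inter> W)))"
  show "openin (atlas_topology A) W"
  proof (subst openin_subopen, clarify)
    fix x assume x: "x \<in> W"
    then obtain U \<phi> where c: "(U, \<phi>) \<in> A" "x \<in> U" using R by (auto simp: points_def)
    have "U \<inter> \<phi> -` (\<phi> ` (U \<inter> W)) \<in> {U \<inter> \<phi> -` T |U \<phi> T. (U, \<phi>) \<in> A \<and> open T}"
      using R c by blast
    then have "openin (atlas_topology A) (U \<inter> \<phi> -` (\<phi> ` (U \<inter> W)))"
      unfolding atlas_topology_def by (rule topology_generated_by_Basis)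
    moreover have "U \<inter> \<phi> -` (\<phi> ` (U \<inter> W)) = U \<inter> W"
      using smooth_atlasD(1)[OF A c(1)] by (auto simp: inj_on_def)
    ultimately show "\<exists>T. openin (atlas_topology A) T \<and> x \<in> T \<and> T \<subseteq> W" using x c by auto
  qed
qed

lemma open_chart_image:
  assumes "smooth_atlas A" and "(U, \<phi>) \<in> A" and "openin (atlas_topology A) W"
  shows "open (\<phi> ` (U \<inter> W))"
  using assms openin_atlas_iff by fastforce

lemma smooth_fun_onD:
  "smooth_fun_on A W f \<Longrightarrow> (U, \<phi>) \<in> A \<Longrightarrow> smooth_on (\<phi> ` (U \<inter> W)) (\<lambda>y. f (inv_into U \<phi> y))"
  unfolding smooth_fun_on_def by auto

lemma smooth_fun_onI:
  "(\<And>U \<phi>. (U, \<phi>) \<in> A \<Longrightarrow> smooth_on (\<phi> ` (U \<inter> W)) (\<lambda>y. f (inv_into U \<phi> y))) \<Longrightarrow> smooth_fun_on A W f"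
  unfolding smooth_fun_on_def by auto

lemma smooth_fun_on_subset: "smooth_fun_on A W f \<Longrightarrow> T \<subseteq> W \<Longrightarrow> smooth_fun_on A T f"
  unfolding smooth_fun_on_def
  by (fastforce intro: smooth_on_subset)

lemma smooth_fun_on_cong:
  assumes "smooth_fun_on A W f" and "smooth_atlas A" and "openin (atlas_topology A) W"
    and "\<And>x. x \<in> W \<Longrightarrow> f x = g x"
  shows "smooth_fun_on A W g"
proof (rule smooth_fun_onI)
  fix U \<phi> assume c: "(U, \<phi>) \<in> A"
  show "smooth_on (\<phi> ` (U \<inter> W)) (\<lambda>y. g (inv_into U \<phi> y))"
    using smooth_fun_onD[OF assms(1) c] open_chart_image[OF assms(2) c assms(3)]
    by (rule smooth_on_cong) (use assms(4) inv_chart[OF assms(2) c] in auto)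
qed

lemma smooth_fun_on_local:
  assumes "smooth_atlas A"
    and "\<And>x. x \<in> W \<Longrightarrow> \<exists>T. openin (atlas_topology A) T \<and> x \<in> T \<and> smooth_fun_on A T f"
  shows "smooth_fun_on A W f"
proof (rule smooth_fun_onI, rule smooth_on_local)
  fix U \<phi> y assume c: "(U, \<phi>) \<in> A" and "y \<in> \<phi> ` (U \<inter> W)"
  then obtain x where x: "x \<in> U" "x \<in> W" "y = \<phi> x" by auto
  then obtain T where "openin (atlas_topology A) T" "x \<in> T" "smooth_fun_on A T f"
    using assms(2) by blast
  then show "\<exists>T. open T \<and> y \<in> T \<and> smooth_on T (\<lambda>y. f (inv_into U \<phi> y))"
    using open_chart_image[OF assms(1) c] smooth_fun_onD[OF _ c] x by blast
qed

lemma smooth_fun_on_const: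
  assumes "smooth_atlas A" and "openin (atlas_topology A) W"
  shows "smooth_fun_on A W (\<lambda>x. a)"
  by (intro smooth_fun_onI smooth_on_const open_chart_image[OF assms(1) _ assms(2)])

lemma smooth_fun_on_add:
  assumes "smooth_atlas A" and "openin (atlas_topology A) W"
    and "smooth_fun_on A W f" and "smooth_fun_on A W g"
  shows "smooth_fun_on A W (\<lambda>x. f x + g x)"
  by (intro smooth_fun_onI smooth_on_add open_chart_image[OF assms(1) _ assms(2)]
      smooth_fun_onD[OF assms(3)] smooth_fun_onD[OF assms(4)])

lemma smooth_fun_on_sum:
  assumes "smooth_atlas A" and "openin (atlas_topology A) W"
    and "\<And>i. i \<in> I \<Longrightarrow> smooth_fun_on A W (f i)"
  shows "smooth_fun_on A W (\<lambda>x. \<Sum>i\<in>I. f i x)"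
  using assms(3)
  by (induction I rule: infinite_finite_induct)
    (auto intro: smooth_fun_on_const[OF assms(1,2)] smooth_fun_on_add[OF assms(1,2)])

lemma smooth_fun_on_linear:
  assumes "bounded_linear l" and "smooth_atlas A" and "openin (atlas_topology A) W"
    and "smooth_fun_on A W f"
  shows "smooth_fun_on A W (\<lambda>x. l (f x))"
  by (intro smooth_fun_onI smooth_on_linear[OF assms(1)] open_chart_image[OF assms(2) _ assms(3)]
      smooth_fun_onD[OF assms(4)])

lemma smooth_fun_on_bilinear:
  assumes "bounded_bilinear b" and "smooth_atlas A" and "openin (atlas_topology A) W"
    and "smooth_fun_on A W f" and "smooth_fun_on A W g"
  shows "smooth_fun_on A W (\<lambda>x. b (f x) (g x))"
  by (intro smooth_fun_onI smooth_on_bilinear[OF assms(1)] open_chart_image[OF assms(2) _ assms(3)]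
      smooth_fun_onD[OF assms(4)] smooth_fun_onD[OF assms(5)])

lemmas smooth_fun_on_mult = smooth_fun_on_bilinear[OF bounded_bilinear_mult]
lemmas smooth_fun_on_scaleR = smooth_fun_on_bilinear[OF bounded_bilinear_scaleR]

lemma smooth_fun_on_Pair:
  assumes "smooth_atlas A" and "openin (atlas_topology A) W"
    and "smooth_fun_on A W f" and "smooth_fun_on A W g"
  shows "smooth_fun_on A W (\<lambda>x. (f x, g x))"
  by (intro smooth_fun_onI smooth_on_Pair open_chart_image[OF assms(1) _ assms(2)]
      smooth_fun_onD[OF assms(3)] smooth_fun_onD[OF assms(4)])

lemma smooth_fun_on_postcompose:
  assumes "frame (C :: 'b::real_inner set)" and "smooth_atlas A" and "openin (atlas_topology A) W"
    and "smooth_fun_on A W (f :: _ \<Rightarrow> 'b)" and "open T" and "smooth_on T g" and "f ` W \<subseteq> T"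
  shows "smooth_fun_on A W (\<lambda>x. g (f x))"
proof (rule smooth_fun_onI)
  fix U \<phi> assume c: "(U, \<phi>) \<in> A"
  show "smooth_on (\<phi> ` (U \<inter> W)) (\<lambda>y. g (f (inv_into U \<phi> y)))"
    by (rule smooth_on_compose[OF assms(1) open_chart_image[OF assms(2) c assms(3)] assms(5)
          smooth_fun_onD[OF assms(4) c] assms(6)])
      (use assms(7) inv_chart[OF assms(2) c] in auto)
qed

lemma smooth_fun_on_chart_map:
  assumes "smooth_atlas A" and "(U, \<phi>) \<in> A"
  shows "smooth_fun_on A U \<phi>"
  by (intro smooth_fun_onI smooth_atlasD(4)[OF assms(1) _ assms(2)])

lemma openin_smooth_preimage:
  assumes A: "smooth_atlas A" and W: "openin (atlas_topology A) W" and "smooth_fun_on A W f" and "open T"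
  shows "openin (atlas_topology A) (W \<inter> f -` T)"
  unfolding openin_atlas_iff[OF A]
proof (intro conjI, use openin_subset[OF W] in force, clarify)
  fix U \<phi> assume c: "(U, \<phi>) \<in> A"
  have "\<phi> ` (U \<inter> (W \<inter> f -` T)) = \<phi> ` (U \<inter> W) \<inter> (\<lambda>y. f (inv_into U \<phi> y)) -` T"
    using inv_chart[OF A c] by auto
  then show "open (\<phi> ` (U \<inter> (W \<inter> f -` T)))"
    using continuous_open_preimage[OF smooth_on_imp_continuous[OF smooth_fun_onD[OF assms(3) c]]
        open_chart_image[OF A c W] \<open>open T\<close>] by simp
qed

text \<open>One chart of the target around each point suffices: other target charts differ by a
  smooth change of charts, and continuity of f follows from that of its chart expression.\<close>

lemma smooth_mapI:
  fixes B :: "('n, 'b::real_inner) chart set"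
  assumes A: "smooth_atlas A" and B: "fd_atlas B" and sub: "f ` points A \<subseteq> points B"
    and loc: "\<And>x. x \<in> points A \<Longrightarrow> \<exists>W V \<psi>. openin (atlas_topology A) W \<and> x \<in> W \<and> (V, \<psi>) \<in> B \<and>
      f ` W \<subseteq> V \<and> smooth_fun_on A W (\<lambda>x. \<psi> (f x))"
  shows "smooth_map A B f"
proof -
  note B' = fd_atlas_smooth[OF B]
  obtain C :: "'b set" where C: "frame C" using B by (auto simp: fd_atlas_def)
  have pre: "\<exists>T. openin (atlas_topology A) T \<and> x \<in> T \<and> f ` T \<subseteq> Q"
    if Q: "openin (atlas_topology B) Q" and x: "x \<in> points A" "f x \<in> Q" for Q x
  proof -
    obtain W V \<psi> where W: "openin (atlas_topology A) W" "x \<in> W" "(V, \<psi>) \<in> B"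
      "f ` W \<subseteq> V" "smooth_fun_on A W (\<lambda>x. \<psi> (f x))" using loc[OF x(1)] by blast
    have "openin (atlas_topology A) (W \<inter> (\<lambda>x. \<psi> (f x)) -` (\<psi> ` (V \<inter> Q)))"
      by (rule openin_smooth_preimage[OF A W(1,5) open_chart_image[OF B' W(3) Q]])
    moreover have "f ` (W \<inter> (\<lambda>x. \<psi> (f x)) -` (\<psi> ` (V \<inter> Q))) \<subseteq> Q"
      using W(4) smooth_atlasD(1)[OF B' W(3)] by (auto simp: inj_on_def image_subset_iff)
    moreover have "x \<in> W \<inter> (\<lambda>x. \<psi> (f x)) -` (\<psi> ` (V \<inter> Q))" using W x by auto
    ultimately show ?thesis by blast
  qed
  have pre': "openin (atlas_topology A) {x \<in> points A. f x \<in> Q}"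
    if Q: "openin (atlas_topology B) Q" for Q
  proof (subst openin_subopen, clarify)
    fix x assume "x \<in> points A" "f x \<in> Q"
    then obtain T where "openin (atlas_topology A) T" "x \<in> T" "f ` T \<subseteq> Q" using pre[OF Q] by blast
    moreover have "T \<subseteq> points A" using openin_subset[OF \<open>openin _ T\<close>] by simp
    ultimately show "\<exists>T. openin (atlas_topology A) T \<and> x \<in> T \<and> T \<subseteq> {x \<in> points A. f x \<in> Q}" by blast
  qed
  have "continuous_map (atlas_topology A) (atlas_topology B) f"
    using sub pre' by (auto simp: continuous_map)
  moreover have "smooth_on (\<phi> ` (U \<inter> f -` V')) (\<lambda>y. \<psi>' (f (inv_into U \<phi> y)))"
    if c: "(U, \<phi>) \<in> A" and d': "(V', \<psi>') \<in> B" for U \<phi> V' \<psi>'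
  proof (rule smooth_on_local)
    fix y assume "y \<in> \<phi> ` (U \<inter> f -` V')"
    then obtain x where x: "x \<in> U" "f x \<in> V'" "y = \<phi> x" by auto
    then have "x \<in> points A" using points_chart[OF c] by auto
    then obtain W V \<psi> where W: "openin (atlas_topology A) W" "x \<in> W" "(V, \<psi>) \<in> B"
      "f ` W \<subseteq> V" "smooth_fun_on A W (\<lambda>x. \<psi> (f x))" using loc by blast
    let ?T = "W \<inter> (\<lambda>x. \<psi> (f x)) -` (\<psi> ` (V \<inter> V'))"
    have oT: "openin (atlas_topology A) ?T"
      by (rule openin_smooth_preimage[OF A W(1,5) smooth_atlasD(3)[OF B' W(3) d']])
    have "smooth_fun_on A ?T (\<lambda>x. \<psi>' (inv_into V \<psi> (\<psi> (f x))))"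
      by (rule smooth_fun_on_postcompose[OF C A oT _ smooth_atlasD(3)[OF B' W(3) d']
            smooth_atlasD(4)[OF B' W(3) d']])
        (use smooth_fun_on_subset[OF W(5)] in auto)
    then have "smooth_fun_on A ?T (\<lambda>x. \<psi>' (f x))"
    proof (rule smooth_fun_on_cong[OF _ A oT])
      fix x assume "x \<in> ?T"
      then have "f x \<in> V" using W(4) by auto
      then show "\<psi>' (inv_into V \<psi> (\<psi> (f x))) = \<psi>' (f x)" using inv_chart[OF B' W(3)] by simp
    qed
    then show "\<exists>T. open T \<and> y \<in> T \<and> smooth_on T (\<lambda>y. \<psi>' (f (inv_into U \<phi> y)))"
      using open_chart_image[OF A c oT] smooth_fun_onD[OF _ c] x W(2,4)
      by (intro exI[of _ "\<phi> ` (U \<inter> ?T)"] conjI) auto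
  qed
  ultimately show ?thesis by (auto simp: smooth_map_def)
qed

lemma smooth_map_continuous:
  "smooth_map A B f \<Longrightarrow> continuous_map (atlas_topology A) (atlas_topology B) f"
  by (simp add: smooth_map_def)

lemma smooth_map_points: "smooth_map A B f \<Longrightarrow> x \<in> points A \<Longrightarrow> f x \<in> points B"
  using smooth_map_continuous[of A B f] by (auto simp: continuous_map)

lemma openin_map_preimage:
  assumes "smooth_map A B f" and "openin (atlas_topology B) W"
  shows "openin (atlas_topology A) (points A \<inter> f -` W)"
proof -
  have "points A \<inter> f -` W = {x \<in> topspace (atlas_topology A). f x \<in> W}" by auto
  then show ?thesis
    using smooth_map_continuous[OF assms(1)] assms(2) by (metis openin_continuous_map_preimage)
qed

lemma smooth_mapD:
  assumes f: "smooth_map A B f" and "(V, \<psi>) \<in> B"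
  shows "smooth_fun_on A (points A \<inter> f -` V) (\<lambda>x. \<psi> (f x))"
proof (rule smooth_fun_onI)
  fix U \<phi> assume c: "(U, \<phi>) \<in> A"
  have "U \<inter> (points A \<inter> f -` V) = U \<inter> f -` V" using points_chart[OF c] by auto
  then show "smooth_on (\<phi> ` (U \<inter> (points A \<inter> f -` V))) (\<lambda>y. \<psi> (f (inv_into U \<phi> y)))"
    using f c assms(2) unfolding smooth_map_def by fastforce
qed

text \<open>Near each point the composite factors through a chart \<psi> of B, as g after the
  inverse of \<psi>, applied to \<psi> after f.\<close>

lemma smooth_fun_on_comp_map:
  fixes B :: "('n, 'b::real_inner) chart set"
  assumes A: "smooth_atlas A" and B: "fd_atlas B" and f: "smooth_map A B f"
    and W: "openin (atlas_topology B) W" and g: "smooth_fun_on B W g"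
  shows "smooth_fun_on A (points A \<inter> f -` W) (\<lambda>x. g (f x))"
proof (rule smooth_fun_on_local[OF A])
  note B' = fd_atlas_smooth[OF B]
  obtain C :: "'b set" where C: "frame C" using B by (auto simp: fd_atlas_def)
  fix x assume "x \<in> points A \<inter> f -` W"
  then have x: "x \<in> points A" "f x \<in> W" by auto
  then obtain V \<psi> where d: "(V, \<psi>) \<in> B" "f x \<in> V"
    using smooth_map_points[OF f] by (blast elim: points_obtain_chart)
  have o: "openin (atlas_topology B) (V \<inter> W)" using openin_chart_domain[OF d(1)] W by blast
  let ?T = "points A \<inter> f -` (V \<inter> W)"
  have oT: "openin (atlas_topology A) ?T" by (rule openin_map_preimage[OF f o])
  have "smooth_fun_on A ?T (\<lambda>x. \<psi> (f x))"
    by (rule smooth_fun_on_subset[OF smooth_mapD[OF f d(1)]]) auto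
  then have "smooth_fun_on A ?T (\<lambda>x. g (inv_into V \<psi> (\<psi> (f x))))"
    by (rule smooth_fun_on_postcompose[OF C A oT _ open_chart_image[OF B' d(1) W] smooth_fun_onD[OF g d(1)]])
      auto
  then have "smooth_fun_on A ?T (\<lambda>x. g (f x))"
    by (rule smooth_fun_on_cong[OF _ A oT]) (use inv_chart[OF B' d(1)] in auto)
  then show "\<exists>T. openin (atlas_topology A) T \<and> x \<in> T \<and> smooth_fun_on A T (\<lambda>x. g (f x))"
    using oT x d by blast
qed

lemma smooth_map_compose:
  assumes A: "smooth_atlas A" and B: "fd_atlas B" and D: "fd_atlas D"
    and f: "smooth_map A B f" and g: "smooth_map B D g"
  shows "smooth_map A D (\<lambda>x. g (f x))"
proof (rule smooth_mapI[OF A D])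
  show "(\<lambda>x. g (f x)) ` points A \<subseteq> points D" using smooth_map_points[OF f] smooth_map_points[OF g] by auto
  fix x assume x: "x \<in> points A"
  then obtain V \<psi> where d: "(V, \<psi>) \<in> D" "g (f x) \<in> V"
    using smooth_map_points[OF f] smooth_map_points[OF g] by (blast elim: points_obtain_chart)
  note o = openin_map_preimage[OF g openin_chart_domain[OF d(1)]]
  show "\<exists>W V \<psi>. openin (atlas_topology A) W \<and> x \<in> W \<and> (V, \<psi>) \<in> D \<and>
      (\<lambda>x. g (f x)) ` W \<subseteq> V \<and> smooth_fun_on A W (\<lambda>x. \<psi> (g (f x)))"
    by (intro exI conjI, rule openin_map_preimage[OF f o])
      (use x d smooth_map_points[OF f] smooth_fun_on_comp_map[OF A B f o smooth_mapD[OF g d(1)]] in auto)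
qed

text \<open>Replaces the atlas \<open>std_atlas\<close> on the real line by the calculus of
  \<open>smooth_fun_on\<close>.\<close>

lemma smooth_functions_iff:
  assumes A: "smooth_atlas A"
  shows "f \<in> smooth_functions A \<longleftrightarrow> smooth_fun_on A (points A) f"
proof
  assume "f \<in> smooth_functions A"
  then have "smooth_map A std_atlas f" by (simp add: smooth_functions_def)
  from smooth_mapD[OF this, of UNIV "\<lambda>x. x"] show "smooth_fun_on A (points A) f"
    by (simp add: std_atlas_def)
next
  assume f: "smooth_fun_on A (points A) f"
  have std: "fd_atlas (std_atlas :: (real, real) chart set)"
    using frame_real by (auto simp: fd_atlas_def smooth_atlas_def std_atlas_def smooth_on_id inv_into_def)
  have "smooth_map A std_atlas f"
    by (rule smooth_mapI[OF A std])
      (use f openin_topspace[of "atlas_topology A"] in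
        \<open>auto simp: std_atlas_def points_def[of "{(UNIV, \<lambda>x. x)}"] intro!: exI[of _ "points A"]\<close>)
  then show "f \<in> smooth_functions A" by (simp add: smooth_functions_def)
qed

subsection \<open>Open submanifolds and products\<close>

lemma points_restrict: "points (restrict_atlas A W) = points A \<inter> W"
  by (auto simp: points_def restrict_atlas_def)

text \<open>\<open>inv_into\<close> depends on the domain, so a restricted chart has a formally
  different inverse; the two agree only on the image of the smaller domain.\<close>

lemma inv_into_restrict:
  assumes "smooth_atlas A" and "(U, \<phi>) \<in> A" and "y \<in> \<phi> ` (U \<inter> W)"
  shows "inv_into (U \<inter> W) \<phi> y = inv_into U \<phi> y"
proof -
  obtain x where x: "x \<in> U \<inter> W" "y = \<phi> x" using assms(3) by auto
  have "inj_on \<phi> (U \<inter> W)" using smooth_atlasD(1)[OF assms(1,2)] by (auto simp: inj_on_def)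
  then show ?thesis using x inv_chart[OF assms(1,2)] by (simp add: inv_into_f_f)
qed

lemma smooth_atlas_restrict:
  assumes A: "smooth_atlas A" and W: "openin (atlas_topology A) W"
  shows "smooth_atlas (restrict_atlas A W)"
proof -
  have "inj_on \<phi> (U \<inter> W) \<and> open (\<phi> ` (U \<inter> W))" if "(U, \<phi>) \<in> A" for U \<phi>
    using smooth_atlasD(1)[OF A that] open_chart_image[OF A that W] by (auto simp: inj_on_def)
  moreover have "open (\<phi> ` (U \<inter> W \<inter> (V \<inter> W))) \<and>
      smooth_on (\<phi> ` (U \<inter> W \<inter> (V \<inter> W))) (\<lambda>y. \<psi> (inv_into (U \<inter> W) \<phi> y))"
    if c: "(U, \<phi>) \<in> A" and d: "(V, \<psi>) \<in> A" for U \<phi> V \<psi>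
  proof -
    have e: "U \<inter> W \<inter> (V \<inter> W) = U \<inter> (V \<inter> W)" by auto
    have o: "open (\<phi> ` (U \<inter> (V \<inter> W)))"
      using open_chart_image[OF A c] openin_chart_domain[OF d] W by blast
    have "smooth_on (\<phi> ` (U \<inter> (V \<inter> W))) (\<lambda>y. \<psi> (inv_into U \<phi> y))"
      by (rule smooth_on_subset[OF smooth_atlasD(4)[OF A c d]]) auto
    then have "smooth_on (\<phi> ` (U \<inter> (V \<inter> W))) (\<lambda>y. \<psi> (inv_into (U \<inter> W) \<phi> y))"
      by (rule smooth_on_cong[OF _ o]) (subst inv_into_restrict[OF A c], auto)
    then show ?thesis using o by (simp add: e)
  qed
  ultimately show ?thesis by (force simp: smooth_atlas_def restrict_atlas_def)
qed

lemma fd_atlas_restrict: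
  "fd_atlas A \<Longrightarrow> openin (atlas_topology A) W \<Longrightarrow> fd_atlas (restrict_atlas A W)"
  by (simp add: fd_atlas_def smooth_atlas_restrict)

lemma openin_restrict_atlas:
  assumes A: "smooth_atlas A" and W: "openin (atlas_topology A) W"
  shows "openin (atlas_topology (restrict_atlas A W)) T \<longleftrightarrow> openin (atlas_topology A) T \<and> T \<subseteq> W"
proof -
  have e: "U \<inter> W \<inter> T = U \<inter> T" if "T \<subseteq> W" for U :: "'a set" using that by auto
  show ?thesis
    unfolding openin_atlas_iff[OF A] openin_atlas_iff[OF smooth_atlas_restrict[OF A W]] points_restrict
    by (auto simp: restrict_atlas_def e; force simp: e)
qed

lemma smooth_fun_on_restrict_atlas:
  assumes A: "smooth_atlas A" and W: "openin (atlas_topology A) W"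
    and T: "openin (atlas_topology A) T" "T \<subseteq> W"
  shows "smooth_fun_on (restrict_atlas A W) T f \<longleftrightarrow> smooth_fun_on A T f"
proof -
  have "smooth_on (\<phi> ` (U \<inter> W \<inter> T)) (\<lambda>y. f (inv_into (U \<inter> W) \<phi> y)) \<longleftrightarrow>
      smooth_on (\<phi> ` (U \<inter> T)) (\<lambda>y. f (inv_into U \<phi> y))" if c: "(U, \<phi>) \<in> A" for U \<phi>
  proof -
    have e: "U \<inter> W \<inter> T = U \<inter> T" using T(2) by auto
    have eq: "inv_into (U \<inter> W) \<phi> y = inv_into U \<phi> y" if "y \<in> \<phi> ` (U \<inter> T)" for y
      using inv_into_restrict[OF A c, of y W] that T(2) by auto
    note o = open_chart_image[OF A c T(1)]
    show ?thesis unfolding e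
      using smooth_on_cong[OF _ o, of "\<lambda>y. f (inv_into U \<phi> y)" "\<lambda>y. f (inv_into (U \<inter> W) \<phi> y)"]
        smooth_on_cong[OF _ o, of "\<lambda>y. f (inv_into (U \<inter> W) \<phi> y)" "\<lambda>y. f (inv_into U \<phi> y)"] eq
      by auto
  qed
  then show ?thesis by (auto simp: smooth_fun_on_def restrict_atlas_def)
qed

lemma smooth_functions_restrict_iff:
  assumes A: "smooth_atlas A" and W: "openin (atlas_topology A) W"
  shows "f \<in> smooth_functions (restrict_atlas A W) \<longleftrightarrow> smooth_fun_on A W f"
proof -
  have "points A \<inter> W = W" using openin_subset[OF W] by auto
  then show ?thesis
    using smooth_functions_iff[OF smooth_atlas_restrict[OF A W]]
      smooth_fun_on_restrict_atlas[OF A W W] by (simp add: points_restrict)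
qed

lemma smooth_map_local:
  assumes A: "smooth_atlas A" and B: "fd_atlas B"
    and loc: "\<And>x. x \<in> points A \<Longrightarrow>
      \<exists>W. openin (atlas_topology A) W \<and> x \<in> W \<and> smooth_map (restrict_atlas A W) B f"
  shows "smooth_map A B f"
proof (rule smooth_mapI[OF A B])
  show "f ` points A \<subseteq> points B"
  proof clarify
    fix x assume "x \<in> points A"
    then show "f x \<in> points B" using loc[of x] smooth_map_points[of _ B f x] by (force simp: points_restrict)
  qed
  fix x assume x: "x \<in> points A"
  then obtain W where W: "openin (atlas_topology A) W" "x \<in> W" and f: "smooth_map (restrict_atlas A W) B f"
    using loc by blast
  obtain V \<psi> where d: "(V, \<psi>) \<in> B" "f x \<in> V"
    using smooth_map_points[OF f, of x] x W by (auto simp: points_restrict elim: points_obtain_chart)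
  let ?T = "points (restrict_atlas A W) \<inter> f -` V"
  have oT: "openin (atlas_topology A) ?T" "?T \<subseteq> W"
    using openin_map_preimage[OF f openin_chart_domain[OF d(1)]] openin_restrict_atlas[OF A W(1)] by auto
  have "smooth_fun_on A ?T (\<lambda>x. \<psi> (f x))"
    by (rule smooth_fun_on_restrict_atlas[OF A W(1) oT, THEN iffD1, OF smooth_mapD[OF f d(1)]])
  then show "\<exists>T V \<psi>. openin (atlas_topology A) T \<and> x \<in> T \<and> (V, \<psi>) \<in> B \<and>
      f ` T \<subseteq> V \<and> smooth_fun_on A T (\<lambda>x. \<psi> (f x))"
    using x W d oT by (intro exI[of _ ?T] exI[of _ V] exI[of _ \<psi>]) (auto simp: points_restrict)
qed

lemma smooth_map_restrict_codomain:
  assumes A: "smooth_atlas A" and B: "fd_atlas B" and f: "smooth_map A (restrict_atlas B W) f"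
  shows "smooth_map A B f"
proof (rule smooth_mapI[OF A B])
  show "f ` points A \<subseteq> points B" using smooth_map_points[OF f] by (auto simp: points_restrict)
  fix x assume x: "x \<in> points A"
  obtain V \<psi> where d: "(V, \<psi>) \<in> B" "f x \<in> V \<inter> W"
    using smooth_map_points[OF f x] by (auto simp: points_restrict elim: points_obtain_chart)
  have d': "(V \<inter> W, \<psi>) \<in> restrict_atlas B W" using d(1) by (force simp: restrict_atlas_def)
  show "\<exists>T V \<psi>. openin (atlas_topology A) T \<and> x \<in> T \<and> (V, \<psi>) \<in> B \<and>
      f ` T \<subseteq> V \<and> smooth_fun_on A T (\<lambda>x. \<psi> (f x))"
    using openin_map_preimage[OF f openin_chart_domain[OF d']] smooth_mapD[OF f d'] x d
    by (intro exI[of _ "points A \<inter> f -` (V \<inter> W)"] exI[of _ V] exI[of _ \<psi>]) auto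
qed

lemma std_atlas_fd: "frame (C :: 'a::real_inner set) \<Longrightarrow> fd_atlas (std_atlas :: ('a, 'a) chart set)"
  by (auto simp: fd_atlas_def smooth_atlas_def std_atlas_def smooth_on_id inv_into_def)

lemma fd_atlas_product:
  assumes A: "fd_atlas (A :: ('m, 'a::real_inner) chart set)"
    and B: "fd_atlas (B :: ('n, 'b::real_inner) chart set)"
  shows "fd_atlas (product_atlas A B)"
proof -
  note A' = fd_atlas_smooth[OF A] and B' = fd_atlas_smooth[OF B]
  obtain C :: "'a set" and D :: "'b set" where fr: "frame C" "frame D"
    using A B by (auto simp: fd_atlas_def)
  have inj: "inj_on (map_prod \<phi> \<psi>) (U \<times> V)" if "(U, \<phi>) \<in> A" "(V, \<psi>) \<in> B" for U \<phi> V \<psi>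
    using smooth_atlasD(1)[OF A' that(1)] smooth_atlasD(1)[OF B' that(2)] by (rule map_prod_inj_on)
  have im: "map_prod \<phi> \<psi> ` (S \<times> T) = (\<phi> ` S) \<times> (\<psi> ` T)" for \<phi> :: "'m \<Rightarrow> 'a" and \<psi> :: "'n \<Rightarrow> 'b" and S T
    by (rule map_prod_image)
  have "open (map_prod \<phi> \<psi> ` (U \<times> V))" if "(U, \<phi>) \<in> A" "(V, \<psi>) \<in> B" for U \<phi> V \<psi>
    unfolding im using smooth_atlasD(2)[OF A' that(1)] smooth_atlasD(2)[OF B' that(2)] by (rule open_Times)
  moreover have "open (map_prod \<phi> \<psi> ` (U \<times> V \<inter> U' \<times> V')) \<and>
      smooth_on (map_prod \<phi> \<psi> ` (U \<times> V \<inter> U' \<times> V')) (\<lambda>y. map_prod \<phi>' \<psi>' (inv_into (U \<times> V) (map_prod \<phi> \<psi>) y))"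
    if c: "(U, \<phi>) \<in> A" "(V, \<psi>) \<in> B" and d: "(U', \<phi>') \<in> A" "(V', \<psi>') \<in> B" for U \<phi> V \<psi> U' \<phi>' V' \<psi>'
  proof -
    let ?S = "\<phi> ` (U \<inter> U')" and ?T = "\<psi> ` (V \<inter> V')"
    have e: "map_prod \<phi> \<psi> ` (U \<times> V \<inter> U' \<times> V') = ?S \<times> ?T" by (simp add: im Times_Int_Times)
    have oS: "open ?S" "open ?T" using smooth_atlasD(3)[OF A' c(1) d(1)] smooth_atlasD(3)[OF B' c(2) d(2)] .
    then have o: "open (?S \<times> ?T)" by (rule open_Times)
    \<comment> \<open>The change of charts acts componentwise, so each component is a change of
      charts of one factor after a linear projection.\<close>
    have "smooth_on (?S \<times> ?T) (\<lambda>p. \<phi>' (inv_into U \<phi> (fst p)))"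
      by (rule smooth_on_compose[OF fr(1) o oS(1) smooth_on_linear[OF bounded_linear_fst o smooth_on_id[OF o]]
            smooth_atlasD(4)[OF A' c(1) d(1)]]) auto
    moreover have "smooth_on (?S \<times> ?T) (\<lambda>p. \<psi>' (inv_into V \<psi> (snd p)))"
      by (rule smooth_on_compose[OF fr(2) o oS(2) smooth_on_linear[OF bounded_linear_snd o smooth_on_id[OF o]]
            smooth_atlasD(4)[OF B' c(2) d(2)]]) auto
    ultimately have "smooth_on (?S \<times> ?T) (\<lambda>p. (\<phi>' (inv_into U \<phi> (fst p)), \<psi>' (inv_into V \<psi> (snd p))))"
      by (rule smooth_on_Pair[OF o])
    then have "smooth_on (?S \<times> ?T) (\<lambda>p. map_prod \<phi>' \<psi>' (inv_into (U \<times> V) (map_prod \<phi> \<psi>) p))"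
    proof (rule smooth_on_cong[OF _ o])
      fix p assume "p \<in> ?S \<times> ?T"
      then obtain x y where p: "p = map_prod \<phi> \<psi> (x, y)" "x \<in> U" "y \<in> V" by auto
      have "inv_into (U \<times> V) (map_prod \<phi> \<psi>) p = (x, y)"
        unfolding p(1) by (rule inv_into_f_f[OF inj[OF c]]) (use p in auto)
      then show "(\<phi>' (inv_into U \<phi> (fst p)), \<psi>' (inv_into V \<psi> (snd p))) =
          map_prod \<phi>' \<psi>' (inv_into (U \<times> V) (map_prod \<phi> \<psi>) p)"
        using p inv_chart[OF A' c(1)] inv_chart[OF B' c(2)] by simp
    qed
    then show ?thesis using o e by simp
  qed
  ultimately have "smooth_atlas (product_atlas A B)"
    unfolding smooth_atlas_def product_atlas_def using inj by fast
  then show ?thesis using frame_Times[OF fr] by (simp add: fd_atlas_def)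
qed

section \<open>The differential of alternating forms on a Lie-Rinehart algebra\<close>

text \<open>C stands for the smooth functions, S for the sections and L for the action of sections
  on functions through the anchor. Both are carrier sets inside larger types, because functions and
  sections have prescribed values off the manifold. The zero of S is expressed as
  \<open>mul 0 V\<close>.\<close>

locale lie_rinehart =
  fixes C :: "'c::comm_ring_1 set" and S :: "'v set"
    and add :: "'v \<Rightarrow> 'v \<Rightarrow> 'v" and mul :: "'c \<Rightarrow> 'v \<Rightarrow> 'v"
    and br :: "'v \<Rightarrow> 'v \<Rightarrow> 'v" and L :: "'v \<Rightarrow> 'c \<Rightarrow> 'c"
  assumes C_0 [simp]: "0 \<in> C"
    and C_add [simp]: "f \<in> C \<Longrightarrow> g \<in> C \<Longrightarrow> f + g \<in> C"
    and C_uminus [simp]: "f \<in> C \<Longrightarrow> - f \<in> C"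
    and C_mult [simp]: "f \<in> C \<Longrightarrow> g \<in> C \<Longrightarrow> f * g \<in> C"
    and S_add [simp]: "V \<in> S \<Longrightarrow> W \<in> S \<Longrightarrow> add V W \<in> S"
    and S_mul [simp]: "f \<in> C \<Longrightarrow> V \<in> S \<Longrightarrow> mul f V \<in> S"
    and S_br [simp]: "V \<in> S \<Longrightarrow> W \<in> S \<Longrightarrow> br V W \<in> S"
    and br_add_left: "U \<in> S \<Longrightarrow> V \<in> S \<Longrightarrow> W \<in> S \<Longrightarrow> br (add U V) W = add (br U W) (br V W)"
    and br_add_right: "U \<in> S \<Longrightarrow> V \<in> S \<Longrightarrow> W \<in> S \<Longrightarrow> br U (add V W) = add (br U V) (br U W)"
    and br_self: "V \<in> S \<Longrightarrow> br V V = mul 0 V"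
    and br_mul_right: "f \<in> C \<Longrightarrow> V \<in> S \<Longrightarrow> W \<in> S \<Longrightarrow>
      br V (mul f W) = add (mul f (br V W)) (mul (L V f) W)"
    and L_closed [simp]: "V \<in> S \<Longrightarrow> f \<in> C \<Longrightarrow> L V f \<in> C"
    and L_add: "V \<in> S \<Longrightarrow> f \<in> C \<Longrightarrow> g \<in> C \<Longrightarrow> L V (f + g) = L V f + L V g"
    and L_mult: "V \<in> S \<Longrightarrow> f \<in> C \<Longrightarrow> g \<in> C \<Longrightarrow> L V (f * g) = L V f * g + f * L V g"
    and L_add_left: "V \<in> S \<Longrightarrow> W \<in> S \<Longrightarrow> f \<in> C \<Longrightarrow> L (add V W) f = L V f + L W f"
    and L_mul_left: "g \<in> C \<Longrightarrow> V \<in> S \<Longrightarrow> f \<in> C \<Longrightarrow> L (mul g V) f = g * L V f"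
begin

text \<open>Separated from linearity over C because \<open>altform_cartan_d\<close> must have
  alternation in all slots before it can derive linearity in the first one.\<close>

definition alternating_additive :: "nat \<Rightarrow> ('v list \<Rightarrow> 'c) \<Rightarrow> bool" where
  "alternating_additive p \<eta> \<longleftrightarrow>
     (\<forall>Vs\<in>lists S. length Vs = p \<longrightarrow> \<eta> Vs \<in> C) \<and>
     (\<forall>As\<in>lists S. \<forall>Bs\<in>lists S. \<forall>V\<in>S. \<forall>W\<in>S. Suc (length As + length Bs) = p \<longrightarrow>
        \<eta> (As @ add V W # Bs) = \<eta> (As @ V # Bs) + \<eta> (As @ W # Bs)) \<and>
     (\<forall>As\<in>lists S. \<forall>Bs\<in>lists S. \<forall>Ds\<in>lists S. \<forall>V\<in>S.
        Suc (Suc (length As + length Bs + length Ds)) = p \<longrightarrow> \<eta> (As @ V # Bs @ V # Ds) = 0)"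

definition altform :: "nat \<Rightarrow> ('v list \<Rightarrow> 'c) \<Rightarrow> bool" where
  "altform p \<eta> \<longleftrightarrow> alternating_additive p \<eta> \<and>
     (\<forall>As\<in>lists S. \<forall>Bs\<in>lists S. \<forall>V\<in>S. \<forall>f\<in>C. Suc (length As + length Bs) = p \<longrightarrow>
        \<eta> (As @ mul f V # Bs) = f * \<eta> (As @ V # Bs))"

lemma alternating_additiveD:
  assumes "alternating_additive p \<eta>"
  shows "Vs \<in> lists S \<Longrightarrow> length Vs = p \<Longrightarrow> \<eta> Vs \<in> C"
    and "As \<in> lists S \<Longrightarrow> Bs \<in> lists S \<Longrightarrow> V \<in> S \<Longrightarrow> W \<in> S \<Longrightarrow> Suc (length As + length Bs) = p \<Longrightarrow>
      \<eta> (As @ add V W # Bs) = \<eta> (As @ V # Bs) + \<eta> (As @ W # Bs)"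
    and "As \<in> lists S \<Longrightarrow> Bs \<in> lists S \<Longrightarrow> Ds \<in> lists S \<Longrightarrow> V \<in> S \<Longrightarrow>
      Suc (Suc (length As + length Bs + length Ds)) = p \<Longrightarrow> \<eta> (As @ V # Bs @ V # Ds) = 0"
  using assms unfolding alternating_additive_def by blast+

lemma altformD:
  assumes "altform p \<eta>"
  shows "alternating_additive p \<eta>"
    and "As \<in> lists S \<Longrightarrow> Bs \<in> lists S \<Longrightarrow> V \<in> S \<Longrightarrow> f \<in> C \<Longrightarrow> Suc (length As + length Bs) = p \<Longrightarrow>
      \<eta> (As @ mul f V # Bs) = f * \<eta> (As @ V # Bs)"
  using assms unfolding altform_def by blast+

text \<open>Polarisation: expand the value with V + W in both slots, which is 0.\<close>

lemma alternating_additive_swap: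
  assumes \<eta>: "alternating_additive p \<eta>" and [simp]: "As \<in> lists S" "Bs \<in> lists S" "Ds \<in> lists S" "V \<in> S" "W \<in> S"
    and len: "Suc (Suc (length As + length Bs + length Ds)) = p"
  shows "\<eta> (As @ V # Bs @ W # Ds) = - \<eta> (As @ W # Bs @ V # Ds)"
proof -
  have add1: "\<eta> (As @ add V W # Bs @ X # Ds) = \<eta> (As @ V # Bs @ X # Ds) + \<eta> (As @ W # Bs @ X # Ds)"
    if "X \<in> S" for X
    using len that by (intro alternating_additiveD(2)[OF \<eta>]) auto
  have add2: "\<eta> (As @ X # Bs @ add V W # Ds) = \<eta> (As @ X # Bs @ V # Ds) + \<eta> (As @ X # Bs @ W # Ds)"
    if "X \<in> S" for X
    using alternating_additiveD(2)[OF \<eta>, of "As @ X # Bs" Ds V W] len that by simp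
  have "\<eta> (As @ X # Bs @ X # Ds) = 0" if "X \<in> S" for X
    using len that by (intro alternating_additiveD(3)[OF \<eta>]) auto
  from this[of "add V W"] this[of V] this[of W]
  have "0 = \<eta> (As @ V # Bs @ W # Ds) + \<eta> (As @ W # Bs @ V # Ds)"
    by (simp add: add1 add2 add.commute)
  then show ?thesis unfolding eq_neg_iff_add_eq_0 by (rule sym)
qed

section \<open>Interior product (prefixing an argument) and Lie derivative of alternating
  forms\<close>

lemma altform_insert:
  assumes \<eta>: "altform (Suc p) \<eta>" and V: "V \<in> S"
  shows "altform p (\<lambda>Z. \<eta> (V # Z))"
proof -
  note b = altformD(1)[OF \<eta>]
  show ?thesis
    unfolding altform_def alternating_additive_def
    using V alternating_additiveD(1)[OF b, of "V # _"] alternating_additiveD(2)[OF b, of "V # _"]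
      alternating_additiveD(3)[OF b, of "V # _"] altformD(2)[OF \<eta>, of "V # _"] by simp
qed

lemma altform_diff:
  assumes \<eta>: "altform p \<eta>" and \<theta>: "altform p \<theta>"
  shows "altform p (\<lambda>Z. \<eta> Z - \<theta> Z)"
proof -
  have C_diff: "f - g \<in> C" if "f \<in> C" "g \<in> C" for f g
    using C_add[OF that(1) C_uminus[OF that(2)]] by simp
  note b = altformD(1)[OF \<eta>] and c = altformD(1)[OF \<theta>]
  show ?thesis
    unfolding altform_def alternating_additive_def
    using alternating_additiveD[OF b] alternating_additiveD[OF c] altformD(2)[OF \<eta>] altformD(2)[OF \<theta>] C_diff
    by (simp add: algebra_simps)
qed

text \<open>The sum over all slots of \<eta> with the entry W of that slot replaced by {V, W}.
  Recursion along the list keeps signs and positions out of the way until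
  \<open>leibniz_explicit\<close>.\<close>

fun leibniz :: "'v \<Rightarrow> ('v list \<Rightarrow> 'c) \<Rightarrow> 'v list \<Rightarrow> 'c" where
  "leibniz V \<eta> [] = 0"
| "leibniz V \<eta> (W # Ws) = \<eta> (br V W # Ws) + leibniz V (\<lambda>Z. \<eta> (W # Z)) Ws"

lemma leibniz_append:
  "leibniz V \<eta> (As @ Bs) = leibniz V (\<lambda>Z. \<eta> (Z @ Bs)) As + leibniz V (\<lambda>Z. \<eta> (As @ Z)) Bs"
  by (induction As arbitrary: \<eta>) (simp_all add: add.assoc)

lemma leibniz_cong:
  "V \<in> S \<Longrightarrow> Ws \<in> lists S \<Longrightarrow> (\<And>Z. Z \<in> lists S \<Longrightarrow> length Z = length Ws \<Longrightarrow> \<eta> Z = \<theta> Z) \<Longrightarrow>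
    leibniz V \<eta> Ws = leibniz V \<theta> Ws"
proof (induction Ws arbitrary: \<eta> \<theta>)
  case (Cons W Ws)
  have "leibniz V (\<lambda>Z. \<eta> (W # Z)) Ws = leibniz V (\<lambda>Z. \<theta> (W # Z)) Ws"
    using Cons.prems by (intro Cons.IH) auto
  then show ?case using Cons.prems by simp
qed simp

lemma leibniz_closed:
  "V \<in> S \<Longrightarrow> Ws \<in> lists S \<Longrightarrow> (\<And>Z. Z \<in> lists S \<Longrightarrow> length Z = length Ws \<Longrightarrow> \<eta> Z \<in> C) \<Longrightarrow>
    leibniz V \<eta> Ws \<in> C"
proof (induction Ws arbitrary: \<eta>)
  case (Cons W Ws)
  have "leibniz V (\<lambda>Z. \<eta> (W # Z)) Ws \<in> C" using Cons.prems by (intro Cons.IH) auto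
  then show ?case using Cons.prems by simp
qed simp

lemma leibniz_add: "leibniz V (\<lambda>Z. \<eta> Z + \<theta> Z) Ws = leibniz V \<eta> Ws + leibniz V \<theta> Ws"
  by (induction Ws arbitrary: \<eta> \<theta>) (simp_all add: algebra_simps)

lemma leibniz_mult: "leibniz V (\<lambda>Z. f * \<eta> Z) Ws = f * leibniz V \<eta> Ws"
  by (induction Ws arbitrary: \<eta>) (simp_all add: algebra_simps)

lemma leibniz_zero: "leibniz V (\<lambda>Z. 0) Ws = 0"
  by (induction Ws) simp_all

lemma leibniz_add_left:
  "altform (length Ws) \<eta> \<Longrightarrow> U \<in> S \<Longrightarrow> V \<in> S \<Longrightarrow> Ws \<in> lists S \<Longrightarrow>
    leibniz (add U V) \<eta> Ws = leibniz U \<eta> Ws + leibniz V \<eta> Ws"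
proof (induction Ws arbitrary: \<eta>)
  case (Cons W Ws)
  have "altform (length Ws) (\<lambda>Z. \<eta> (W # Z))" using Cons.prems by (intro altform_insert) auto
  moreover have "\<eta> (add (br U W) (br V W) # Ws) = \<eta> (br U W # Ws) + \<eta> (br V W # Ws)"
    using Cons.prems alternating_additiveD(2)[OF altformD(1)[OF Cons.prems(1)], of "[]" Ws] by simp
  ultimately show ?case using Cons by (simp add: br_add_left algebra_simps)
qed simp

definition lie_der :: "'v \<Rightarrow> ('v list \<Rightarrow> 'c) \<Rightarrow> 'v list \<Rightarrow> 'c" where
  "lie_der V \<eta> Ws = L V (\<eta> Ws) - leibniz V \<eta> Ws"

lemma L_zero: "V \<in> S \<Longrightarrow> L V 0 = 0"
  using L_add[of V 0 0] by simp

text \<open>Replacing an entry other than the two equal ones leaves a repeated argument, so these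
  terms vanish; the two terms in which one copy of W is replaced cancel by antisymmetry.\<close>

lemma leibniz_alternating:
  assumes \<eta>: "alternating_additive p \<eta>"
    and X [simp]: "V \<in> S" "As \<in> lists S" "Bs \<in> lists S" "Ds \<in> lists S" "W \<in> S"
    and len: "Suc (Suc (length As + length Bs + length Ds)) = p"
  shows "leibniz V \<eta> (As @ W # Bs @ W # Ds) = 0"
proof -
  have "leibniz V (\<lambda>Z. \<eta> (Z @ W # Bs @ W # Ds)) As = leibniz V (\<lambda>Z. 0) As"
    by (rule leibniz_cong) (use len in \<open>simp_all del: in_lists_conv_set add: alternating_additiveD(3)[OF \<eta>]\<close>)
  moreover have "leibniz V (\<lambda>Z. \<eta> (As @ W # Z @ W # Ds)) Bs = leibniz V (\<lambda>Z. 0) Bs"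
    by (rule leibniz_cong) (use len in \<open>simp_all del: in_lists_conv_set add: alternating_additiveD(3)[OF \<eta>]\<close>)
  moreover have "leibniz V (\<lambda>Z. \<eta> (As @ W # Bs @ W # Z)) Ds = leibniz V (\<lambda>Z. 0) Ds"
    by (rule leibniz_cong) (use len in \<open>simp_all del: in_lists_conv_set add: alternating_additiveD(3)[OF \<eta>]\<close>)
  moreover have "\<eta> (As @ br V W # Bs @ W # Ds) = - \<eta> (As @ W # Bs @ br V W # Ds)"
    by (rule alternating_additive_swap[OF \<eta>]) (use len in auto)
  ultimately show ?thesis
    by (simp add: leibniz_append leibniz_zero)
qed

text \<open>For linearity over C the point is that (L_V f) \<eta>(..., X, ...) arises twice with
  opposite signs: from the product rule for L and from the bracket {V, f X} in the slot of
  X.\<close>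

lemma altform_lie_der:
  assumes \<eta>: "altform p \<eta>" and V [simp]: "V \<in> S"
  shows "altform p (lie_der V \<eta>)"
proof -
  note b = altformD(1)[OF \<eta>]
  have C_diff: "f - g \<in> C" if "f \<in> C" "g \<in> C" for f g
    using C_add[OF that(1) C_uminus[OF that(2)]] by simp
  have closed: "lie_der V \<eta> Vs \<in> C" if "Vs \<in> lists S" "length Vs = p" for Vs
    unfolding lie_der_def using alternating_additiveD(1)[OF b] that by (intro C_diff L_closed leibniz_closed) auto
  have additive: "lie_der V \<eta> (As @ add X Y # Bs) = lie_der V \<eta> (As @ X # Bs) + lie_der V \<eta> (As @ Y # Bs)"
    if [simp]: "As \<in> lists S" "Bs \<in> lists S" "X \<in> S" "Y \<in> S" and len: "Suc (length As + length Bs) = p"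
    for As Bs X Y
  proof -
    note e = alternating_additiveD(2)[OF b]
    have "leibniz V (\<lambda>Z. \<eta> (Z @ add X Y # Bs)) As =
        leibniz V (\<lambda>Z. \<eta> (Z @ X # Bs) + \<eta> (Z @ Y # Bs)) As"
      by (rule leibniz_cong) (use len in \<open>simp_all del: in_lists_conv_set add: e\<close>)
    moreover have "leibniz V (\<lambda>Z. \<eta> (As @ add X Y # Z)) Bs =
        leibniz V (\<lambda>Z. \<eta> (As @ X # Z) + \<eta> (As @ Y # Z)) Bs"
      by (rule leibniz_cong) (use len in \<open>simp_all del: in_lists_conv_set add: e\<close>)
    moreover have "\<eta> (As @ br V (add X Y) # Bs) = \<eta> (As @ br V X # Bs) + \<eta> (As @ br V Y # Bs)"
      using len by (simp add: br_add_right e)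
    moreover have "L V (\<eta> (As @ add X Y # Bs)) = L V (\<eta> (As @ X # Bs)) + L V (\<eta> (As @ Y # Bs))"
      using len by (simp add: e L_add alternating_additiveD(1)[OF b])
    ultimately show ?thesis by (simp add: lie_der_def leibniz_append leibniz_add algebra_simps)
  qed
  have homogeneous: "lie_der V \<eta> (As @ mul f X # Bs) = f * lie_der V \<eta> (As @ X # Bs)"
    if [simp]: "As \<in> lists S" "Bs \<in> lists S" "X \<in> S" "f \<in> C" and len: "Suc (length As + length Bs) = p"
    for As Bs X f
  proof -
    note e = altformD(2)[OF \<eta>]
    have "leibniz V (\<lambda>Z. \<eta> (Z @ mul f X # Bs)) As = leibniz V (\<lambda>Z. f * \<eta> (Z @ X # Bs)) As"
      by (rule leibniz_cong) (use len in \<open>simp_all del: in_lists_conv_set add: e\<close>)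
    moreover have "leibniz V (\<lambda>Z. \<eta> (As @ mul f X # Z)) Bs = leibniz V (\<lambda>Z. f * \<eta> (As @ X # Z)) Bs"
      by (rule leibniz_cong) (use len in \<open>simp_all del: in_lists_conv_set add: e\<close>)
    moreover have "\<eta> (As @ br V (mul f X) # Bs) = f * \<eta> (As @ br V X # Bs) + L V f * \<eta> (As @ X # Bs)"
      using len by (simp add: br_mul_right e alternating_additiveD(2)[OF b])
    moreover have "L V (\<eta> (As @ mul f X # Bs)) = L V f * \<eta> (As @ X # Bs) + f * L V (\<eta> (As @ X # Bs))"
      using len by (simp add: e L_mult alternating_additiveD(1)[OF b])
    ultimately show ?thesis by (simp add: lie_der_def leibniz_append leibniz_mult algebra_simps)
  qed
  have alternating: "lie_der V \<eta> (As @ X # Bs @ X # Ds) = 0"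
    if [simp]: "As \<in> lists S" "Bs \<in> lists S" "Ds \<in> lists S" "X \<in> S"
      and len: "Suc (Suc (length As + length Bs + length Ds)) = p" for As Bs Ds X
    using len by (simp add: lie_der_def leibniz_alternating[OF b] alternating_additiveD(3)[OF b] L_zero)
  show ?thesis
    unfolding altform_def alternating_additive_def
    by (intro conjI ballI impI) (rule closed additive homogeneous alternating; assumption)+
qed

text \<open>Cartan's formula read as a definition by recursion on the arguments. The value 0 on the
  empty list makes \<open>cartan_d \<eta> [V]\<close> equal to \<open>L V (\<eta> [])\<close>, the
  differential of a function.\<close>

fun cartan_d :: "('v list \<Rightarrow> 'c) \<Rightarrow> 'v list \<Rightarrow> 'c" where
  "cartan_d \<eta> [] = 0"
| "cartan_d \<eta> (V # Ws) = lie_der V \<eta> Ws - cartan_d (\<lambda>Z. \<eta> (V # Z)) Ws"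

lemma cartan_d_cong:
  "Ws \<in> lists S \<Longrightarrow> (\<And>Z. Z \<in> lists S \<Longrightarrow> Suc (length Z) = length Ws \<Longrightarrow> \<eta> Z = \<theta> Z) \<Longrightarrow>
    cartan_d \<eta> Ws = cartan_d \<theta> Ws"
proof (induction Ws arbitrary: \<eta> \<theta>)
  case (Cons W Ws)
  have "cartan_d (\<lambda>Z. \<eta> (W # Z)) Ws = cartan_d (\<lambda>Z. \<theta> (W # Z)) Ws"
    using Cons.prems by (intro Cons.IH) auto
  moreover have "leibniz W \<eta> Ws = leibniz W \<theta> Ws"
    using Cons.prems by (intro leibniz_cong) auto
  ultimately show ?case using Cons.prems by (simp add: lie_der_def)
qed simp

lemma cartan_d_add:
  "Ws \<in> lists S \<Longrightarrow> (\<And>Z. Z \<in> lists S \<Longrightarrow> Suc (length Z) = length Ws \<Longrightarrow> \<eta> Z \<in> C) \<Longrightarrow>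
    (\<And>Z. Z \<in> lists S \<Longrightarrow> Suc (length Z) = length Ws \<Longrightarrow> \<theta> Z \<in> C) \<Longrightarrow>
    cartan_d (\<lambda>Z. \<eta> Z + \<theta> Z) Ws = cartan_d \<eta> Ws + cartan_d \<theta> Ws"
proof (induction Ws arbitrary: \<eta> \<theta>)
  case (Cons W Ws)
  have "cartan_d (\<lambda>Z. \<eta> (W # Z) + \<theta> (W # Z)) Ws =
      cartan_d (\<lambda>Z. \<eta> (W # Z)) Ws + cartan_d (\<lambda>Z. \<theta> (W # Z)) Ws"
    using Cons.prems by (intro Cons.IH) auto
  then show ?case using Cons.prems by (simp add: lie_der_def leibniz_add L_add algebra_simps)
qed simp

text \<open>Real scalars will enter as ring elements annihilated by every L V; for other elements c
  the product rule would leave terms with L V c.\<close>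

lemma cartan_d_const_mult:
  assumes c: "c \<in> C" "\<And>V. V \<in> S \<Longrightarrow> L V c = 0"
  shows "Ws \<in> lists S \<Longrightarrow> (\<And>Z. Z \<in> lists S \<Longrightarrow> Suc (length Z) = length Ws \<Longrightarrow> \<eta> Z \<in> C) \<Longrightarrow>
    cartan_d (\<lambda>Z. c * \<eta> Z) Ws = c * cartan_d \<eta> Ws"
proof (induction Ws arbitrary: \<eta>)
  case (Cons W Ws)
  have "cartan_d (\<lambda>Z. c * \<eta> (W # Z)) Ws = c * cartan_d (\<lambda>Z. \<eta> (W # Z)) Ws"
    using Cons.prems by (intro Cons.IH) auto
  then show ?case using Cons.prems by (simp add: lie_der_def leibniz_mult L_mult c algebra_simps)
qed simp

lemma cartan_d_zero: "Ws \<in> lists S \<Longrightarrow> cartan_d (\<lambda>Z. 0) Ws = 0"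
  by (induction Ws) (simp_all add: lie_der_def leibniz_zero L_zero)

text \<open>In the inductive step \<open>ins\<close> settles all slots but the first, which is
  treated by \<open>add0\<close>, \<open>alt0\<close> and \<open>hom0\<close>. The last one relies
  on \<open>bi\<close>, alternation in all slots. In degree 0 linearity is that of L V in V.\<close>

lemma altform_cartan_d: "altform p \<eta> \<Longrightarrow> altform (Suc p) (cartan_d \<eta>)"
proof (induction p arbitrary: \<eta>)
  case (0 \<eta>)
  have "cartan_d \<eta> [V] = L V (\<eta> [])" for V by (simp add: lie_der_def)
  moreover have "\<eta> [] \<in> C" using alternating_additiveD(1)[OF altformD(1)[OF 0]] by simp
  ultimately show ?case
    unfolding altform_def alternating_additive_def
    by (auto simp: length_Suc_conv L_add_left L_mul_left simp del: cartan_d.simps)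
next
  case (Suc q \<eta>)
  let ?p = "Suc q"
  note b = altformD(1)[OF Suc.prems]
  \<comment> \<open>The recursion itself: with V fixed this is L_V \<eta> - d(i_V \<eta>), a
    difference of two alternating forms.\<close>
  have ins: "altform ?p (\<lambda>Ws. cartan_d \<eta> (V # Ws))" if "V \<in> S" for V
    using altform_diff[OF altform_lie_der[OF Suc.prems that] Suc.IH[OF altform_insert[OF Suc.prems that]]]
    by simp
  note insb = altformD(1)[OF ins]
  have closed: "cartan_d \<eta> Vs \<in> C" if "Vs \<in> lists S" "length Vs = Suc ?p" for Vs
    using that alternating_additiveD(1)[OF insb] by (cases Vs) auto
  have add0: "cartan_d \<eta> (add U V # Ws) = cartan_d \<eta> (U # Ws) + cartan_d \<eta> (V # Ws)"
    if [simp]: "U \<in> S" "V \<in> S" "Ws \<in> lists S" and len: "length Ws = ?p" for U V Ws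
  proof -
    have "cartan_d (\<lambda>Z. \<eta> (add U V # Z)) Ws = cartan_d (\<lambda>Z. \<eta> (U # Z) + \<eta> (V # Z)) Ws"
      by (rule cartan_d_cong) (use len alternating_additiveD(2)[OF b, of "[]"] in auto)
    also have "\<dots> = cartan_d (\<lambda>Z. \<eta> (U # Z)) Ws + cartan_d (\<lambda>Z. \<eta> (V # Z)) Ws"
      by (rule cartan_d_add) (use len alternating_additiveD(1)[OF b] in auto)
    finally show ?thesis
      using leibniz_add_left[of Ws \<eta> U V] len Suc.prems alternating_additiveD(1)[OF b]
      by (simp add: lie_der_def L_add_left algebra_simps)
  qed
  \<comment> \<open>Unfolding twice, (L_V \<eta>)(V, Ds) and (L_V i_V \<eta>)(Ds) differ only by the
    term \<eta>({V, V}, Ds), which is 0, and the last term is the differential of i_V i_V \<eta> =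
    0.\<close>
  have alt1: "cartan_d \<eta> (V # V # Ds) = 0" if [simp]: "V \<in> S" "Ds \<in> lists S" and len: "length Ds = q" for V Ds
  proof -
    have "cartan_d (\<lambda>Z. \<eta> (V # V # Z)) Ds = cartan_d (\<lambda>Z. 0) Ds"
      by (rule cartan_d_cong) (use len alternating_additiveD(3)[OF b, of "[]" "[]"] in auto)
    moreover have "\<eta> (mul 0 V # Ds) = 0"
      using altformD(2)[OF Suc.prems, of "[]" Ds V 0] len by simp
    ultimately show ?thesis by (simp add: lie_der_def br_self cartan_d_zero)
  qed
  have alt0: "cartan_d \<eta> (V # Bs @ V # Ds) = 0"
    if [simp]: "V \<in> S" "Bs \<in> lists S" "Ds \<in> lists S" and len: "length Bs + length Ds = q" for V Bs Ds
  proof (cases Bs)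
    case Nil
    then show ?thesis using alt1 len by (simp del: cartan_d.simps)
  next
    case (Cons B Bs')
    then have [simp]: "B \<in> S" "Bs' \<in> lists S" using that by auto
    \<comment> \<open>The exchange of B with the later V takes place behind the first argument,
      where \<open>ins\<close> already gives alternation; it makes the two V adjacent.\<close>
    have "cartan_d \<eta> (V # B # Bs' @ V # Ds) = - cartan_d \<eta> (V # V # Bs' @ B # Ds)"
      using alternating_additive_swap[OF insb[of V], of "[]" Bs' Ds B V] len Cons by (simp del: cartan_d.simps)
    also have "\<dots> = 0" using alt1[of V "Bs' @ B # Ds"] len Cons by (simp del: cartan_d.simps)
    finally show ?thesis using Cons by (simp del: cartan_d.simps)
  qed
  have bi: "alternating_additive (Suc ?p) (cartan_d \<eta>)"
    unfolding alternating_additive_def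
  proof (intro conjI ballI impI)
    show "cartan_d \<eta> Vs \<in> C" if "Vs \<in> lists S" "length Vs = Suc ?p" for Vs
      using closed that .
    show "cartan_d \<eta> (As @ add V W # Bs) = cartan_d \<eta> (As @ V # Bs) + cartan_d \<eta> (As @ W # Bs)"
      if "As \<in> lists S" "Bs \<in> lists S" "V \<in> S" "W \<in> S" "Suc (length As + length Bs) = Suc ?p" for As Bs V W
      using that add0[of V W Bs] alternating_additiveD(2)[OF insb, of _ _ Bs V W]
      by (cases As) (auto simp del: cartan_d.simps)
    show "cartan_d \<eta> (As @ V # Bs @ V # Ds) = 0"
      if "As \<in> lists S" "Bs \<in> lists S" "Ds \<in> lists S" "V \<in> S"
        "Suc (Suc (length As + length Bs + length Ds)) = Suc ?p" for As Bs Ds V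
      using that alt0[of V Bs Ds] alternating_additiveD(3)[OF insb, of _ _ Bs Ds V]
      by (cases As) (auto simp del: cartan_d.simps)
  qed
  have hom0: "cartan_d \<eta> (mul f V # Bs) = f * cartan_d \<eta> (V # Bs)"
    if [simp]: "V \<in> S" "f \<in> C" "Bs \<in> lists S" and len: "length Bs = ?p" for V f Bs
  proof -
    \<comment> \<open>A second argument W exists because \<eta> has positive degree. By
      \<open>bi\<close> the multiple of V moves behind W, where linearity is known from
      \<open>ins\<close>.\<close>
    obtain W Ws where B: "Bs = W # Ws" using len by (cases Bs) auto
    then have [simp]: "W \<in> S" "Ws \<in> lists S" using that by auto
    have sw: "cartan_d \<eta> (X # W # Ws) = - cartan_d \<eta> (W # X # Ws)" if "X \<in> S" for X
      using alternating_additive_swap[OF bi, of "[]" "[]" Ws X W] that B len by (simp del: cartan_d.simps)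
    have "cartan_d \<eta> (W # mul f V # Ws) = f * cartan_d \<eta> (W # V # Ws)"
      using altformD(2)[OF ins[of W], of "[]" Ws V f] B len by (simp del: cartan_d.simps)
    then show ?thesis by (simp add: B sw del: cartan_d.simps)
  qed
  have "cartan_d \<eta> (As @ mul f V # Bs) = f * cartan_d \<eta> (As @ V # Bs)"
    if "As \<in> lists S" "Bs \<in> lists S" "V \<in> S" "f \<in> C" "Suc (length As + length Bs) = Suc ?p" for As Bs V f
    using that hom0[of V f Bs] altformD(2)[OF ins, of _ _ Bs V f]
    by (cases As) (auto simp del: cartan_d.simps)
  with bi show ?case unfolding altform_def by simp
qed

section \<open>The explicit formula, with \<open>nths xs (- {i})\<close> for the list that omits
  entry i\<close>

lemma nths_Cons_minus:
  "nths (x # xs) (- {0}) = xs"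
  "nths (x # xs) (- {Suc i}) = x # nths xs (- {i})"
  "nths (x # xs) (- {0, Suc j}) = nths xs (- {j})"
  "nths (x # xs) (- {Suc i, Suc j}) = x # nths xs (- {i, j})"
  by (auto simp: nths_Cons nths_all intro!: arg_cong[where f = "nths xs"])

lemma nths_in_lists: "xs \<in> lists S \<Longrightarrow> nths xs I \<in> lists S"
  using set_nths_subset[of xs I] by (auto simp: lists_eq_set)

lemma length_nths_minus1: "i < length xs \<Longrightarrow> Suc (length (nths xs (- {i}))) = length xs"
proof -
  assume "i < length xs"
  moreover have "{k. k < length xs \<and> k \<in> - {i}} = {..<length xs} - {i}" by auto
  ultimately show ?thesis by (simp add: length_nths)
qed

lemma length_nths_minus2:
  "i < j \<Longrightarrow> j < length xs \<Longrightarrow> Suc (Suc (length (nths xs (- {i, j})))) = length xs"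
proof -
  assume "i < j" "j < length xs"
  moreover have "{k. k < length xs \<and> k \<in> - {i, j}} = {..<length xs} - {i, j}" by auto
  ultimately show ?thesis by (simp add: length_nths card_Diff_subset)
qed

text \<open>Carrying the bracket from slot j to the front passes j entries, whence the sign.\<close>

lemma leibniz_explicit:
  "altform (length Ws) \<eta> \<Longrightarrow> V \<in> S \<Longrightarrow> Ws \<in> lists S \<Longrightarrow>
    leibniz V \<eta> Ws = (\<Sum>j<length Ws. (-1) ^ j * \<eta> (br V (Ws ! j) # nths Ws (- {j})))"
proof (induction Ws arbitrary: \<eta>)
  case (Cons W Ws)
  then have [simp]: "W \<in> S" "V \<in> S" "Ws \<in> lists S" by auto
  have W: "Ws ! j \<in> S" if "j < length Ws" for j using that \<open>Ws \<in> lists S\<close> by (auto simp: lists_eq_set)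
  have sw: "\<eta> (W # br V (Ws ! j) # nths Ws (- {j})) = - \<eta> (br V (Ws ! j) # W # nths Ws (- {j}))"
    if "j < length Ws" for j
    using alternating_additive_swap[OF altformD(1)[OF Cons.prems(1)], of "[]" "[]" "nths Ws (- {j})" W "br V (Ws ! j)"]
      length_nths_minus1[OF that] nths_in_lists[OF \<open>Ws \<in> lists S\<close>] that W
    by simp
  have "leibniz V (\<lambda>Z. \<eta> (W # Z)) Ws = (\<Sum>j<length Ws. (-1) ^ j * \<eta> (W # br V (Ws ! j) # nths Ws (- {j})))"
    using Cons.prems by (intro Cons.IH altform_insert) auto
  also have "\<dots> = (\<Sum>j<length Ws. (-1) ^ Suc j * \<eta> (br V (Ws ! j) # W # nths Ws (- {j})))"
    by (rule sum.cong) (auto simp: sw)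
  finally show ?case
    by (simp only: leibniz.simps length_Cons sum.lessThan_Suc_shift nths_Cons_minus nth_Cons_0 nth_Cons_Suc)
      simp
qed simp

text \<open>In the recursion for V # Ws, the Lie derivative along V supplies exactly the terms with
  i = 0 in both sums. The terms without index 0 come from the induction hypothesis for i_V
  \<eta>.\<close>

lemma cartan_d_explicit:
  "altform p \<eta> \<Longrightarrow> length Vs = Suc p \<Longrightarrow> Vs \<in> lists S \<Longrightarrow>
    cartan_d \<eta> Vs =
      (\<Sum>i\<le>p. (-1) ^ i * L (Vs ! i) (\<eta> (nths Vs (- {i})))) +
      (\<Sum>j\<le>p. \<Sum>i<j. (-1) ^ (i + j) * \<eta> (br (Vs ! i) (Vs ! j) # nths Vs (- {i, j})))"
proof (induction p arbitrary: \<eta> Vs)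
  case 0
  then obtain V where "Vs = [V]" by (auto simp: length_Suc_conv)
  then show ?case by (simp add: lie_der_def nths_Cons)
next
  case (Suc q)
  then obtain V Ws where Vs: "Vs = V # Ws" and len: "length Ws = Suc q" by (auto simp: length_Suc_conv)
  have [simp]: "V \<in> S" "Ws \<in> lists S" using Suc.prems Vs by auto
  have W: "Ws ! i \<in> S" if "i < Suc q" for i using that len \<open>Ws \<in> lists S\<close> by (auto simp: lists_eq_set)
  have sw: "\<eta> (V # br (Ws ! i) (Ws ! j) # nths Ws (- {i, j})) =
      - \<eta> (br (Ws ! i) (Ws ! j) # V # nths Ws (- {i, j}))" if "i < j" "j < Suc q" for i j
    using alternating_additive_swap[OF altformD(1)[OF Suc.prems(1)], of "[]" "[]" "nths Ws (- {i, j})" V "br (Ws ! i) (Ws ! j)"]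
      length_nths_minus2[OF that(1), of Ws] nths_in_lists[OF \<open>Ws \<in> lists S\<close>] that len W by simp
  have "cartan_d (\<lambda>Z. \<eta> (V # Z)) Ws =
      (\<Sum>i\<le>q. (-1) ^ i * L (Ws ! i) (\<eta> (V # nths Ws (- {i})))) +
      (\<Sum>j\<le>q. \<Sum>i<j. (-1) ^ (i + j) * \<eta> (V # br (Ws ! i) (Ws ! j) # nths Ws (- {i, j})))"
    using Suc.prems len by (intro Suc.IH altform_insert) auto
  \<comment> \<open>Exchanging V with the bracket costs one sign, which the minus sign of the
    recursion will cancel.\<close>
  also have "(\<Sum>j\<le>q. \<Sum>i<j. (-1) ^ (i + j) * \<eta> (V # br (Ws ! i) (Ws ! j) # nths Ws (- {i, j}))) =
      - (\<Sum>j\<le>q. \<Sum>i<j. (-1) ^ (i + j) * \<eta> (br (Ws ! i) (Ws ! j) # V # nths Ws (- {i, j})))"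
    by (simp add: sw flip: sum_negf)
  finally have 1: "cartan_d (\<lambda>Z. \<eta> (V # Z)) Ws =
      (\<Sum>i\<le>q. (-1) ^ i * L (Ws ! i) (\<eta> (V # nths Ws (- {i}))))
      - (\<Sum>j\<le>q. \<Sum>i<j. (-1) ^ (i + j) * \<eta> (br (Ws ! i) (Ws ! j) # V # nths Ws (- {i, j})))"
    by simp
  have 2: "leibniz V \<eta> Ws = (\<Sum>j\<le>q. (-1) ^ j * \<eta> (br V (Ws ! j) # nths Ws (- {j})))"
    using leibniz_explicit[of Ws \<eta> V] Suc.prems len by (simp add: lessThan_Suc_atMost)
  have 3: "(\<Sum>i\<le>Suc q. (-1) ^ i * L (Vs ! i) (\<eta> (nths Vs (- {i})))) =
      L V (\<eta> Ws) - (\<Sum>i\<le>q. (-1) ^ i * L (Ws ! i) (\<eta> (V # nths Ws (- {i}))))"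
    by (simp only: sum.atMost_Suc_shift Vs nths_Cons_minus nth_Cons_0 nth_Cons_Suc)
      (simp add: sum_negf)
  \<comment> \<open>The inner sum is empty for j = 0. For j > 0 the term i = 0 belongs to
    \<open>leibniz\<close>, its sign changed by the shift of j; in the other terms both indices
    shift and the sign stays.\<close>
  have 4: "(\<Sum>j\<le>Suc q. \<Sum>i<j. (-1) ^ (i + j) * \<eta> (br (Vs ! i) (Vs ! j) # nths Vs (- {i, j}))) =
      - (\<Sum>j\<le>q. (-1) ^ j * \<eta> (br V (Ws ! j) # nths Ws (- {j}))) +
      (\<Sum>j\<le>q. \<Sum>i<j. (-1) ^ (i + j) * \<eta> (br (Ws ! i) (Ws ! j) # V # nths Ws (- {i, j})))"
    by (simp only: sum.atMost_Suc_shift sum.lessThan_Suc_shift Vs nths_Cons_minus nth_Cons_0 nth_Cons_Suc)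
      (simp add: sum_negf sum.distrib sum_subtractf)
  show ?case unfolding 3 4 using 1 2 by (simp add: Vs lie_der_def)
qed

end

section \<open>Vector bundles and their sections\<close>

text \<open>\<open>smooth_functions\<close> leaves the values off the manifold free. Fixing them to
  be 0 turns identities that hold on the manifold into equalities of ring elements.\<close>

definition smooth_ring :: "('m, 'a::real_inner) chart set \<Rightarrow> ('m \<Rightarrow> real) set" where
  "smooth_ring A = {f. smooth_fun_on A (points A) f \<and> (\<forall>x. x \<notin> points A \<longrightarrow> f x = 0)}"

text \<open>U and the complement of K are open and cover the manifold; on the latter the extended
  function is constantly 0.\<close>

lemma smooth_fun_on_extend_zero:
  assumes A: "smooth_atlas A" and U: "openin (atlas_topology A) U"
    and K: "closedin (atlas_topology A) K" "K \<subseteq> U"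
    and f: "smooth_fun_on A U f" and zero: "\<And>x. x \<in> U - K \<Longrightarrow> f x = 0"
  shows "smooth_fun_on A (points A) (\<lambda>x. if x \<in> U then f x else 0)"
proof (rule smooth_fun_on_local[OF A])
  fix x assume x: "x \<in> points A"
  have oK: "openin (atlas_topology A) (points A - K)"
    using openin_diff[OF openin_topspace K(1)] by simp
  show "\<exists>T. openin (atlas_topology A) T \<and> x \<in> T \<and> smooth_fun_on A T (\<lambda>x. if x \<in> U then f x else 0)"
  proof (cases "x \<in> U")
    case True
    have "smooth_fun_on A U (\<lambda>x. if x \<in> U then f x else 0)"
      by (rule smooth_fun_on_cong[OF f A U]) simp
    then show ?thesis using U True by blast
  next
    case False
    have "smooth_fun_on A (points A - K) (\<lambda>x. if x \<in> U then f x else 0)"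
      by (rule smooth_fun_on_cong[OF smooth_fun_on_const[OF A oK, of 0] A oK]) (use zero in auto)
    moreover have "x \<in> points A - K" using False x K(2) by auto
    ultimately show ?thesis using oK by blast
  qed
qed

text \<open>Two sets are provided: the closed K, off which \<kappa> vanishes, for extending by 0,
  and the open T, where \<kappa> is 1, for leaving local objects unchanged near x.\<close>

lemma bump_function:
  fixes A :: "('m, 'a::real_inner) chart set"
  assumes M: "smooth_manifold A" and N: "openin (atlas_topology A) N" and x: "x \<in> N"
  obtains \<kappa> K T where "\<kappa> \<in> smooth_ring A" and "closedin (atlas_topology A) K" and "K \<subseteq> N"
    and "\<And>y. y \<notin> K \<Longrightarrow> \<kappa> y = 0" and "openin (atlas_topology A) T" and "x \<in> T" and "T \<subseteq> K"
    and "\<And>y. y \<in> T \<Longrightarrow> \<kappa> y = 1"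
proof -
  note fd = smooth_manifold_fd_atlas[OF M]
  note A = fd_atlas_smooth[OF fd]
  obtain C :: "'a set" where C: "frame C" using fd by (auto simp: fd_atlas_def)
  obtain U \<phi> where c: "(U, \<phi>) \<in> A" "x \<in> U"
    using x openin_subset[OF N] points_obtain_chart[of x A] by auto
  obtain r where r: "r > 0" "cball (\<phi> x) r \<subseteq> \<phi> ` (U \<inter> N)"
    using bspec[OF iffD1[OF open_contains_cball open_chart_image[OF A c(1) N]], of "\<phi> x"] c(2) x by auto
  have "r\<^sup>2 / 4 < r\<^sup>2" using r(1) by simp
  then obtain \<theta> :: "real \<Rightarrow> real" where \<theta>: "smooth_on UNIV \<theta>" "\<And>t. t \<le> r\<^sup>2 / 4 \<Longrightarrow> \<theta> t = 1" "\<And>t. t \<ge> r\<^sup>2 \<Longrightarrow> \<theta> t = 0"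
    using cutoff_exists by blast
  \<comment> \<open>The squared distance is smooth at the centre too. With the thresholds (r/2)^2
    and r^2 for \<theta>, g is 1 on the ball of radius r/2 and 0 outside that of radius r.\<close>
  define g where "g y = \<theta> ((y + - \<phi> x) \<bullet> (y + - \<phi> x))" for y
  have g_dist: "g y = \<theta> ((dist y (\<phi> x))\<^sup>2)" for y
    by (simp add: g_def dist_norm power2_norm_eq_inner)
  have "smooth_on UNIV (\<lambda>y. y + - \<phi> x)"
    by (rule smooth_on_add[OF open_UNIV smooth_on_id[OF open_UNIV] smooth_on_const[OF open_UNIV]])
  from smooth_on_bilinear[OF bounded_bilinear_inner open_UNIV this this]
  have "smooth_on UNIV g" unfolding g_def
    by (rule smooth_on_compose[OF frame_real open_UNIV open_UNIV _ \<theta>(1)]) simp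
  then have sg: "smooth_fun_on A U (\<lambda>z. g (\<phi> z))"
    by (intro smooth_fun_on_postcompose[OF C A openin_chart_domain[OF c(1)] smooth_fun_on_chart_map[OF A c(1)]])
      auto
  define \<kappa> where "\<kappa> = (\<lambda>z. if z \<in> U then g (\<phi> z) else 0)"
  define K where "K = inv_into U \<phi> ` cball (\<phi> x) r"
  define T where "T = U \<inter> \<phi> -` ball (\<phi> x) (r / 2)"
  have KN: "K \<subseteq> U \<inter> N" using r(2) inv_chart[OF A c(1)] by (force simp: K_def)
  have inK: "z \<in> K" if "z \<in> U" "dist (\<phi> z) (\<phi> x) \<le> r" for z
    unfolding K_def by (rule image_eqI[of _ _ "\<phi> z"]) (use that inv_chart[OF A c(1)] in \<open>auto simp: dist_commute\<close>)
  \<comment> \<open>The inverse chart is continuous, so K is compact as the image of a closed ball,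
    and then closed because the manifold is Hausdorff.\<close>
  have "continuous_map (subtopology euclidean (\<phi> ` U)) (atlas_topology A) (inv_into U \<phi>)"
    unfolding continuous_map
  proof (intro conjI allI impI)
    show "inv_into U \<phi> ` topspace (subtopology euclidean (\<phi> ` U)) \<subseteq> topspace (atlas_topology A)"
      using inv_chart[OF A c(1)] points_chart[OF c(1)] by auto
    fix Q assume Q: "openin (atlas_topology A) Q"
    have "{y \<in> topspace (subtopology euclidean (\<phi> ` U)). inv_into U \<phi> y \<in> Q} = \<phi> ` (U \<inter> Q)"
      using inv_chart[OF A c(1)] by auto
    moreover have "openin (subtopology euclidean (\<phi> ` U)) (\<phi> ` (U \<inter> Q))"
      using open_chart_image[OF A c(1) Q] by (intro open_subset) auto
    ultimately show "openin (subtopology euclidean (\<phi> ` U))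
        {y \<in> topspace (subtopology euclidean (\<phi> ` U)). inv_into U \<phi> y \<in> Q}" by simp
  qed
  moreover have "compactin (subtopology euclidean (\<phi> ` U)) (cball (\<phi> x) r)"
    using compact_cball_frame[OF C] r(2) by (auto simp: compactin_subtopology)
  ultimately have "compactin (atlas_topology A) K" unfolding K_def by (rule image_compactin[rotated])
  then have K: "closedin (atlas_topology A) K"
    using M by (intro compactin_imp_closedin) (auto simp: smooth_manifold_def)
  have zero: "\<kappa> y = 0" if "y \<notin> K" for y
  proof (cases "y \<in> U")
    case True
    then have "dist (\<phi> y) (\<phi> x) > r" using inK that by fastforce
    then have "r\<^sup>2 \<le> (dist (\<phi> y) (\<phi> x))\<^sup>2" using r(1) by (intro power_mono) auto
    then show ?thesis using \<theta>(3) True by (simp add: \<kappa>_def g_dist)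
  qed (simp add: \<kappa>_def)
  show ?thesis
  proof (rule that[of \<kappa> K T])
    have "g (\<phi> z) = 0" if "z \<in> U - K" for z
      using zero[of z] that by (simp add: \<kappa>_def)
    then have "smooth_fun_on A (points A) \<kappa>"
      unfolding \<kappa>_def
      using KN by (intro smooth_fun_on_extend_zero[OF A openin_chart_domain[OF c(1)] K _ sg]) auto
    then show "\<kappa> \<in> smooth_ring A"
      using points_chart[OF c(1)] by (auto simp: smooth_ring_def \<kappa>_def)
    show "closedin (atlas_topology A) K" "K \<subseteq> N" using K KN by auto
    show "openin (atlas_topology A) T"
      unfolding T_def
      by (rule openin_smooth_preimage[OF A openin_chart_domain[OF c(1)] smooth_fun_on_chart_map[OF A c(1)]]) simp
    show "x \<in> T" using c(2) r(1) by (simp add: T_def)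
    show "T \<subseteq> K" using inK r(1) by (auto simp: T_def dist_commute)
    show "\<kappa> y = 1" if "y \<in> T" for y
    proof -
      have "dist (\<phi> y) (\<phi> x) \<le> r / 2" using that by (simp add: T_def dist_commute)
      then have "(dist (\<phi> y) (\<phi> x))\<^sup>2 \<le> (r / 2)\<^sup>2" by (intro power_mono) auto
      then show ?thesis using \<theta>(2) that by (simp add: \<kappa>_def T_def g_dist power_divide)
    qed
  qed (use zero in auto)
qed

lemma smooth_map_cong:
  assumes A: "smooth_atlas A" and B: "fd_atlas B" and f: "smooth_map A B f"
    and eq: "\<And>x. x \<in> points A \<Longrightarrow> f x = g x"
  shows "smooth_map A B g"
proof (rule smooth_mapI[OF A B])
  show "g ` points A \<subseteq> points B" using smooth_map_points[OF f] eq by auto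
  fix x assume x: "x \<in> points A"
  then obtain V \<psi> where d: "(V, \<psi>) \<in> B" "f x \<in> V"
    using smooth_map_points[OF f] by (blast elim: points_obtain_chart)
  note o = openin_map_preimage[OF f openin_chart_domain[OF d(1)]]
  have "smooth_fun_on A (points A \<inter> f -` V) (\<lambda>x. \<psi> (g x))"
    by (rule smooth_fun_on_cong[OF smooth_mapD[OF f d(1)] A o]) (use eq in auto)
  then show "\<exists>W V \<psi>. openin (atlas_topology A) W \<and> x \<in> W \<and> (V, \<psi>) \<in> B \<and>
      g ` W \<subseteq> V \<and> smooth_fun_on A W (\<lambda>x. \<psi> (g x))"
    using o x d eq by (intro exI[of _ "points A \<inter> f -` V"] exI[of _ V] exI[of _ \<psi>]) auto
qed

lemma restrict_chart: "(V, \<phi>) \<in> A \<Longrightarrow> (V \<inter> U, \<phi>) \<in> restrict_atlas A U"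
  unfolding restrict_atlas_def by (rule image_eqI[where x = "(V, \<phi>)"]) simp_all

lemma product_std_chart:
  assumes "(V, \<phi>) \<in> A"
  shows "(V \<times> UNIV, map_prod \<phi> (\<lambda>v. v)) \<in> product_atlas A std_atlas"
  unfolding product_atlas_def std_atlas_def
  by (rule CollectI, intro exI conjI, rule refl, rule assms, rule singletonI)

locale smooth_bundle =
  fixes E :: "('m, 'a::real_inner, 'e, 'f::real_inner, 'z) bundle_data_scheme"
  assumes vb: "vector_bundle E"
begin

abbreviation "A \<equiv> base_atlas E"
abbreviation "M \<equiv> points (base_atlas E)"
abbreviation "T \<equiv> total_atlas E"
abbreviation "opn \<equiv> openin (atlas_topology (base_atlas E))"
abbreviation "S \<equiv> sections E"
abbreviation "C \<equiv> smooth_ring (base_atlas E)"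
abbreviation "triv \<equiv> local_trivialisation E"
abbreviation "fib \<equiv> fibre E"
abbreviation "sm \<equiv> smooth_fun_on (base_atlas E)"

section \<open>Local trivialisations and the fibres\<close>

lemma manifold: "smooth_manifold A" and total_manifold: "smooth_manifold T"
  and proj_smooth: "smooth_map T A (proj E)"
  and fibre_vs: "x \<in> M \<Longrightarrow> real_vector_space_on (fib x) (fzero E x) (fadd E) (fscale E)"
  using vb by (auto simp: vector_bundle_def)

lemma triv_exists: "x \<in> M \<Longrightarrow> \<exists>U h. x \<in> U \<and> triv U h"
  using vb by (auto simp: vector_bundle_def)

lemma A_fd: "fd_atlas A" and T_fd: "fd_atlas T"
  using manifold total_manifold by (auto intro: smooth_manifold_fd_atlas)

lemmas A_sm = fd_atlas_smooth[OF A_fd] and T_sm = fd_atlas_smooth[OF T_fd]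

lemma opn_M: "opn M"
  using openin_topspace[of "atlas_topology A"] by simp

lemma frame_base: "\<exists>B::'a set. frame B"
  using A_fd by (simp add: fd_atlas_def)

text \<open>The typical fibre is finite-dimensional because it is a factor of the model space of the
  total space.\<close>

lemma frame_fibre: "\<exists>B::'f set. frame B"
proof -
  obtain B :: "('a \<times> 'f) set" where B: "finite B" "span B = UNIV"
    using total_manifold by (auto simp: smooth_manifold_def)
  have "span (snd ` B) = snd ` span B"
    by (rule linear_span_image) (simp add: linear_snd)
  then have "span (snd ` B) = UNIV" using B(2) by simp
  then show ?thesis using frame_exists[of "snd ` B"] B(1) by simp
qed

lemma fibre_closed:
  assumes "x \<in> M"
  shows "fzero E x \<in> fib x" and "u \<in> fib x \<Longrightarrow> v \<in> fib x \<Longrightarrow> fadd E u v \<in> fib x"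
    and "u \<in> fib x \<Longrightarrow> fscale E a u \<in> fib x"
proof -
  note v = fibre_vs[OF assms, unfolded real_vector_space_on_def]
  show "fzero E x \<in> fib x" using v by (rule conjunct1)
  show "u \<in> fib x \<Longrightarrow> v \<in> fib x \<Longrightarrow> fadd E u v \<in> fib x"
    using v[THEN conjunct2, THEN conjunct1] by simp
  show "u \<in> fib x \<Longrightarrow> fscale E a u \<in> fib x"
    using v[THEN conjunct2, THEN conjunct2, THEN conjunct1] by simp
qed

lemma triv_open: "triv U h \<Longrightarrow> opn U"
  by (simp add: local_trivialisation_def)

lemma triv_subset: "triv U h \<Longrightarrow> U \<subseteq> M"
  using openin_subset[OF triv_open] by fastforce

lemma restrict_total: "restrict_atlas T (proj E -` U) = restrict_atlas T (points T \<inter> proj E -` U)"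
  unfolding restrict_atlas_def
  by (intro image_cong refl) (auto simp: points_def)

lemma total_open: "triv U h \<Longrightarrow> openin (atlas_topology T) (points T \<inter> proj E -` U)"
  using openin_map_preimage[OF proj_smooth triv_open] .

lemma points_product: "points (product_atlas B B') = points B \<times> points B'"
  unfolding points_def product_atlas_def by fast

lemma points_std: "points std_atlas = UNIV"
  by (simp add: points_def std_atlas_def)

lemma triv_diffeo:
  assumes "triv U h"
  shows "bij_betw (\<lambda>e. (proj E e, h e)) (points T \<inter> proj E -` U) (U \<times> UNIV)"
    and "smooth_map (restrict_atlas T (points T \<inter> proj E -` U))
      (product_atlas (restrict_atlas A U) std_atlas) (\<lambda>e. (proj E e, h e))"
    and "smooth_map (product_atlas (restrict_atlas A U) std_atlas)
      (restrict_atlas T (points T \<inter> proj E -` U))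
      (inv_into (points T \<inter> proj E -` U) (\<lambda>e. (proj E e, h e)))"
proof -
  have "M \<inter> U = U" using triv_subset[OF assms] by auto
  then show "bij_betw (\<lambda>e. (proj E e, h e)) (points T \<inter> proj E -` U) (U \<times> UNIV)"
    "smooth_map (restrict_atlas T (points T \<inter> proj E -` U))
      (product_atlas (restrict_atlas A U) std_atlas) (\<lambda>e. (proj E e, h e))"
    "smooth_map (product_atlas (restrict_atlas A U) std_atlas)
      (restrict_atlas T (points T \<inter> proj E -` U))
      (inv_into (points T \<inter> proj E -` U) (\<lambda>e. (proj E e, h e)))"
    using assms
    by (auto simp: local_trivialisation_def diffeomorphism_def restrict_total points_product points_std
        points_restrict Int_assoc)
qed

lemma triv_fibre_bij:
  assumes "triv U h" and "x \<in> U"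
  shows "bij_betw h (fib x) UNIV"
proof -
  note b = triv_diffeo(1)[OF assms(1)]
  have "inj_on h (fib x)"
    using bij_betw_imp_inj_on[OF b] assms(2) by (auto simp: inj_on_def fibre_def)
  moreover have "v \<in> h ` fib x" for v
  proof -
    have "(x, v) \<in> (\<lambda>e. (proj E e, h e)) ` (points T \<inter> proj E -` U)"
      using b assms(2) by (auto simp: bij_betw_def)
    then show ?thesis by (auto simp: fibre_def)
  qed
  ultimately show ?thesis by (auto simp: bij_betw_def)
qed

abbreviation "loc h x b \<equiv> inv_into (fib x) h b"

lemma loc_simps:
  assumes "triv U h" and "x \<in> U"
  shows "loc h x b \<in> fib x" and "h (loc h x b) = b" and "v \<in> fib x \<Longrightarrow> loc h x (h v) = v"
  using triv_fibre_bij[OF assms]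
  by (auto simp: bij_betw_def inv_into_into f_inv_into_f inv_into_f_f)

lemma triv_inject:
  "triv U h \<Longrightarrow> x \<in> U \<Longrightarrow> u \<in> fib x \<Longrightarrow> v \<in> fib x \<Longrightarrow> h u = h v \<Longrightarrow> u = v"
  by (metis loc_simps(3))

lemma triv_linear:
  assumes "triv U h" and "x \<in> U"
  shows "u \<in> fib x \<Longrightarrow> v \<in> fib x \<Longrightarrow> h (fadd E u v) = h u + h v"
    and "u \<in> fib x \<Longrightarrow> h (fscale E a u) = a *\<^sub>R h u"
    and "h (fzero E x) = 0"
proof -
  show add: "u \<in> fib x \<Longrightarrow> v \<in> fib x \<Longrightarrow> h (fadd E u v) = h u + h v" for u v
    using assms by (auto simp: local_trivialisation_def)
  show "u \<in> fib x \<Longrightarrow> h (fscale E a u) = a *\<^sub>R h u"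
    using assms by (auto simp: local_trivialisation_def)
  have x: "x \<in> M" using triv_subset assms by blast
  have "fadd E (fzero E x) (fzero E x) = fzero E x"
    using fibre_vs[OF x] fibre_closed[OF x] unfolding real_vector_space_on_def by blast
  then have "h (fzero E x) + h (fzero E x) = h (fzero E x)"
    using add[OF fibre_closed(1)[OF x] fibre_closed(1)[OF x]] by simp
  then show "h (fzero E x) = 0" by simp
qed

lemma triv_smooth:
  assumes t: "triv U h"
  shows "smooth_fun_on T (points T \<inter> proj E -` U) h"
proof (rule smooth_fun_on_local[OF T_sm])
  let ?P = "points T \<inter> proj E -` U" and ?B = "product_atlas (restrict_atlas A U) (std_atlas :: ('f, 'f) chart set)"
  let ?F = "\<lambda>e. (proj E e, h e)"
  note oP = total_open[OF t]
  fix e assume e: "e \<in> ?P"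
  then have "proj E e \<in> M" using smooth_map_points[OF proj_smooth] by auto
  then obtain V \<phi> where c: "(V, \<phi>) \<in> A" "proj E e \<in> V" by (rule points_obtain_chart)
  have d: "((V \<inter> U) \<times> UNIV, map_prod \<phi> (\<lambda>v. v)) \<in> ?B"
    by (rule product_std_chart[OF restrict_chart[OF c(1)]])
  let ?W = "points (restrict_atlas T ?P) \<inter> ?F -` ((V \<inter> U) \<times> UNIV)"
  have oW: "openin (atlas_topology T) ?W" "?W \<subseteq> ?P"
    using openin_map_preimage[OF triv_diffeo(2)[OF t] openin_chart_domain[OF d]]
      openin_restrict_atlas[OF T_sm oP] by auto
  have "smooth_fun_on (restrict_atlas T ?P) ?W (\<lambda>e. snd (map_prod \<phi> (\<lambda>v. v) (?F e)))"
    by (rule smooth_fun_on_linear[OF bounded_linear_snd smooth_atlas_restrict[OF T_sm oP] _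
          smooth_mapD[OF triv_diffeo(2)[OF t] d]])
      (use oW openin_restrict_atlas[OF T_sm oP] in auto)
  then have "smooth_fun_on T ?W h"
    by (subst smooth_fun_on_restrict_atlas[OF T_sm oP oW, symmetric]) simp
  moreover have "e \<in> ?W" using e c(2) by (auto simp: points_restrict)
  ultimately show "\<exists>W. openin (atlas_topology T) W \<and> e \<in> W \<and> smooth_fun_on T W h"
    using oW(1) by blast
qed

text \<open>The local section with component b is x \<mapsto> (x, b x) followed by the inverse of
  the trivialisation; smoothness of the first map is checked in product charts.\<close>

lemma loc_smooth:
  assumes t: "triv U h" and W: "opn W" "W \<subseteq> U" and b: "sm W b"
  shows "smooth_map (restrict_atlas A W) T (\<lambda>x. loc h x (b x))"
proof -
  let ?P = "points T \<inter> proj E -` U" and ?B = "product_atlas (restrict_atlas A U) (std_atlas :: ('f, 'f) chart set)"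
  let ?F = "\<lambda>e. (proj E e, h e)"
  obtain Bf :: "'f set" where Bf: "frame Bf" using frame_fibre by blast
  note AW = smooth_atlas_restrict[OF A_sm W(1)] and AU = fd_atlas_restrict[OF A_fd triv_open[OF t]]
    and TP = fd_atlas_restrict[OF T_fd total_open[OF t]]
  have B: "fd_atlas ?B" by (rule fd_atlas_product[OF AU std_atlas_fd[OF Bf]])
  have WM: "M \<inter> W = W" "M \<inter> U = U" using openin_subset[OF W(1)] triv_subset[OF t] by auto
  have "smooth_map (restrict_atlas A W) ?B (\<lambda>x. (x, b x))"
  proof (rule smooth_mapI[OF AW B])
    show "(\<lambda>x. (x, b x)) ` points (restrict_atlas A W) \<subseteq> points ?B"
      using W(2) by (auto simp: points_product points_std points_restrict)
    fix x assume "x \<in> points (restrict_atlas A W)"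
    then have x: "x \<in> M" "x \<in> W" by (auto simp: points_restrict)
    then obtain V \<phi> where c: "(V, \<phi>) \<in> A" "x \<in> V" by (blast elim: points_obtain_chart)
    have o: "opn (V \<inter> W)" using openin_chart_domain[OF c(1)] W(1) by (rule openin_Int)
    have "sm (V \<inter> W) (\<lambda>x. (\<phi> x, b x))"
      by (rule smooth_fun_on_Pair[OF A_sm o])
        (rule smooth_fun_on_subset[OF smooth_fun_on_chart_map[OF A_sm c(1)]] smooth_fun_on_subset[OF b]; blast)+
    then have "smooth_fun_on (restrict_atlas A W) (V \<inter> W) (\<lambda>x. map_prod \<phi> (\<lambda>v. v) (x, b x))"
      by (subst smooth_fun_on_restrict_atlas[OF A_sm W(1) o]) auto
    moreover have "openin (atlas_topology (restrict_atlas A W)) (V \<inter> W)"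
      using openin_restrict_atlas[OF A_sm W(1)] o by auto
    moreover have "((V \<inter> U) \<times> UNIV, map_prod \<phi> (\<lambda>v. v)) \<in> ?B"
      by (rule product_std_chart[OF restrict_chart[OF c(1)]])
    moreover have "(\<lambda>x. (x, b x)) ` (V \<inter> W) \<subseteq> (V \<inter> U) \<times> UNIV" using W(2) by auto
    ultimately show "\<exists>Q V \<psi>. openin (atlas_topology (restrict_atlas A W)) Q \<and> x \<in> Q \<and> (V, \<psi>) \<in> ?B \<and>
        (\<lambda>x. (x, b x)) ` Q \<subseteq> V \<and> smooth_fun_on (restrict_atlas A W) Q (\<lambda>x. \<psi> (x, b x))"
      using x c by (intro exI[of _ "V \<inter> W"] exI[of _ "(V \<inter> U) \<times> UNIV"] exI[of _ "map_prod \<phi> (\<lambda>v. v)"]) auto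
  qed
  from smooth_map_compose[OF AW B TP this triv_diffeo(3)[OF t]]
  have "smooth_map (restrict_atlas A W) (restrict_atlas T ?P) (\<lambda>x. inv_into ?P ?F (x, b x))" .
  from smooth_map_restrict_codomain[OF AW T_fd this]
  show ?thesis
  proof (rule smooth_map_cong[OF AW T_fd])
    fix x assume "x \<in> points (restrict_atlas A W)"
    then have x: "x \<in> U" using W(2) by (auto simp: points_restrict)
    note l = loc_simps[OF t x]
    have "inv_into ?P ?F (?F (loc h x (b x))) = loc h x (b x)"
      by (rule inv_into_f_f[OF bij_betw_imp_inj_on[OF triv_diffeo(1)[OF t]]])
        (use l(1)[of "b x"] x in \<open>auto simp: fibre_def\<close>)
    then show "inv_into ?P ?F (x, b x) = loc h x (b x)"
      using l(1)[of "b x"] l(2)[of "b x"] by (simp add: fibre_def)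
  qed
qed

section \<open>Smooth sections and their components in a trivialisation\<close>

lemma sectionD:
  assumes "V \<in> S"
  shows "x \<in> M \<Longrightarrow> V x \<in> fib x" and "triv U h \<Longrightarrow> sm U (\<lambda>x. h (V x))"
    and "V \<in> extensional M" and "smooth_map A T V"
proof -
  show V: "smooth_map A T V" and "V \<in> extensional M" using assms by (auto simp: sections_def)
  have p: "proj E (V x) = x" if "x \<in> M" for x using assms that by (auto simp: sections_def)
  show "x \<in> M \<Longrightarrow> V x \<in> fib x" using p smooth_map_points[OF V] by (auto simp: fibre_def)
  assume t: "triv U h"
  show "sm U (\<lambda>x. h (V x))"
    by (rule smooth_fun_on_subset[OF smooth_fun_on_comp_map[OF A_sm T_fd V total_open[OF t] triv_smooth[OF t]]])
      (use p triv_subset[OF t] smooth_map_points[OF V] in auto)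
qed

text \<open>Converse to \<open>sectionD\<close>: near each point V is
  \<open>loc h x (h (V x))\<close>, so \<open>loc_smooth\<close> applies to its component in a
  single trivialisation.\<close>

lemma sectionI:
  assumes ext: "V \<in> extensional M" and fib: "\<And>x. x \<in> M \<Longrightarrow> V x \<in> fib x"
    and loc: "\<And>x. x \<in> M \<Longrightarrow> \<exists>U h W. triv U h \<and> opn W \<and> x \<in> W \<and> W \<subseteq> U \<and> sm W (\<lambda>x. h (V x))"
  shows "V \<in> S"
proof -
  have "smooth_map A T V"
  proof (rule smooth_map_local[OF A_sm T_fd])
    fix x assume "x \<in> M"
    then obtain U h W where t: "triv U h" and W: "opn W" "x \<in> W" "W \<subseteq> U" "sm W (\<lambda>x. h (V x))"
      using loc by blast
    have "smooth_map (restrict_atlas A W) T V"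
      by (rule smooth_map_cong[OF smooth_atlas_restrict[OF A_sm W(1)] T_fd loc_smooth[OF t W(1,3,4)]])
        (use W(3) fib triv_subset[OF t] loc_simps(3)[OF t] in \<open>auto simp: points_restrict\<close>)
    then show "\<exists>W. opn W \<and> x \<in> W \<and> smooth_map (restrict_atlas A W) T V" using W by blast
  qed
  then show ?thesis using ext fib by (auto simp: sections_def fibre_def)
qed

lemma sectionI_triv:
  assumes "V \<in> extensional M" and "\<And>x. x \<in> M \<Longrightarrow> V x \<in> fib x"
    and "\<And>U h. triv U h \<Longrightarrow> sm U (\<lambda>x. h (V x))"
  shows "V \<in> S"
  by (rule sectionI[OF assms(1,2)]) (use triv_exists triv_open assms(3) in blast)+

lemma C_D: "f \<in> C \<Longrightarrow> W \<subseteq> M \<Longrightarrow> sm W f" "f \<in> C \<Longrightarrow> x \<notin> M \<Longrightarrow> f x = 0"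
  by (auto simp: smooth_ring_def intro: smooth_fun_on_subset)

lemma sec_add_closed:
  assumes "V \<in> S" and "W \<in> S" shows "sec_add E V W \<in> S"
proof (rule sectionI_triv)
  note V = sectionD[OF assms(1)] and W = sectionD[OF assms(2)]
  show "sec_add E V W \<in> extensional M" by (simp add: sec_add_def)
  show "sec_add E V W x \<in> fib x" if "x \<in> M" for x
    using that V(1) W(1) fibre_closed(2) by (simp add: sec_add_def)
  show "sm U (\<lambda>x. h (sec_add E V W x))" if t: "triv U h" for U h
    by (rule smooth_fun_on_cong[OF smooth_fun_on_add[OF A_sm triv_open[OF t] V(2)[OF t] W(2)[OF t]] A_sm triv_open[OF t]])
      (use triv_subset[OF t] V(1) W(1) triv_linear(1)[OF t] in \<open>auto simp: sec_add_def\<close>)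
qed

lemma sec_mult_closed:
  assumes "f \<in> C" and "V \<in> S" shows "sec_mult E f V \<in> S"
proof (rule sectionI_triv)
  note V = sectionD[OF assms(2)]
  show "sec_mult E f V \<in> extensional M" by (simp add: sec_mult_def)
  show "sec_mult E f V x \<in> fib x" if "x \<in> M" for x
    using that V(1) fibre_closed(3) by (simp add: sec_mult_def)
  show "sm U (\<lambda>x. h (sec_mult E f V x))" if t: "triv U h" for U h
    by (rule smooth_fun_on_cong[OF smooth_fun_on_scaleR[OF A_sm triv_open[OF t] C_D(1)[OF assms(1) triv_subset[OF t]] V(2)[OF t]] A_sm triv_open[OF t]])
      (use triv_subset[OF t] V(1) triv_linear(2)[OF t] in \<open>auto simp: sec_mult_def\<close>)
qed

lemma sec_zero_closed: "sec_zero E \<in> S"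
proof (rule sectionI_triv)
  show "sm U (\<lambda>x. h (sec_zero E x))" if t: "triv U h" for U h
    by (rule smooth_fun_on_cong[OF smooth_fun_on_const[OF A_sm triv_open[OF t], of 0] A_sm triv_open[OF t]])
      (use triv_subset[OF t] triv_linear(3)[OF t] in \<open>auto simp: sec_zero_def\<close>)
qed (auto simp: sec_zero_def fibre_closed)

text \<open>\<kappa> times the local section with constant component b, continued by the zero
  section. Off K it is the zero section altogether, so near a point outside U its component in any
  trivialisation is 0.\<close>

lemma section_cutoff:
  assumes t: "triv U h" and \<kappa>: "\<kappa> \<in> C" and K: "closedin (atlas_topology A) K" "K \<subseteq> U"
    and zero: "\<And>x. x \<notin> K \<Longrightarrow> \<kappa> x = 0"
  shows "\<exists>W\<in>S. \<forall>x\<in>U. h (W x) = \<kappa> x *\<^sub>R b"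
proof
  let ?W = "\<lambda>x\<in>M. if x \<in> U then loc h x (\<kappa> x *\<^sub>R b) else fzero E x"
  note UM = triv_subset[OF t]
  show hW: "\<forall>x\<in>U. h (?W x) = \<kappa> x *\<^sub>R b" using UM loc_simps(2)[OF t] by auto
  show "?W \<in> S"
  proof (rule sectionI)
    show "?W x \<in> fib x" if "x \<in> M" for x using that loc_simps(1)[OF t] fibre_closed(1) by auto
    have oK: "opn (M - K)" using openin_diff[OF openin_topspace K(1)] by simp
    fix x assume x: "x \<in> M"
    show "\<exists>U h W. triv U h \<and> opn W \<and> x \<in> W \<and> W \<subseteq> U \<and> sm W (\<lambda>x. h (?W x))"
    proof (cases "x \<in> U")
      case True
      have "sm U (\<lambda>x. \<kappa> x *\<^sub>R b)"
        by (rule smooth_fun_on_scaleR[OF A_sm triv_open[OF t] C_D(1)[OF \<kappa> UM] smooth_fun_on_const[OF A_sm triv_open[OF t]]])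
      then have "sm U (\<lambda>x. h (?W x))"
        by (rule smooth_fun_on_cong[OF _ A_sm triv_open[OF t]]) (use hW in auto)
      then show ?thesis using t triv_open[OF t] True by blast
    next
      case False
      obtain U' h' where t': "x \<in> U'" "triv U' h'" using triv_exists[OF x] by blast
      have o: "opn (U' \<inter> (M - K))" using triv_open[OF t'(2)] oK by (rule openin_Int)
      have "?W y = fzero E y" if "y \<in> U' \<inter> (M - K)" for y
      proof -
        have y: "y \<in> M" "\<kappa> y = 0" using that zero by auto
        have "loc h y 0 = fzero E y" if "y \<in> U"
          using loc_simps(3)[OF t that fibre_closed(1)[OF y(1)]] triv_linear(3)[OF t that] by simp
        then show ?thesis using y by simp
      qed
      then have "h' (?W y) = 0" if "y \<in> U' \<inter> (M - K)" for y
        using that triv_linear(3)[OF t'(2), of y] by simp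
      then have "sm (U' \<inter> (M - K)) (\<lambda>x. h' (?W x))"
        by (intro smooth_fun_on_cong[OF smooth_fun_on_const[OF A_sm o, of 0] A_sm o]) auto
      then show ?thesis using t' o x False K(2) by blast
    qed
  qed auto
qed

text \<open>Q depends on the bump function only and not on b, so several local sections are extended
  at once with the same neighbourhood.\<close>

lemma section_extension:
  assumes t: "triv U h" and x: "x \<in> U"
  obtains Q where "opn Q" and "x \<in> Q" and "Q \<subseteq> U"
    and "\<forall>b. \<exists>W\<in>S. \<forall>y\<in>Q. W y = loc h y b"
proof -
  obtain \<kappa> K Q where \<kappa>: "\<kappa> \<in> C" and K: "closedin (atlas_topology A) K" "K \<subseteq> U" "\<And>y. y \<notin> K \<Longrightarrow> \<kappa> y = 0"
    and Q: "opn Q" "x \<in> Q" "Q \<subseteq> K" "\<And>y. y \<in> Q \<Longrightarrow> \<kappa> y = 1"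
    using bump_function[OF manifold triv_open[OF t] x] by blast
  have "\<exists>W\<in>S. \<forall>y\<in>Q. W y = loc h y b" for b
  proof -
    obtain W where W: "W \<in> S" "\<forall>y\<in>U. h (W y) = \<kappa> y *\<^sub>R b"
      using section_cutoff[OF t \<kappa> K] by blast
    have "W y = loc h y b" if "y \<in> Q" for y
    proof -
      have y: "y \<in> U" "y \<in> M" using that Q(3) K(2) triv_subset[OF t] by auto
      have "h (W y) = b" using W(2) y(1) Q(4)[OF that] by simp
      then show ?thesis using loc_simps(3)[OF t y(1) sectionD(1)[OF W(1) y(2)]] by simp
    qed
    then show ?thesis using W(1) by blast
  qed
  then show ?thesis using that Q K(2) by blast
qed

lemma section_through:
  assumes x: "x \<in> M" and v: "v \<in> fib x"
  shows "\<exists>V\<in>S. V x = v"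
proof -
  obtain U h where t: "x \<in> U" "triv U h" using triv_exists[OF x] by blast
  obtain Q where "opn Q" "x \<in> Q" "Q \<subseteq> U" "\<forall>b. \<exists>W\<in>S. \<forall>y\<in>Q. W y = loc h y b"
    by (rule section_extension[OF t(2,1)])
  then show ?thesis using loc_simps(3)[OF t(2,1) v] by (metis (no_types))
qed

section \<open>Combinations of sections, and sections that vanish at a point\<close>

definition combination :: "(('m \<Rightarrow> real) \<times> ('m \<Rightarrow> 'e)) list \<Rightarrow> 'm \<Rightarrow> 'e" where
  "combination ps = foldr (\<lambda>(a, W) V. sec_add E (sec_mult E a W) V) ps (sec_zero E)"

lemma combination_closed:
  "(\<And>a W. (a, W) \<in> set ps \<Longrightarrow> a \<in> C \<and> W \<in> S) \<Longrightarrow> combination ps \<in> S"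
  unfolding combination_def
  by (induction ps) (auto intro!: sec_add_closed sec_mult_closed sec_zero_closed)

lemma triv_combination:
  assumes t: "triv U h" "x \<in> U"
  shows "(\<And>a W. (a, W) \<in> set ps \<Longrightarrow> a \<in> C \<and> W \<in> S) \<Longrightarrow>
    h (combination ps x) = (\<Sum>(a, W)\<leftarrow>ps. a x *\<^sub>R h (W x))"
proof (induction ps)
  case Nil
  have "x \<in> M" using t triv_subset by blast
  then show ?case using triv_linear(3)[OF t] by (simp add: combination_def sec_zero_def)
next
  case (Cons p ps)
  obtain a W where p: "p = (a, W)" by (cases p)
  have x: "x \<in> M" using t triv_subset by blast
  have aW: "a \<in> C" "W \<in> S" using Cons.prems p by auto
  have "combination ps \<in> S" by (rule combination_closed) (use Cons.prems in auto)
  note fib = sectionD(1)[OF this x] sectionD(1)[OF aW(2) x]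
  have "combination (p # ps) x = fadd E (fscale E (a x) (W x)) (combination ps x)"
    using x by (simp add: combination_def p sec_add_def sec_mult_def)
  then have "h (combination (p # ps) x) = a x *\<^sub>R h (W x) + h (combination ps x)"
    using triv_linear(1,2)[OF t] fib fibre_closed(3)[OF x] by simp
  moreover have "h (combination ps x) = (\<Sum>(a, W)\<leftarrow>ps. a x *\<^sub>R h (W x))"
    by (rule Cons.IH) (use Cons.prems in auto)
  ultimately show ?case by (simp add: p)
qed

lemma section_eqI:
  assumes "V \<in> S" and "W \<in> S" and "\<And>x U h. triv U h \<Longrightarrow> x \<in> U \<Longrightarrow> h (V x) = h (W x)"
  shows "V = W"
proof (rule extensionalityI[OF sectionD(3)[OF assms(1)] sectionD(3)[OF assms(2)]])
  fix x assume x: "x \<in> M"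
  obtain U h where t: "x \<in> U" "triv U h" using triv_exists[OF x] by blast
  show "V x = W x"
    using triv_inject[OF t(2,1) sectionD(1)[OF assms(1) x] sectionD(1)[OF assms(2) x]] assms(3)[OF t(2,1)] .
qed

lemma triv_sec:
  assumes "triv U h" and "x \<in> U" and "V \<in> S"
  shows "W \<in> S \<Longrightarrow> h (sec_add E V W x) = h (V x) + h (W x)"
    and "h (sec_mult E f V x) = f x *\<^sub>R h (V x)"
    and "h (sec_zero E x) = 0"
  using assms triv_subset[OF assms(1)] triv_linear[OF assms(1,2)] sectionD(1)[OF assms(3), of x]
    sectionD(1)[of W x]
  by (auto simp: sec_add_def sec_mult_def sec_zero_def)

lemma C_mult: "f \<in> C \<Longrightarrow> g \<in> C \<Longrightarrow> f * g \<in> C"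
  using smooth_fun_on_mult[OF A_sm opn_M, of f g] by (auto simp: smooth_ring_def times_fun_def)

text \<open>Locally V is the sum of V^b e_b over a frame of the typical fibre. Neither the
  coordinates V^b nor the local sections e_b are global, but the products \<kappa> V^b and \<kappa>
  e_b are, and they combine to \<kappa>^2 V. The bump function of the conclusion is therefore a
  square.\<close>

lemma vanishing_section:
  assumes V: "V \<in> S" and x: "x \<in> M" and V0: "V x = fzero E x"
  obtains \<kappa> ps where "\<kappa> \<in> C" and "\<kappa> x = 1"
    and "\<And>a W. (a, W) \<in> set ps \<Longrightarrow> a \<in> C \<and> W \<in> S \<and> a x = 0"
    and "sec_mult E \<kappa> V = combination ps"
proof -
  obtain U h where t: "x \<in> U" "triv U h" using triv_exists[OF x] by blast
  note UM = triv_subset[OF t(2)] and oU = triv_open[OF t(2)]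
  obtain \<kappa> K Q where \<kappa>: "\<kappa> \<in> C" and K: "closedin (atlas_topology A) K" "K \<subseteq> U" "\<And>y. y \<notin> K \<Longrightarrow> \<kappa> y = 0"
    and Q: "opn Q" "x \<in> Q" "Q \<subseteq> K" "\<And>y. y \<in> Q \<Longrightarrow> \<kappa> y = 1"
    using bump_function[OF manifold oU t(1)] by blast
  obtain B :: "'f set" where B: "frame B" using frame_fibre by blast
  then obtain bs where bs: "set bs = B" "distinct bs" using finite_distinct_list by (auto simp: frame_def)
  have "\<forall>b. \<exists>W. W \<in> S \<and> (\<forall>y\<in>U. h (W y) = \<kappa> y *\<^sub>R b)"
    using section_cutoff[OF t(2) \<kappa> K] by blast
  then obtain w where w: "\<And>b. w b \<in> S" "\<And>b y. y \<in> U \<Longrightarrow> h (w b y) = \<kappa> y *\<^sub>R b" by metis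
  \<comment> \<open>\<kappa> times the coordinate of V along b; it vanishes at x because h (V x) =
    0. The second factor \<kappa> is contained in \<open>w b\<close>.\<close>
  define a where "a b y = (if y \<in> U then \<kappa> y * ((h (V y) \<bullet> b) / (b \<bullet> b)) else 0)" for b y
  have aC: "a b \<in> C" for b
  proof -
    have "sm U (\<lambda>y. (h (V y) \<bullet> b) / (b \<bullet> b))"
      by (rule smooth_fun_on_linear[OF _ A_sm oU sectionD(2)[OF V t(2)]])
        (rule bounded_linear_compose[OF bounded_linear_divide bounded_linear_inner_left])
    then have "sm U (\<lambda>y. \<kappa> y * ((h (V y) \<bullet> b) / (b \<bullet> b)))"
      by (rule smooth_fun_on_mult[OF A_sm oU C_D(1)[OF \<kappa> UM]])
    then have "sm M (a b)" unfolding a_def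
      by (rule smooth_fun_on_extend_zero[OF A_sm oU K(1,2)]) (use K(3) in auto)
    then show ?thesis using UM by (auto simp: smooth_ring_def a_def)
  qed
  let ?ps = "map (\<lambda>b. (a b, w b)) bs"
  have "h (V x) = 0" using V0 triv_linear(3)[OF t(2,1)] by simp
  then have ps: "c \<in> C \<and> W \<in> S \<and> c x = 0" if "(c, W) \<in> set ?ps" for c W
    using that aC w(1) by (auto simp: a_def)
  then have comb: "combination ?ps \<in> S" by (intro combination_closed) blast
  note \<kappa>2 = C_mult[OF \<kappa> \<kappa>]
  show ?thesis
  proof (rule that[OF \<kappa>2 _ ps])
    show "(\<kappa> * \<kappa>) x = 1" using Q(2,4) by simp
    show "sec_mult E (\<kappa> * \<kappa>) V = combination ?ps"
    proof (rule section_eqI[OF sec_mult_closed[OF \<kappa>2 V] comb])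
      fix y U' h' assume t': "triv U' h'" "y \<in> U'"
      have "h' (combination ?ps y) = (\<Sum>(c, W)\<leftarrow>?ps. c y *\<^sub>R h' (W y))"
        by (rule triv_combination[OF t']) (use ps in blast)
      also have "\<dots> = (\<Sum>b\<in>B. a b y *\<^sub>R h' (w b y))"
        using bs by (simp add: comp_def sum_list_distinct_conv_sum_set)
      finally have eq: "h' (combination ?ps y) = (\<Sum>b\<in>B. a b y *\<^sub>R h' (w b y))" .
      have "y \<in> M" using t' triv_subset by blast
      show "h' (sec_mult E (\<kappa> * \<kappa>) V y) = h' (combination ?ps y)"
      proof (cases "y \<in> U")
        case True
        have "h (combination ?ps y) = (\<Sum>(c, W)\<leftarrow>?ps. c y *\<^sub>R h (W y))"
          by (rule triv_combination[OF t(2) True]) (use ps in blast)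
        also have "\<dots> = (\<Sum>b\<in>B. a b y *\<^sub>R h (w b y))"
          using bs by (simp add: comp_def sum_list_distinct_conv_sum_set)
        also have "\<dots> = (\<kappa> y * \<kappa> y) *\<^sub>R (\<Sum>b\<in>B. ((h (V y) \<bullet> b) / (b \<bullet> b)) *\<^sub>R b)"
          using True by (simp add: a_def w(2) scaleR_right.sum mult_ac)
        also have "\<dots> = h (sec_mult E (\<kappa> * \<kappa>) V y)"
          using B triv_sec(2)[OF t(2) True V, of "\<kappa> * \<kappa>"] by (simp add: frame_def)
        finally have "combination ?ps y = sec_mult E (\<kappa> * \<kappa>) V y"
          by (rule triv_inject[OF t(2) True sectionD(1)[OF comb \<open>y \<in> M\<close>]
                sectionD(1)[OF sec_mult_closed[OF \<kappa>2 V] \<open>y \<in> M\<close>]])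
        then show ?thesis by simp
      next
        case False
        \<comment> \<open>Off U both sides are the zero vector: the left by \<kappa>, the right by
          the coefficients \<open>a b\<close>.\<close>
        then have "\<kappa> y = 0" using K by auto
        then show ?thesis using False eq triv_sec(2)[OF t' V, of "\<kappa> * \<kappa>"] by (simp add: a_def)
      qed
    qed
  qed
qed

end

section \<open>The anchor and the Lie derivative of functions\<close>

text \<open>Removes the arbitrary chart from \<open>differential\<close>: by the chain rule the
  derivatives of f in two charts differ by that of the change of charts, which is also how the
  components of a tangent vector transform.\<close>

lemma differential_chart:
  assumes fd: "fd_atlas A" and c: "(U, \<phi>) \<in> A" "x \<in> U"
    and N: "openin (atlas_topology A) N" "x \<in> N" and f: "smooth_fun_on A N f"
    and v: "v \<in> tangent_bundle A" "fst v = x"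
  shows "differential A f x v =
    frechet_derivative (\<lambda>y. f (inv_into U \<phi> y)) (at (\<phi> x)) (snd v (U, \<phi>))"
proof -
  note A = fd_atlas_smooth[OF fd]
  have cU: "(U, \<phi>) \<in> charts_at A x" using c by (simp add: charts_at_def)
  then have "(SOME c. c \<in> charts_at A x) \<in> charts_at A x" by (rule someI)
  moreover obtain V \<psi> where s: "(SOME c. c \<in> charts_at A x) = (V, \<psi>)" by (rule prod.exhaust)
  ultimately have d: "(V, \<psi>) \<in> A" "x \<in> V" by (auto simp: charts_at_def)
  let ?W = "\<phi> ` (U \<inter> (V \<inter> N))"
  have o: "open ?W"
    using openin_chart_domain[OF d(1)] N(1) by (intro open_chart_image[OF A c(1)]) auto
  have x: "\<phi> x \<in> ?W" using c d N by auto
  have tr: "((\<lambda>y. \<psi> (inv_into U \<phi> y)) has_derivative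
      frechet_derivative (\<lambda>y. \<psi> (inv_into U \<phi> y)) (at (\<phi> x))) (at (\<phi> x))"
    by (rule smooth_on_derivative(1)[OF smooth_atlasD(4)[OF A c(1) d(1)]]) (use c d in auto)
  have fd: "((\<lambda>y. f (inv_into V \<psi> y)) has_derivative
      frechet_derivative (\<lambda>y. f (inv_into V \<psi> y)) (at (\<psi> x))) (at (\<psi> x))"
    by (rule smooth_on_derivative(1)[OF smooth_fun_onD[OF f d(1)]]) (use d N in auto)
  have e: "\<psi> (inv_into U \<phi> (\<phi> x)) = \<psi> x" using inv_chart[OF A c] by simp
  have "((\<lambda>y. f (inv_into V \<psi> (\<psi> (inv_into U \<phi> y)))) has_derivative
      (\<lambda>h. frechet_derivative (\<lambda>y. f (inv_into V \<psi> y)) (at (\<psi> x))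
        (frechet_derivative (\<lambda>y. \<psi> (inv_into U \<phi> y)) (at (\<phi> x)) h))) (at (\<phi> x))"
    using has_derivative_compose[OF tr, of "\<lambda>y. f (inv_into V \<psi> y)"] fd e by simp
  then have "((\<lambda>y. f (inv_into U \<phi> y)) has_derivative
      (\<lambda>h. frechet_derivative (\<lambda>y. f (inv_into V \<psi> y)) (at (\<psi> x))
        (frechet_derivative (\<lambda>y. \<psi> (inv_into U \<phi> y)) (at (\<phi> x)) h))) (at (\<phi> x))"
    by (rule has_derivative_transform_within_open[OF _ o x])
      (use inv_chart[OF A c(1)] inv_chart[OF A d(1)] in auto)
  from frechet_derivative_at[OF this]
  have "frechet_derivative (\<lambda>y. f (inv_into U \<phi> y)) (at (\<phi> x)) (snd v (U, \<phi>)) =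
      frechet_derivative (\<lambda>y. f (inv_into V \<psi> y)) (at (\<psi> x))
        (frechet_derivative (\<lambda>y. \<psi> (inv_into U \<phi> y)) (at (\<phi> x)) (snd v (U, \<phi>)))"
    by (metis (no_types))
  also have "frechet_derivative (\<lambda>y. \<psi> (inv_into U \<phi> y)) (at (\<phi> x)) (snd v (U, \<phi>)) = snd v (V, \<psi>)"
  proof -
    have "\<forall>(U, \<phi>)\<in>charts_at A x. \<forall>(V, \<psi>)\<in>charts_at A x.
        snd v (V, \<psi>) = frechet_derivative (\<lambda>y. \<psi> (inv_into U \<phi> y)) (at (\<phi> x)) (snd v (U, \<phi>))"
      using v by (cases v) (simp add: tangent_bundle_def)
    moreover have "(V, \<psi>) \<in> charts_at A x" using d by (simp add: charts_at_def)
    ultimately show ?thesis using cU by (metis (mono_tags, lifting) case_prodD)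
  qed
  finally show ?thesis by (simp add: differential_def s)
qed

text \<open>Values off the manifold do not matter, since f is only evaluated along the inverse of a
  chart near an interior point of its image.\<close>

lemma differential_cong:
  assumes A: "smooth_atlas A" and x: "x \<in> points A" and eq: "\<And>y. y \<in> points A \<Longrightarrow> f y = g y"
  shows "differential A f x v = differential A g x v"
proof -
  have "\<exists>c. c \<in> charts_at A x" using x by (force simp: charts_at_def points_def)
  then have "(SOME c. c \<in> charts_at A x) \<in> charts_at A x" by (rule someI_ex)
  moreover obtain V \<psi> where s: "(SOME c. c \<in> charts_at A x) = (V, \<psi>)" by (rule prod.exhaust)
  ultimately have d: "(V, \<psi>) \<in> A" "x \<in> V" by (auto simp: charts_at_def)
  have "frechet_derivative (\<lambda>y. f (inv_into V \<psi> y)) (at (\<psi> x)) =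
      frechet_derivative (\<lambda>y. g (inv_into V \<psi> y)) (at (\<psi> x))"
    by (rule frechet_derivative_cong_open(1)[OF smooth_atlasD(2)[OF A d(1)]])
      (use d points_chart[OF d(1)] inv_chart[OF A d(1)] eq in auto)
  then show ?thesis by (simp add: differential_def s)
qed

locale algebroid =
  fixes E :: "('m, 'a::real_inner, 'e, 'f::real_inner) anchored_bundle"
  assumes alg: "lie_algebroid E"

sublocale algebroid \<subseteq> smooth_bundle E
  using alg by unfold_locales (simp add: lie_algebroid_def)

context algebroid
begin

abbreviation "\<rho> \<equiv> anchor E"

lemma anchor_map: "bundle_map_to_tangent E \<rho>"
  using alg by (simp add: lie_algebroid_def)

lemma anchor_smooth: "smooth_map T (tangent_atlas A) \<rho>"
  using anchor_map by (simp add: bundle_map_to_tangent_def)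

lemma anchor_tangent:
  assumes "e \<in> fib x"
  shows "\<rho> e \<in> tangent_bundle A" and "fst (\<rho> e) = x"
proof -
  have e: "e \<in> points T" "proj E e = x" using assms by (auto simp: fibre_def)
  show "fst (\<rho> e) = x" using e anchor_map by (simp add: bundle_map_to_tangent_def)
  have "\<rho> e \<in> points (tangent_atlas A)" by (rule smooth_map_points[OF anchor_smooth e(1)])
  then show "\<rho> e \<in> tangent_bundle A" by (auto simp: points_def tangent_atlas_def)
qed

text \<open>The second component of the chart of the tangent bundle induced by (U, \<phi>), pulled
  back first by the anchor and then by V.\<close>

lemma anchor_component_smooth:
  assumes c: "(U, \<phi>) \<in> A" and V: "V \<in> S"
  shows "sm U (\<lambda>x. snd (\<rho> (V x)) (U, \<phi>))"
proof -
  let ?TU = "{v \<in> tangent_bundle A. fst v \<in> U}" and ?t = "\<lambda>(x, t). (\<phi> x, t (U, \<phi>))"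
  have d: "(?TU, ?t) \<in> tangent_atlas A" using c by (force simp: tangent_atlas_def)
  have o: "openin (atlas_topology T) (points T \<inter> \<rho> -` ?TU)"
    by (rule openin_map_preimage[OF anchor_smooth openin_chart_domain[OF d]])
  have "smooth_fun_on T (points T \<inter> \<rho> -` ?TU) (\<lambda>e. snd (?t (\<rho> e)))"
    by (rule smooth_fun_on_linear[OF bounded_linear_snd T_sm o smooth_mapD[OF anchor_smooth d]])
  then have s: "smooth_fun_on T (points T \<inter> \<rho> -` ?TU) (\<lambda>e. snd (\<rho> e) (U, \<phi>))"
    by (simp add: case_prod_beta)
  have "U \<subseteq> M \<inter> V -` (points T \<inter> \<rho> -` ?TU)"
  proof
    fix x assume x: "x \<in> U"
    then have "x \<in> M" using points_chart[OF c] by auto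
    then show "x \<in> M \<inter> V -` (points T \<inter> \<rho> -` ?TU)"
      using sectionD(1)[OF V] anchor_tangent x by (force simp: fibre_def)
  qed
  then show ?thesis
    using smooth_fun_on_subset[OF smooth_fun_on_comp_map[OF A_sm T_fd sectionD(4)[OF V] o s]] by blast
qed

section \<open>The Lie derivative of functions in a chart\<close>

lemma rho_derivative_chart:
  assumes c: "(U, \<phi>) \<in> A" "x \<in> U" and f: "sm M f" and V: "V \<in> S"
  shows "rho_derivative E V f x =
    frechet_derivative (\<lambda>y. f (inv_into U \<phi> y)) (at (\<phi> x)) (snd (\<rho> (V x)) (U, \<phi>))"
proof -
  have x: "x \<in> M" using points_chart[OF c(1)] c(2) by auto
  note a = anchor_tangent[OF sectionD(1)[OF V x]]
  show ?thesis
    using differential_chart[OF A_fd c opn_M x f a] by (simp add: rho_derivative_def lie_derivative_def)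
qed

lemma chart_derivative:
  assumes c: "(U, \<phi>) \<in> A" "x \<in> U" and f: "sm M f"
  shows "((\<lambda>y. f (inv_into U \<phi> y)) has_derivative
    frechet_derivative (\<lambda>y. f (inv_into U \<phi> y)) (at (\<phi> x))) (at (\<phi> x))"
  by (rule smooth_on_derivative(1)[OF smooth_fun_onD[OF f c(1)]])
    (use c points_chart[OF c(1)] in auto)

text \<open>Base point and direction of the derivative both depend on x. As for compositions, the
  direction is expanded in a frame, which leaves derivatives in fixed directions with smooth
  coefficients.\<close>

lemma rho_derivative_smooth:
  assumes f: "sm M f" and V: "V \<in> S"
  shows "sm M (rho_derivative E V f)"
proof (rule smooth_fun_on_local[OF A_sm])
  fix x assume "x \<in> M"
  then obtain U \<phi> where c: "(U, \<phi>) \<in> A" "x \<in> U" by (rule points_obtain_chart)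
  obtain B :: "'a set" where B: "frame B" using frame_base by blast
  note oU = openin_chart_domain[OF c(1)]
  let ?D = "\<lambda>y. frechet_derivative (\<lambda>y. f (inv_into U \<phi> y)) (at y)"
  let ?t = "\<lambda>x. snd (\<rho> (V x)) (U, \<phi>)"
  have "U \<inter> M = U" using points_chart[OF c(1)] by auto
  then have "smooth_on (\<phi> ` U) (\<lambda>y. f (inv_into U \<phi> y))" using smooth_fun_onD[OF f c(1)] by simp
  note D = smooth_on_derivative(2)[OF this]
  have "sm U (\<lambda>x. \<Sum>b\<in>B. ((?t x \<bullet> b) / (b \<bullet> b)) *\<^sub>R ?D (\<phi> x) b)"
  proof (intro smooth_fun_on_sum[OF A_sm oU] smooth_fun_on_scaleR[OF A_sm oU])
    fix b
    show "sm U (\<lambda>x. (?t x \<bullet> b) / (b \<bullet> b))"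
      by (rule smooth_fun_on_linear[OF _ A_sm oU anchor_component_smooth[OF c(1) V]])
        (rule bounded_linear_compose[OF bounded_linear_divide bounded_linear_inner_left])
    show "sm U (\<lambda>x. ?D (\<phi> x) b)"
      by (rule smooth_fun_on_postcompose[OF B A_sm oU smooth_fun_on_chart_map[OF A_sm c(1)]
            smooth_atlasD(2)[OF A_sm c(1)] D]) simp
  qed
  then have "sm U (rho_derivative E V f)"
  proof (rule smooth_fun_on_cong[OF _ A_sm oU])
    fix z assume z: "z \<in> U"
    have "linear (?D (\<phi> z))" using chart_derivative[OF c(1) z f] by (rule has_derivative_linear)
    from frame_image_sum[OF B this]
    show "(\<Sum>b\<in>B. ((?t z \<bullet> b) / (b \<bullet> b)) *\<^sub>R ?D (\<phi> z) b) = rho_derivative E V f z"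
      using rho_derivative_chart[OF c(1) z f V] by simp
  qed
  then show "\<exists>Q. opn Q \<and> x \<in> Q \<and> sm Q (rho_derivative E V f)" using oU c(2) by blast
qed

lemma rho_derivative_cong:
  "x \<in> M \<Longrightarrow> (\<And>y. y \<in> M \<Longrightarrow> f y = g y) \<Longrightarrow> rho_derivative E V f x = rho_derivative E V g x"
  unfolding rho_derivative_def lie_derivative_def by (rule differential_cong[OF A_sm])

section \<open>The derivations \<open>L V\<close> of the ring \<open>C\<close>, with value 0 off the
  manifold\<close>

definition L :: "('m \<Rightarrow> 'e) \<Rightarrow> ('m \<Rightarrow> real) \<Rightarrow> 'm \<Rightarrow> real" where
  "L V f = (\<lambda>x. if x \<in> M then rho_derivative E V f x else 0)"

text \<open>The real number a as an element of \<open>C\<close>. The function that is a everywhere,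
  such as the unit 1 of the ring of all functions, is in general not in \<open>C\<close>.\<close>

definition const :: "real \<Rightarrow> 'm \<Rightarrow> real" where
  "const a = (\<lambda>x. if x \<in> M then a else 0)"

lemma C_smooth: "f \<in> C \<Longrightarrow> sm M f"
  by (rule C_D(1)) auto

lemma C_intro: "sm M f \<Longrightarrow> (\<And>x. x \<notin> M \<Longrightarrow> f x = 0) \<Longrightarrow> f \<in> C"
  by (simp add: smooth_ring_def)

lemma C_restrict:
  assumes "sm M f" shows "(\<lambda>x. if x \<in> M then f x else 0) \<in> C"
  by (rule C_intro) (auto intro: smooth_fun_on_cong[OF assms A_sm opn_M])

lemma const_closed: "const a \<in> C"
  unfolding const_def by (rule C_restrict[OF smooth_fun_on_const[OF A_sm opn_M]])

lemma C_plus: "f \<in> C \<Longrightarrow> g \<in> C \<Longrightarrow> f + g \<in> C"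
  using smooth_fun_on_add[OF A_sm opn_M, of f g] by (auto simp: smooth_ring_def plus_fun_def)

lemma fun_eqI_on_M:
  fixes f g :: "'m \<Rightarrow> real"
  assumes "\<And>x. x \<notin> M \<Longrightarrow> f x = g x"
    and "\<And>x U \<phi>. x \<in> M \<Longrightarrow> (U, \<phi>) \<in> A \<Longrightarrow> x \<in> U \<Longrightarrow> f x = g x"
  shows "f = g"
proof
  fix x show "f x = g x"
  proof (cases "x \<in> M")
    case True
    then obtain U \<phi> where "(U, \<phi>) \<in> A" "x \<in> U" by (rule points_obtain_chart)
    then show ?thesis using assms(2) True by blast
  qed (rule assms(1))
qed

lemma L_const: assumes "V \<in> S" shows "L V (const a) = 0"
proof (rule fun_eqI_on_M)
  fix x U \<phi> assume x: "x \<in> M" "(U, \<phi>) \<in> A" "x \<in> U"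
  have "rho_derivative E V (const a) x = rho_derivative E V (\<lambda>_. a) x"
    by (rule rho_derivative_cong[OF x(1)]) (simp add: const_def)
  also have "\<dots> = 0"
    using rho_derivative_chart[OF x(2,3) smooth_fun_on_const[OF A_sm opn_M] assms] by simp
  finally show "L V (const a) x = 0 x" using x by (simp add: L_def)
qed (simp add: L_def)

lemma L_plus:
  assumes V: "V \<in> S" and f: "f \<in> C" and g: "g \<in> C"
  shows "L V (f + g) = L V f + L V g"
proof (rule fun_eqI_on_M)
  fix x U \<phi> assume x: "x \<in> M" "(U, \<phi>) \<in> A" "x \<in> U"
  note r = rho_derivative_chart[OF x(2,3) C_smooth V]
  note d = chart_derivative[OF x(2,3) C_smooth]
  have "((\<lambda>y. (f + g) (inv_into U \<phi> y)) has_derivative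
    (\<lambda>h. frechet_derivative (\<lambda>y. f (inv_into U \<phi> y)) (at (\<phi> x)) h +
      frechet_derivative (\<lambda>y. g (inv_into U \<phi> y)) (at (\<phi> x)) h)) (at (\<phi> x))"
    using has_derivative_add[OF d[OF f] d[OF g]] by simp
  from frechet_derivative_at[OF this, symmetric]
  show "L V (f + g) x = (L V f + L V g) x"
    using x r[OF f] r[OF g] r[OF C_plus[OF f g]] by (simp add: L_def)
qed (simp add: L_def)

lemma L_times:
  assumes V: "V \<in> S" and f: "f \<in> C" and g: "g \<in> C"
  shows "L V (f * g) = L V f * g + f * L V g"
proof (rule fun_eqI_on_M)
  fix x U \<phi> assume x: "x \<in> M" "(U, \<phi>) \<in> A" "x \<in> U"
  note r = rho_derivative_chart[OF x(2,3) C_smooth V]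
  note d = chart_derivative[OF x(2,3) C_smooth]
  have "inv_into U \<phi> (\<phi> x) = x" by (rule inv_chart[OF A_sm x(2,3)])
  then have "((\<lambda>y. (f * g) (inv_into U \<phi> y)) has_derivative
    (\<lambda>h. f x * frechet_derivative (\<lambda>y. g (inv_into U \<phi> y)) (at (\<phi> x)) h +
      frechet_derivative (\<lambda>y. f (inv_into U \<phi> y)) (at (\<phi> x)) h * g x)) (at (\<phi> x))"
    using has_derivative_mult[OF d[OF f] d[OF g]] by simp
  from frechet_derivative_at[OF this, symmetric]
  show "L V (f * g) x = (L V f * g + f * L V g) x"
    using x r[OF f] r[OF g] r[OF C_mult[OF f g]] by (simp add: L_def)
qed (simp add: L_def)

lemma L_linear:
  assumes V: "V \<in> S" and f: "f \<in> C"
  shows "W \<in> S \<Longrightarrow> L (sec_add E V W) f = L V f + L W f"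
    and "g \<in> C \<Longrightarrow> L (sec_mult E g V) f = g * L V f"
proof -
  show "L (sec_add E V W) f = L V f + L W f" if W: "W \<in> S"
  proof (rule fun_eqI_on_M)
    fix x U \<phi> assume x: "x \<in> M" "(U, \<phi>) \<in> A" "x \<in> U"
    note r = rho_derivative_chart[OF x(2,3) C_smooth[OF f]]
    have "snd (\<rho> (sec_add E V W x)) (U, \<phi>) = snd (\<rho> (V x)) (U, \<phi>) + snd (\<rho> (W x)) (U, \<phi>)"
      using anchor_map x(1) sectionD(1)[OF V x(1)] sectionD(1)[OF W x(1)]
      by (simp add: bundle_map_to_tangent_def sec_add_def)
    then show "L (sec_add E V W) f x = (L V f + L W f) x"
      using x r[OF V] r[OF W] r[OF sec_add_closed[OF V W]]
        linear_add[OF has_derivative_linear[OF chart_derivative[OF x(2,3) C_smooth[OF f]]]]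
      by (simp add: L_def)
  qed (simp add: L_def)
  show "L (sec_mult E g V) f = g * L V f" if g: "g \<in> C"
  proof (rule fun_eqI_on_M)
    fix x U \<phi> assume x: "x \<in> M" "(U, \<phi>) \<in> A" "x \<in> U"
    note r = rho_derivative_chart[OF x(2,3) C_smooth[OF f]]
    have "snd (\<rho> (sec_mult E g V x)) (U, \<phi>) = g x *\<^sub>R snd (\<rho> (V x)) (U, \<phi>)"
      using anchor_map x(1) sectionD(1)[OF V x(1)]
      by (simp add: bundle_map_to_tangent_def sec_mult_def)
    then show "L (sec_mult E g V) f x = (g * L V f) x"
      using x r[OF V] r[OF sec_mult_closed[OF g V]]
        linear_cmul[OF has_derivative_linear[OF chart_derivative[OF x(2,3) C_smooth[OF f]]]]
      by (simp add: L_def)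
  qed (simp add: L_def)
qed

lemma sec_mult_0: "V \<in> S \<Longrightarrow> sec_mult E 0 V = sec_zero E"
proof (rule section_eqI[OF _ sec_zero_closed])
  assume V: "V \<in> S"
  have "const 0 = 0" by (simp add: const_def fun_eq_iff)
  then show "sec_mult E 0 V \<in> S" using sec_mult_closed[OF const_closed[of 0] V] by simp
  show "h (sec_mult E 0 V x) = h (sec_zero E x)" if "triv U h" "x \<in> U" for x U h
    using triv_sec(2,3)[OF that V] by simp
qed

end

sublocale algebroid \<subseteq> lr: lie_rinehart C S "sec_add E" "sec_mult E" "bracket E" L
proof unfold_locales
  have br: "lie_bracket_on_sections E (bracket E)"
    and leib: "\<forall>s\<in>S. \<forall>t\<in>S. \<forall>f\<in>smooth_functions A.
        bracket E s (sec_mult E f t) =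
        sec_add E (sec_mult E f (bracket E s t)) (sec_mult E (rho_derivative E s f) t)"
    using alg by (auto simp: lie_algebroid_def)
  show "0 \<in> C" using const_closed[of 0] by (simp add: const_def zero_fun_def)
  \<comment> \<open>The negative is the product with \<open>const (-1)\<close>, because -1 itself
    need not belong to \<open>C\<close>.\<close>
  show "- f \<in> C" if "f \<in> C" for f
    using C_mult[OF const_closed[of "-1"] that] C_D(2)[OF that]
    by (auto simp: const_def times_fun_def fun_Compl_def if_distrib cong: if_cong
        elim!: back_subst[of "\<lambda>f. f \<in> C"])
  show "bracket E V V = sec_mult E 0 V" if "V \<in> S" for V
    using br that sec_mult_0 by (simp add: lie_bracket_on_sections_def)
  show "bracket E V (sec_mult E f W) = sec_add E (sec_mult E f (bracket E V W)) (sec_mult E (L V f) W)"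
    if f: "f \<in> C" and "V \<in> S" "W \<in> S" for f V W
  proof -
    have "f \<in> smooth_functions A" using C_smooth[OF f] smooth_functions_iff[OF A_sm] by blast
    \<comment> \<open>The algebroid axiom is stated with \<open>rho_derivative\<close>, which agrees
      with L on M; \<open>sec_mult\<close> takes no other values into account.\<close>
    moreover have "sec_mult E (rho_derivative E V f) W = sec_mult E (L V f) W"
      unfolding sec_mult_def by (rule restrict_ext) (simp add: L_def)
    ultimately show ?thesis using leib that by simp
  qed
  show "L V f \<in> C" if "V \<in> S" "f \<in> C" for V f
    unfolding L_def by (rule C_restrict[OF rho_derivative_smooth[OF C_smooth[OF that(2)] that(1)]])
qed (use alg in \<open>auto simp: lie_algebroid_def lie_bracket_on_sections_def
    intro: C_plus C_mult sec_add_closed sec_mult_closed L_plus L_times L_linear\<close>)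

section \<open>Forms as alternating maps on sections\<close>

context smooth_bundle
begin

section \<open>Multilinear algebra in a single fibre\<close>

lemma alternating_linear:
  assumes \<alpha>: "\<alpha> \<in> alternating_forms E p x"
    and l: "set As \<subseteq> fib x" "set Bs \<subseteq> fib x" "u \<in> fib x" "v \<in> fib x" "Suc (length As + length Bs) = p"
  shows "\<alpha> (As @ fadd E (fscale E a u) (fscale E b v) # Bs) = a * \<alpha> (As @ u # Bs) + b * \<alpha> (As @ v # Bs)"
proof -
  have "length (As @ u # Bs) = p \<and> set (As @ u # Bs) \<subseteq> fib x \<and> length As < p \<and> u \<in> fib x \<and> v \<in> fib x"
    using l by auto
  then have "\<alpha> ((As @ u # Bs)[length As := fadd E (fscale E a u) (fscale E b v)]) =
      a * \<alpha> ((As @ u # Bs)[length As := u]) + b * \<alpha> ((As @ u # Bs)[length As := v])"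
    using \<alpha> unfolding alternating_forms_def by blast
  then show ?thesis by simp
qed

lemma alternating_scale_add:
  assumes \<alpha>: "\<alpha> \<in> alternating_forms E p x" and x: "x \<in> M"
    and l: "set As \<subseteq> fib x" "set Bs \<subseteq> fib x" "u \<in> fib x" "Suc (length As + length Bs) = p"
  shows "v \<in> fib x \<Longrightarrow> \<alpha> (As @ fadd E u v # Bs) = \<alpha> (As @ u # Bs) + \<alpha> (As @ v # Bs)"
    and "\<alpha> (As @ fscale E a u # Bs) = a * \<alpha> (As @ u # Bs)"
proof -
  have one: "fscale E 1 w = w" if "w \<in> fib x" for w
    using fibre_vs[OF x] that by (simp add: real_vector_space_on_def)
  \<comment> \<open>Linearity is only given for combinations of two vectors, so a u is written as a
    u + 0 u.\<close>
  have "fscale E (a + 0) u = fadd E (fscale E a u) (fscale E 0 u)"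
    using fibre_vs[OF x] l(3) unfolding real_vector_space_on_def by blast
  then show "\<alpha> (As @ fscale E a u # Bs) = a * \<alpha> (As @ u # Bs)"
    using alternating_linear[OF \<alpha> l(1,2,3,3,4), of a 0] by simp
  show "v \<in> fib x \<Longrightarrow> \<alpha> (As @ fadd E u v # Bs) = \<alpha> (As @ u # Bs) + \<alpha> (As @ v # Bs)"
    using alternating_linear[OF \<alpha> l(1,2,3) _ l(4), of v 1 1] one l(3) by simp
qed

lemma alternating_expand:
  assumes \<alpha>: "\<alpha> \<in> alternating_forms E p x" and t: "triv U h" "x \<in> U" and B: "frame B"
    and l: "set As \<subseteq> fib x" "set Bs \<subseteq> fib x" "u \<in> fib x" "Suc (length As + length Bs) = p"
  shows "\<alpha> (As @ u # Bs) = (\<Sum>b\<in>B. ((h u \<bullet> b) / (b \<bullet> b)) * \<alpha> (As @ loc h x b # Bs))"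
proof -
  have x: "x \<in> M" using t triv_subset by blast
  note lc = loc_simps[OF t] and tl = triv_linear[OF t]
  have "loc h x (b + c) = fadd E (loc h x b) (loc h x c)" for b c
    by (rule triv_inject[OF t]) (simp_all add: lc tl fibre_closed[OF x])
  moreover have "loc h x (r *\<^sub>R b) = fscale E r (loc h x b)" for r b
    by (rule triv_inject[OF t]) (simp_all add: lc tl fibre_closed[OF x])
  ultimately have "linear (\<lambda>b. \<alpha> (As @ loc h x b # Bs))"
    using alternating_scale_add[OF \<alpha> x l(1,2) _ l(4)] lc(1) by (intro linearI) simp_all
  from frame_image_sum[OF B this, of "h u"] show ?thesis using lc(3)[OF l(3)] by simp
qed

section \<open>Smooth forms and their values on sections\<close>

lemma formD:
  assumes "\<eta> \<in> forms E p"
  shows "x \<in> M \<Longrightarrow> \<eta> x \<in> alternating_forms E p x" and "x \<notin> M \<Longrightarrow> \<eta> x vs = 0"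
    and "triv U h \<Longrightarrow> length bs = p \<Longrightarrow> sm U (\<lambda>x. \<eta> x (map (loc h x) bs))"
proof -
  show "x \<in> M \<Longrightarrow> \<eta> x \<in> alternating_forms E p x" and "x \<notin> M \<Longrightarrow> \<eta> x vs = 0"
    using assms by (auto simp: forms_def)
  assume t: "triv U h" and "length bs = p"
  then have "(\<lambda>x. \<eta> x (map (loc h x) bs)) \<in> smooth_functions (restrict_atlas A U)"
    using assms unfolding forms_def by blast
  then show "sm U (\<lambda>x. \<eta> x (map (loc h x) bs))"
    by (rule smooth_functions_restrict_iff[OF A_sm triv_open[OF t], THEN iffD1])
qed

text \<open>The definition of \<open>forms\<close> tests smoothness on local sections with constant
  components only. The mixed argument list is the generalisation that lets the last section be
  expanded in a frame and its frame vectors join bs.\<close>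

lemma form_frame_smooth:
  assumes \<eta>: "\<eta> \<in> forms E p" and t: "triv U h"
  shows "Vs \<in> lists S \<Longrightarrow> length Vs + length bs = p \<Longrightarrow>
    sm U (\<lambda>x. \<eta> x (map (\<lambda>V. V x) Vs @ map (loc h x) bs))"
proof (induction Vs arbitrary: bs rule: rev_induct)
  case Nil
  then show ?case using formD(3)[OF \<eta> t] by simp
next
  case (snoc V Vs)
  obtain B :: "'f set" where B: "frame B" using frame_fibre by blast
  note oU = triv_open[OF t]
  have V: "V \<in> S" "Vs \<in> lists S" using snoc.prems by auto
  have "sm U (\<lambda>x. \<Sum>b\<in>B. ((h (V x) \<bullet> b) / (b \<bullet> b)) * \<eta> x (map (\<lambda>V. V x) Vs @ map (loc h x) (b # bs)))"
  proof (intro smooth_fun_on_sum[OF A_sm oU] smooth_fun_on_mult[OF A_sm oU])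
    fix b
    show "sm U (\<lambda>x. (h (V x) \<bullet> b) / (b \<bullet> b))"
      by (rule smooth_fun_on_linear[OF _ A_sm oU sectionD(2)[OF V(1) t]])
        (rule bounded_linear_compose[OF bounded_linear_divide bounded_linear_inner_left])
    show "sm U (\<lambda>x. \<eta> x (map (\<lambda>V. V x) Vs @ map (loc h x) (b # bs)))"
      using snoc.prems V by (intro snoc.IH) auto
  qed
  then show ?case
  proof (rule smooth_fun_on_cong[OF _ A_sm oU])
    fix x assume x: "x \<in> U"
    then have xM: "x \<in> M" using triv_subset[OF t] by blast
    have "set (map (\<lambda>V. V x) Vs) \<subseteq> fib x" "set (map (loc h x) bs) \<subseteq> fib x" "V x \<in> fib x"
      using sectionD(1)[OF _ xM] V loc_simps(1)[OF t x] by auto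
    from alternating_expand[OF formD(1)[OF \<eta> xM] t x B this]
    show "(\<Sum>b\<in>B. ((h (V x) \<bullet> b) / (b \<bullet> b)) * \<eta> x (map (\<lambda>V. V x) Vs @ map (loc h x) (b # bs))) =
        \<eta> x (map (\<lambda>V. V x) (Vs @ [V]) @ map (loc h x) bs)"
      using snoc.prems by simp
  qed
qed

lemma sm_triv_local:
  assumes "\<And>U h. triv U h \<Longrightarrow> sm U f" shows "sm M f"
proof (rule smooth_fun_on_local[OF A_sm])
  fix x assume "x \<in> M"
  then obtain U h where "x \<in> U" and t: "triv U h" using triv_exists by blast
  then show "\<exists>Q. opn Q \<and> x \<in> Q \<and> sm Q f" using triv_open[OF t] assms[OF t] by blast
qed

lemma form_eval_closed:
  assumes \<eta>: "\<eta> \<in> forms E p" and V: "Vs \<in> lists S" "length Vs = p"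
  shows "form_eval \<eta> Vs \<in> C"
proof -
  have "sm U (form_eval \<eta> Vs)" if "triv U h" for U h
    using form_frame_smooth[OF \<eta> that V(1), of "[]"] V(2) by (simp add: form_eval_def[abs_def])
  then have "sm M (form_eval \<eta> Vs)" by (rule sm_triv_local)
  then show ?thesis using formD(2)[OF \<eta>] by (auto simp: smooth_ring_def form_eval_def)
qed

text \<open>The source of all uniqueness claims: every tuple of fibre vectors is the tuple of values
  of global sections, and on other lists forms vanish by convention.\<close>

lemma form_eqI:
  assumes \<omega>: "\<omega> \<in> forms E p" "\<omega>' \<in> forms E p"
    and eq: "\<And>Vs x. Vs \<in> lists S \<Longrightarrow> length Vs = p \<Longrightarrow> x \<in> M \<Longrightarrow> form_eval \<omega> Vs x = form_eval \<omega>' Vs x"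
  shows "\<omega> = \<omega>'"
proof (intro ext)
  fix x vs
  show "\<omega> x vs = \<omega>' x vs"
  proof (cases "x \<in> M \<and> length vs = p \<and> set vs \<subseteq> fib x")
    case True
    then have "\<exists>Vs. Vs \<in> lists S \<and> map (\<lambda>V. V x) Vs = vs"
    proof (induction vs arbitrary: p)
      case (Cons v vs)
      then obtain Vs V where "Vs \<in> lists S" "map (\<lambda>V. V x) Vs = vs" "V \<in> S" "V x = v"
        using section_through[of x v] by auto
      then show ?case by (intro exI[of _ "V # Vs"]) auto
    qed auto
    then obtain Vs where "Vs \<in> lists S" "map (\<lambda>V. V x) Vs = vs" by blast
    then show ?thesis using eq[of Vs x] True by (auto simp: form_eval_def)
  next
    case False
    have "\<omega> x vs = 0" if "\<omega> \<in> forms E p" for \<omega>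
      using False formD(1,2)[OF that, of x] by (cases "x \<in> M") (auto simp: alternating_forms_def)
    from this[OF \<omega>(1)] this[OF \<omega>(2)] show ?thesis by simp
  qed
qed

lemma forms_linear:
  assumes \<eta>: "\<eta> \<in> forms E p" and \<theta>: "\<theta> \<in> forms E p"
  shows "(\<lambda>x vs. a * \<eta> x vs + b * \<theta> x vs) \<in> forms E p"
proof -
  have "(\<lambda>vs. a * \<eta> x vs + b * \<theta> x vs) \<in> alternating_forms E p x" if "x \<in> M" for x
    using formD(1)[OF \<eta> that] formD(1)[OF \<theta> that]
    unfolding alternating_forms_def by (simp add: algebra_simps)
  moreover have "(\<lambda>x. a * \<eta> x (map (loc h x) bs) + b * \<theta> x (map (loc h x) bs))
      \<in> smooth_functions (restrict_atlas A U)"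
    if t: "triv U h" "length bs = p" for U h bs
    by (rule smooth_functions_restrict_iff[OF A_sm triv_open[OF t(1)], THEN iffD2])
      (intro smooth_fun_on_add[OF A_sm triv_open[OF t(1)]] smooth_fun_on_mult[OF A_sm triv_open[OF t(1)]]
        smooth_fun_on_const[OF A_sm triv_open[OF t(1)]] formD(3)[OF \<eta> t] formD(3)[OF \<theta> t])
  ultimately show ?thesis
    using formD(2)[OF \<eta>] formD(2)[OF \<theta>] by (simp add: forms_def)
qed

lemma zero_form: "(\<lambda>x vs. 0) \<in> forms E p"
proof -
  have "(\<lambda>x. 0) \<in> smooth_functions (restrict_atlas A U)" if t: "triv U h" for U h
    by (rule smooth_functions_restrict_iff[OF A_sm triv_open[OF t], THEN iffD2])
      (rule smooth_fun_on_const[OF A_sm triv_open[OF t]])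
  then show ?thesis by (auto simp: forms_def alternating_forms_def)
qed

lemma form_of_fun_in_forms:
  assumes "sm M f"
  shows "form_of_fun E f \<in> forms E 0"
proof -
  have "(\<lambda>x. form_of_fun E f x []) \<in> smooth_functions (restrict_atlas A U)" if "triv U h" for U h
    using triv_subset[OF that]
    by (intro smooth_functions_restrict_iff[OF A_sm triv_open[OF that], THEN iffD2] smooth_fun_on_cong[OF smooth_fun_on_subset[OF assms] A_sm triv_open[OF that]])
      (auto simp: form_of_fun_def)
  then show ?thesis
    by (auto simp: forms_def alternating_forms_def form_of_fun_def)
qed

lemma forms_0_obtain:
  assumes \<eta>: "\<eta> \<in> forms E 0"
  obtains f where "f \<in> smooth_functions A" and "\<eta> = form_of_fun E f"
proof (rule that)
  have "(\<lambda>x. \<eta> x []) \<in> C" using form_eval_closed[OF \<eta>, of "[]"] by (simp add: form_eval_def[abs_def])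
  then show "(\<lambda>x. \<eta> x []) \<in> smooth_functions A"
    using smooth_functions_iff[OF A_sm] by (simp add: smooth_ring_def)
  show "\<eta> = form_of_fun E (\<lambda>x. \<eta> x [])"
  proof (intro ext)
    fix x vs show "\<eta> x vs = form_of_fun E (\<lambda>x. \<eta> x []) x vs"
      using formD(1,2)[OF \<eta>, of x] by (cases "x \<in> M") (auto simp: form_of_fun_def alternating_forms_def)
  qed
qed

end

context algebroid
begin

lemma lists_S_values: "Vs \<in> lists S \<Longrightarrow> x \<in> M \<Longrightarrow> set (map (\<lambda>V. V x) Vs) \<subseteq> fib x"
  using sectionD(1) by auto

text \<open>Entry into the algebraic setting. The identities are equalities of functions on the
  whole type: on M they hold fibrewise, off M forms vanish.\<close>

lemma altform_form_eval:
  assumes \<eta>: "\<eta> \<in> forms E p"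
  shows "lr.altform p (form_eval \<eta>)"
  unfolding lr.altform_def lr.alternating_additive_def
proof (intro conjI ballI impI)
  show "form_eval \<eta> Vs \<in> C" if "Vs \<in> lists S" "length Vs = p" for Vs
    by (rule form_eval_closed[OF \<eta> that])
  show "form_eval \<eta> (As @ sec_add E V W # Bs) = form_eval \<eta> (As @ V # Bs) + form_eval \<eta> (As @ W # Bs)"
    if l: "As \<in> lists S" "Bs \<in> lists S" "V \<in> S" "W \<in> S" "Suc (length As + length Bs) = p" for As Bs V W
  proof
    fix x
    show "form_eval \<eta> (As @ sec_add E V W # Bs) x = (form_eval \<eta> (As @ V # Bs) + form_eval \<eta> (As @ W # Bs)) x"
    proof (cases "x \<in> M")
      case True
      show ?thesis
        using alternating_scale_add(1)[OF formD(1)[OF \<eta> True] True lists_S_values[OF l(1) True]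
            lists_S_values[OF l(2) True] sectionD(1)[OF l(3) True] _ sectionD(1)[OF l(4) True]] l(5) True
        by (simp add: form_eval_def sec_add_def)
    next
      case False
      then show ?thesis by (simp add: form_eval_def formD(2)[OF \<eta>])
    qed
  qed
  show "form_eval \<eta> (As @ sec_mult E f V # Bs) = f * form_eval \<eta> (As @ V # Bs)"
    if l: "As \<in> lists S" "Bs \<in> lists S" "V \<in> S" "f \<in> C" "Suc (length As + length Bs) = p" for As Bs V f
  proof
    fix x
    show "form_eval \<eta> (As @ sec_mult E f V # Bs) x = (f * form_eval \<eta> (As @ V # Bs)) x"
    proof (cases "x \<in> M")
      case True
      show ?thesis
        using alternating_scale_add(2)[OF formD(1)[OF \<eta> True] True lists_S_values[OF l(1) True]
            lists_S_values[OF l(2) True] sectionD(1)[OF l(3) True]] l(5) True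
        by (simp add: form_eval_def sec_mult_def)
    next
      case False
      then show ?thesis by (simp add: form_eval_def formD(2)[OF \<eta>])
    qed
  qed
  show "form_eval \<eta> (As @ V # Bs @ V # Ds) = 0"
    if l: "As \<in> lists S" "Bs \<in> lists S" "Ds \<in> lists S" "V \<in> S"
      "Suc (Suc (length As + length Bs + length Ds)) = p" for As Bs Ds V
  proof
    fix x
    show "form_eval \<eta> (As @ V # Bs @ V # Ds) x = 0 x"
    proof (cases "x \<in> M")
      case True
      let ?vs = "map (\<lambda>V. V x) (As @ V # Bs @ V # Ds)"
      have "As @ V # Bs @ V # Ds \<in> lists S" using l by simp
      then have "set ?vs \<subseteq> fib x" by (rule lists_S_values[OF _ True])
      moreover have "length ?vs = p" "\<not> distinct ?vs" using l(5) by simp_all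
      ultimately have "\<eta> x ?vs = 0" using formD(1)[OF \<eta> True] unfolding alternating_forms_def by blast
      then show ?thesis by (simp add: form_eval_def)
    next
      case False
      then show ?thesis by (simp add: form_eval_def formD(2)[OF \<eta>])
    qed
  qed
qed

section \<open>Linearity over functions makes values depend on the point only\<close>

lemma altform_combination:
  assumes F: "lr.altform q F" and l: "As \<in> lists S" "Bs \<in> lists S" "Suc (length As + length Bs) = q"
    and x: "x \<in> M"
  shows "(\<And>a W. (a, W) \<in> set ps \<Longrightarrow> a \<in> C \<and> W \<in> S \<and> a x = 0) \<Longrightarrow> F (As @ combination ps # Bs) x = 0"
proof (induction ps)
  case Nil
  have "combination [] = sec_mult E 0 (sec_zero E)"
    using sec_mult_0[OF sec_zero_closed] by (simp add: combination_def)
  then show ?case using lr.altformD(2)[OF F l(1,2) sec_zero_closed lr.C_0 l(3)] by simp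
next
  case (Cons p ps)
  obtain a W where p: "p = (a, W)" by (cases p)
  have aW: "a \<in> C" "W \<in> S" "a x = 0" using Cons.prems p by auto
  have "combination ps \<in> S" using Cons.prems by (intro combination_closed) auto
  from lr.alternating_additiveD(2)[OF lr.altformD(1)[OF F] l(1,2) sec_mult_closed[OF aW(1,2)] this l(3)]
  have "F (As @ combination (p # ps) # Bs) x =
      F (As @ sec_mult E a W # Bs) x + F (As @ combination ps # Bs) x"
    by (simp add: combination_def p)
  moreover have "F (As @ sec_mult E a W # Bs) x = 0"
    using lr.altformD(2)[OF F l(1,2) aW(2,1) l(3)] aW(3) by simp
  moreover have "F (As @ combination ps # Bs) x = 0"
    by (rule Cons.IH) (use Cons.prems in auto)
  ultimately show ?case by simp
qed

text \<open>The value with \<kappa> V in place of V is 0 at x by the expansion of \<kappa> V, and it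
  is \<kappa>(x) = 1 times the value with V.\<close>

lemma altform_vanishing:
  assumes F: "lr.altform q F" and l: "As \<in> lists S" "Bs \<in> lists S" "Suc (length As + length Bs) = q"
    and x: "x \<in> M" and V: "V \<in> S" "V x = fzero E x"
  shows "F (As @ V # Bs) x = 0"
proof -
  obtain \<kappa> ps where \<kappa>: "\<kappa> \<in> C" "\<kappa> x = 1"
    and ps: "\<And>a W. (a, W) \<in> set ps \<Longrightarrow> a \<in> C \<and> W \<in> S \<and> a x = 0"
    and eq: "sec_mult E \<kappa> V = combination ps"
    using vanishing_section[OF V(1) x V(2)] by blast
  have "F (As @ sec_mult E \<kappa> V # Bs) x = 0"
    unfolding eq by (rule altform_combination[OF F l x ps])
  then show ?thesis using lr.altformD(2)[OF F l(1,2) V(1) \<kappa>(1) l(3)] \<kappa>(2) by simp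
qed

text \<open>The previous lemma for V - W, with -W realised as \<open>const (-1)\<close> times
  W.\<close>

lemma altform_pointwise_slot:
  assumes F: "lr.altform q F" and l: "As \<in> lists S" "Bs \<in> lists S" "Suc (length As + length Bs) = q"
    and x: "x \<in> M" and V: "V \<in> S" "W \<in> S" "V x = W x"
  shows "F (As @ V # Bs) x = F (As @ W # Bs) x"
proof -
  let ?W = "sec_mult E (const (-1)) W"
  have W: "?W \<in> S" by (rule sec_mult_closed[OF const_closed V(2)])
  have "sec_add E V ?W x = fzero E x"
  proof -
    obtain U h where t: "x \<in> U" "triv U h" using triv_exists[OF x] by blast
    have "h (?W x) = - h (W x)" using triv_sec(2)[OF t(2,1) V(2), of "const (-1)"] x by (simp add: const_def)
    then have "h (sec_add E V ?W x) = h (fzero E x)"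
      using triv_sec(1)[OF t(2,1) V(1) W] triv_linear(3)[OF t(2,1)] V(3) by simp
    then show ?thesis
      by (rule triv_inject[OF t(2,1) sectionD(1)[OF sec_add_closed[OF V(1) W] x] fibre_closed(1)[OF x]])
  qed
  then have "F (As @ sec_add E V ?W # Bs) x = 0"
    by (rule altform_vanishing[OF F l x sec_add_closed[OF V(1) W]])
  then show ?thesis
    using lr.alternating_additiveD(2)[OF lr.altformD(1)[OF F] l(1,2) V(1) W l(3)]
      lr.altformD(2)[OF F l(1,2) V(2) const_closed l(3)] x by (simp add: const_def)
qed

text \<open>Entries are exchanged one at a time from the left, and \<open>As\<close> collects those
  already exchanged.\<close>

lemma altform_pointwise:
  assumes F: "lr.altform q F" and x: "x \<in> M"
  shows "Vs \<in> lists S \<Longrightarrow> Ws \<in> lists S \<Longrightarrow> map (\<lambda>V. V x) Vs = map (\<lambda>V. V x) Ws \<Longrightarrow> As \<in> lists S \<Longrightarrow>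
    length As + length Vs = q \<Longrightarrow> F (As @ Vs) x = F (As @ Ws) x"
proof (induction Vs arbitrary: As Ws)
  case (Cons V Vs)
  obtain W Ws' where Ws: "Ws = W # Ws'" using Cons.prems(3) by (cases Ws) auto
  have "F (As @ V # Vs) x = F (As @ W # Vs) x"
    by (rule altform_pointwise_slot[OF F _ _ _ x]) (use Cons.prems Ws in auto)
  also have "\<dots> = F ((As @ [W]) @ Ws') x"
    using Cons.IH[of Ws' "As @ [W]"] Cons.prems Ws by simp
  finally show ?case by (simp add: Ws)
qed simp

section \<open>From alternating maps on sections back to forms\<close>

definition through :: "'m \<Rightarrow> 'e \<Rightarrow> 'm \<Rightarrow> 'e" where
  "through x v = (SOME V. V \<in> S \<and> V x = v)"

lemma through: "x \<in> M \<Longrightarrow> v \<in> fib x \<Longrightarrow> through x v \<in> S \<and> through x v x = v"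
  unfolding through_def
  by (rule someI_ex[where P = "\<lambda>V. V \<in> S \<and> V x = v"]) (use section_through in blast)

lemma lists_through:
  assumes x: "x \<in> M" and vs: "set vs \<subseteq> fib x"
  shows "map (through x) vs \<in> lists S \<and> map (\<lambda>V. V x) (map (through x) vs) = vs"
proof -
  have "through x v \<in> S \<and> through x v x = v" if "v \<in> set vs" for v
    using through[OF x] subsetD[OF vs that] .
  then show ?thesis by (auto intro!: map_idI)
qed

text \<open>Evaluates F on arbitrarily chosen sections through the given vectors; for an
  \<open>altform\<close> the choice is immaterial by \<open>form_of_eq\<close>.\<close>

definition form_of :: "nat \<Rightarrow> (('m \<Rightarrow> 'e) list \<Rightarrow> 'm \<Rightarrow> real) \<Rightarrow> 'm \<Rightarrow> 'e list \<Rightarrow> real" where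
  "form_of q F = (\<lambda>x vs. if x \<in> M \<and> length vs = q \<and> set vs \<subseteq> fib x then F (map (through x) vs) x else 0)"

lemma form_of_eq:
  assumes F: "lr.altform q F" and x: "x \<in> M" and Vs: "Vs \<in> lists S" "length Vs = q"
    and vs: "map (\<lambda>V. V x) Vs = vs"
  shows "form_of q F x vs = F Vs x"
proof -
  have s: "set vs \<subseteq> fib x" using lists_S_values[OF Vs(1) x] vs by simp
  have "map (through x) vs \<in> lists S" "map (\<lambda>V. V x) (map (through x) vs) = map (\<lambda>V. V x) Vs"
    using lists_through[OF x s] vs by simp_all
  then have "F (map (through x) vs) x = F Vs x"
    using altform_pointwise[OF F x, of "map (through x) vs" Vs "[]"] Vs vs by auto
  then show ?thesis using x Vs(2) vs s by (auto simp: form_of_def)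
qed

lemma form_of_eval:
  "lr.altform q F \<Longrightarrow> x \<in> M \<Longrightarrow> Vs \<in> lists S \<Longrightarrow> length Vs = q \<Longrightarrow> form_eval (form_of q F) Vs x = F Vs x"
  by (simp add: form_eval_def form_of_eq)

lemma form_of_alternating:
  assumes F: "lr.altform q F" and x: "x \<in> M"
  shows "form_of q F x \<in> alternating_forms E q x"
  unfolding alternating_forms_def
proof (rule CollectI, intro conjI allI impI)
  show "form_of q F x vs = 0" if "\<not> (length vs = q \<and> set vs \<subseteq> fib x)" for vs
    using that by (auto simp: form_of_def)
  show "form_of q F x (vs[i := fadd E (fscale E a u) (fscale E b v)]) =
      a * form_of q F x (vs[i := u]) + b * form_of q F x (vs[i := v])"
    if "length vs = q \<and> set vs \<subseteq> fib x \<and> i < q \<and> u \<in> fib x \<and> v \<in> fib x" for vs i u v a b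
  proof -
    let ?A = "map (through x) (take i vs)" and ?B = "map (through x) (drop (Suc i) vs)"
    let ?u = "through x u" and ?v = "through x v"
    have vs: "set (take i vs) \<subseteq> fib x" "set (drop (Suc i) vs) \<subseteq> fib x"
      using that set_take_subset[of i vs] set_drop_subset[of "Suc i" vs] by auto
    have uv: "?u \<in> S" "?v \<in> S" "?u x = u" "?v x = v" using that through[OF x] by auto
    have au: "sec_mult E (const a) ?u \<in> S" "sec_mult E (const b) ?v \<in> S"
      by (simp_all add: sec_mult_closed const_closed uv)
    note l = lists_through[OF x vs(1), THEN conjunct1] lists_through[OF x vs(2), THEN conjunct1]
    have len: "Suc (length ?A + length ?B) = q" using that by simp
    \<comment> \<open>Any section W through w may be used in slot i. This allows the combination of
      the chosen sections to stand for the combined vector, whose own chosen section is unrelated to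
      it.\<close>
    have eq: "form_of q F x (vs[i := w]) = F (?A @ W # ?B) x" if "W \<in> S" "W x = w" for w W
    proof (rule form_of_eq[OF F x])
      show "?A @ W # ?B \<in> lists S" using l that by simp
      show "length (?A @ W # ?B) = q" using len by simp
      show "map (\<lambda>V. V x) (?A @ W # ?B) = vs[i := w]"
        using lists_through[OF x vs(1)] lists_through[OF x vs(2)] that
          \<open>length vs = q \<and> set vs \<subseteq> fib x \<and> i < q \<and> u \<in> fib x \<and> v \<in> fib x\<close>
        by (simp only: map_append list.map upd_conv_take_nth_drop)
    qed
    have "form_of q F x (vs[i := fadd E (fscale E a u) (fscale E b v)]) =
        F (?A @ sec_add E (sec_mult E (const a) ?u) (sec_mult E (const b) ?v) # ?B) x"
      by (rule eq[OF sec_add_closed[OF au]]) (simp add: x uv sec_add_def sec_mult_def const_def)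
    also have "\<dots> = a * F (?A @ ?u # ?B) x + b * F (?A @ ?v # ?B) x"
      using lr.alternating_additiveD(2)[OF lr.altformD(1)[OF F] l au len] x
        lr.altformD(2)[OF F l uv(1) const_closed len] lr.altformD(2)[OF F l uv(2) const_closed len]
      by (simp add: const_def)
    finally show ?thesis by (simp add: eq[OF uv(1,3)] eq[OF uv(2,4)])
  qed
  show "form_of q F x vs = 0" if nd: "length vs = q \<and> set vs \<subseteq> fib x \<and> \<not> distinct vs" for vs
  proof -
    obtain as bs ds y where d: "vs = as @ [y] @ bs @ [y] @ ds" using nd not_distinct_decomp[of vs] by blast
    \<comment> \<open>Equal vectors receive the same chosen section, so alternation on sections
      applies.\<close>
    have "map (through x) as \<in> lists S" "map (through x) bs \<in> lists S" "map (through x) ds \<in> lists S"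
      "through x y \<in> S"
      using lists_through[OF x, of vs] nd d by auto
    from lr.alternating_additiveD(3)[OF lr.altformD(1)[OF F] this] nd d
    show ?thesis by (simp add: form_of_def)
  qed
qed

lemma form_of_in_forms:
  assumes F: "lr.altform q F"
  shows "form_of q F \<in> forms E q"
proof -
  have "(\<lambda>x. form_of q F x (map (loc h x) bs)) \<in> smooth_functions (restrict_atlas A U)"
    if t: "triv U h" and len: "length bs = q" for U h bs
  proof (rule smooth_functions_restrict_iff[OF A_sm triv_open[OF t], THEN iffD2], rule smooth_fun_on_local[OF A_sm])
    fix x assume x: "x \<in> U"
    \<comment> \<open>On this Q all local sections with constant components come from global ones,
      so the value is F of fixed global sections, an element of \<open>C\<close>.\<close>
    obtain Q where Q: "opn Q" "x \<in> Q" "Q \<subseteq> U" "\<forall>b. \<exists>W\<in>S. \<forall>y\<in>Q. W y = loc h y b"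
      by (rule section_extension[OF t x])
    then obtain w where w: "\<And>b. w b \<in> S" "\<And>b y. y \<in> Q \<Longrightarrow> w b y = loc h y b" by metis
    have ws: "map w bs \<in> lists S" using w(1) by auto
    have "F (map w bs) \<in> C"
      by (rule lr.alternating_additiveD(1)[OF lr.altformD(1)[OF F] ws]) (use len in simp)
    moreover have QM: "Q \<subseteq> M" using Q(3) triv_subset[OF t] by blast
    ultimately have "sm Q (F (map w bs))" by (intro C_D(1))
    then have "sm Q (\<lambda>x. form_of q F x (map (loc h x) bs))"
    proof (rule smooth_fun_on_cong[OF _ A_sm Q(1)])
      fix y assume y: "y \<in> Q"
      then have "y \<in> M" using QM by blast
      then show "F (map w bs) y = form_of q F y (map (loc h y) bs)"
        using form_of_eq[OF F _ ws, of y "map (loc h y) bs"] len w(2)[OF y] by simp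
    qed
    then show "\<exists>Q. opn Q \<and> x \<in> Q \<and> sm Q (\<lambda>x. form_of q F x (map (loc h x) bs))" using Q by blast
  qed
  then show ?thesis
    using form_of_alternating[OF F] by (simp add: forms_def form_of_def)
qed

section \<open>The exterior derivative\<close>

definition D :: "nat \<Rightarrow> ('m \<Rightarrow> 'e list \<Rightarrow> real) \<Rightarrow> 'm \<Rightarrow> 'e list \<Rightarrow> real" where
  "D p \<eta> = form_of (Suc p) (lr.cartan_d (form_eval \<eta>))"

lemma D_in_forms: "\<eta> \<in> forms E p \<Longrightarrow> D p \<eta> \<in> forms E (Suc p)"
  unfolding D_def by (intro form_of_in_forms lr.altform_cartan_d altform_form_eval)

lemma D_eval:
  "\<eta> \<in> forms E p \<Longrightarrow> Vs \<in> lists S \<Longrightarrow> length Vs = Suc p \<Longrightarrow> x \<in> M \<Longrightarrow>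
    form_eval (D p \<eta>) Vs x = lr.cartan_d (form_eval \<eta>) Vs x"
  unfolding D_def by (intro form_of_eval lr.altform_cartan_d altform_form_eval)

lemma sum_fun_at:
  fixes g :: "'i \<Rightarrow> 'm \<Rightarrow> real"
  shows "(\<Sum>i\<in>I. g i) x = (\<Sum>i\<in>I. g i x)"
  by (induction I rule: infinite_finite_induct) auto

lemma sign_fun_at: "((-1 :: 'm \<Rightarrow> real) ^ i) x = (-1) ^ i"
  by (induction i) auto

text \<open>Includes p = 0, where the double sum is empty; \<open>D_function\<close> reads clause
  (i) off this case.\<close>

lemma D_explicit:
  assumes \<eta>: "\<eta> \<in> forms E p" and Vs: "Vs \<in> lists S" "length Vs = Suc p" and x: "x \<in> M"
  shows "form_eval (D p \<eta>) Vs x =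
    (\<Sum>i\<le>p. (-1) ^ i * rho_derivative E (Vs ! i) (form_eval \<eta> (nths Vs (- {i}))) x) +
    (\<Sum>j\<le>p. \<Sum>i<j. (-1) ^ (i + j) *
      form_eval \<eta> (bracket E (Vs ! i) (Vs ! j) # nths Vs (- {i, j})) x)"
  using lr.cartan_d_explicit[OF altform_form_eval[OF \<eta>] Vs(2,1)] x
  by (simp add: D_eval[OF \<eta> Vs x] sum_fun_at sign_fun_at L_def)

lemma D_linear:
  assumes \<eta>: "\<eta> \<in> forms E p" and \<theta>: "\<theta> \<in> forms E p"
  shows "D p (\<lambda>x vs. a * \<eta> x vs + b * \<theta> x vs) = (\<lambda>x vs. a * D p \<eta> x vs + b * D p \<theta> x vs)"
proof (rule form_eqI[OF D_in_forms[OF forms_linear[OF \<eta> \<theta>]] forms_linear[OF D_in_forms[OF \<eta>] D_in_forms[OF \<theta>]]])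
  fix Vs x assume Vs: "Vs \<in> lists S" "length Vs = Suc p" and x: "x \<in> M"
  \<comment> \<open>The real scalars are replaced by the ring elements \<open>const a\<close> and
    \<open>const b\<close>, which every L V annihilates; off M the forms vanish anyway.\<close>
  have "form_eval (\<lambda>x vs. a * \<eta> x vs + b * \<theta> x vs) =
      (\<lambda>Z. const a * form_eval \<eta> Z + const b * form_eval \<theta> Z)"
    by (intro ext) (simp add: form_eval_def const_def formD(2)[OF \<eta>] formD(2)[OF \<theta>])
  moreover have "lr.cartan_d (\<lambda>Z. const a * form_eval \<eta> Z + const b * form_eval \<theta> Z) Vs =
      lr.cartan_d (\<lambda>Z. const a * form_eval \<eta> Z) Vs + lr.cartan_d (\<lambda>Z. const b * form_eval \<theta> Z) Vs"
    by (rule lr.cartan_d_add[OF Vs(1)])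
      (use Vs(2) in \<open>auto intro!: C_mult const_closed form_eval_closed[OF \<eta>] form_eval_closed[OF \<theta>]\<close>)
  moreover have "lr.cartan_d (\<lambda>Z. const c * form_eval \<eta> Z) Vs = const c * lr.cartan_d (form_eval \<eta>) Vs"
    if "\<eta> \<in> forms E p" for c \<eta>
    by (rule lr.cartan_d_const_mult[OF const_closed L_const Vs(1)])
      (use Vs(2) in \<open>auto intro!: form_eval_closed[OF that]\<close>)
  moreover have "form_eval (\<lambda>x vs. a * D p \<eta> x vs + b * D p \<theta> x vs) Vs x =
      a * form_eval (D p \<eta>) Vs x + b * form_eval (D p \<theta>) Vs x"
    by (simp add: form_eval_def)
  ultimately show "form_eval (D p (\<lambda>x vs. a * \<eta> x vs + b * \<theta> x vs)) Vs x =
      form_eval (\<lambda>x vs. a * D p \<eta> x vs + b * D p \<theta> x vs) Vs x"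
    using \<eta> \<theta> x by (simp add: D_eval[OF _ Vs x] forms_linear const_def)
qed

lemma D_zero: "D p (\<lambda>x vs. 0) = (\<lambda>x vs. 0)"
  using D_linear[OF zero_form zero_form, of p 0 0] by simp

lemma D_function:
  assumes f: "f \<in> smooth_functions A" and V: "V \<in> S" and x: "x \<in> M"
  shows "form_eval (D 0 (form_of_fun E f)) [V] x = rho_derivative E V f x"
proof -
  have "form_of_fun E f \<in> forms E 0"
    using form_of_fun_in_forms f smooth_functions_iff[OF A_sm] by blast
  then have "form_eval (D 0 (form_of_fun E f)) [V] x =
      rho_derivative E V (form_eval (form_of_fun E f) []) x"
    using D_explicit[of "form_of_fun E f" 0 "[V]" x] V x by (simp add: nths_Cons)
  also have "\<dots> = rho_derivative E V f x"
    by (rule rho_derivative_cong[OF x]) (simp add: form_eval_def form_of_fun_def)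
  finally show ?thesis .
qed

text \<open>The component of degree 0 is 0, since a map of degree 1 sends nothing there. The
  restriction to \<open>all_forms E\<close> fixes the value elsewhere, without which no function
  could be unique.\<close>

definition ext_d :: "('m, 'e) graded_form \<Rightarrow> ('m, 'e) graded_form" where
  "ext_d = (\<lambda>\<omega>\<in>all_forms E. (\<lambda>q. case q of 0 \<Rightarrow> (\<lambda>x vs. 0) | Suc p \<Rightarrow> D p (\<omega> p)))"

lemma all_formsD: "\<omega> \<in> all_forms E \<Longrightarrow> \<omega> p \<in> forms E p"
  by (simp add: all_forms_def)

lemma homogeneous_at: "homogeneous p \<eta> p = \<eta>"
  by (simp add: homogeneous_def)

lemma homogeneous_in_all_forms:
  assumes "\<eta> \<in> forms E p" shows "homogeneous p \<eta> \<in> all_forms E"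
proof -
  have "{q. homogeneous p \<eta> q \<noteq> (\<lambda>x vs. 0)} \<subseteq> {p}" by (auto simp: homogeneous_def)
  then have "finite {q. homogeneous p \<eta> q \<noteq> (\<lambda>x vs. 0)}" by (rule finite_subset) simp
  then show ?thesis using assms zero_form by (auto simp: all_forms_def homogeneous_def)
qed

lemma all_forms_linear:
  assumes "\<omega> \<in> all_forms E" and "\<theta> \<in> all_forms E"
  shows "(\<lambda>p x vs. a * \<omega> p x vs + b * \<theta> p x vs) \<in> all_forms E"
proof -
  have "{p. (\<lambda>x vs. a * \<omega> p x vs + b * \<theta> p x vs) \<noteq> (\<lambda>x vs. 0)} \<subseteq>
      {p. \<omega> p \<noteq> (\<lambda>x vs. 0)} \<union> {p. \<theta> p \<noteq> (\<lambda>x vs. 0)}"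
    by auto
  then have "finite {p. (\<lambda>x vs. a * \<omega> p x vs + b * \<theta> p x vs) \<noteq> (\<lambda>x vs. 0)}"
    by (rule finite_subset) (use assms in \<open>simp add: all_forms_def\<close>)
  then show ?thesis using assms by (simp add: all_forms_def forms_linear)
qed

lemma ext_d_homogeneous:
  assumes "\<eta> \<in> forms E p"
  shows "ext_d (homogeneous p \<eta>) = homogeneous (Suc p) (D p \<eta>)"
  using homogeneous_in_all_forms[OF assms]
  by (auto simp: ext_d_def homogeneous_def D_zero fun_eq_iff split: nat.split)

lemma ext_d_graded: "graded_endomorphism E 1 ext_d"
  unfolding graded_endomorphism_def
proof (intro conjI ballI allI)
  show "ext_d \<in> all_forms E \<rightarrow>\<^sub>E all_forms E"
  proof (rule PiE_I)
    fix \<omega> assume \<omega>: "\<omega> \<in> all_forms E"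
    have "{q. ext_d \<omega> q \<noteq> (\<lambda>x vs. 0)} \<subseteq> Suc ` {p. \<omega> p \<noteq> (\<lambda>x vs. 0)}"
    proof clarify
      fix q assume "ext_d \<omega> q \<noteq> (\<lambda>x vs. 0)"
      then show "q \<in> Suc ` {p. \<omega> p \<noteq> (\<lambda>x vs. 0)}"
        using \<omega> D_zero by (cases q) (auto simp: ext_d_def)
    qed
    then have "finite {q. ext_d \<omega> q \<noteq> (\<lambda>x vs. 0)}"
      by (rule finite_subset) (use \<omega> in \<open>simp add: all_forms_def\<close>)
    moreover have "ext_d \<omega> q \<in> forms E q" for q
      using \<omega> zero_form D_in_forms[OF all_formsD[OF \<omega>]] by (cases q) (auto simp: ext_d_def)
    ultimately show "ext_d \<omega> \<in> all_forms E" by (simp add: all_forms_def)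
  qed (simp add: ext_d_def)
  show "ext_d (\<lambda>p x vs. a * \<omega> p x vs + b * \<theta> p x vs) = (\<lambda>p x vs. a * ext_d \<omega> p x vs + b * ext_d \<theta> p x vs)"
    if \<omega>: "\<omega> \<in> all_forms E" and \<theta>: "\<theta> \<in> all_forms E" for \<omega> \<theta> a b
  proof
    fix q
    show "ext_d (\<lambda>p x vs. a * \<omega> p x vs + b * \<theta> p x vs) q = (\<lambda>x vs. a * ext_d \<omega> q x vs + b * ext_d \<theta> q x vs)"
      using \<omega> \<theta> all_forms_linear[OF \<omega> \<theta>] D_linear[OF all_formsD[OF \<omega>] all_formsD[OF \<theta>]]
      by (cases q) (simp_all add: ext_d_def)
  qed
  show "ext_d ` homogeneous p ` forms E p \<subseteq> homogeneous (p + 1) ` forms E (p + 1)" for p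
    using ext_d_homogeneous D_in_forms by auto
qed

section \<open>Uniqueness, degree by degree and for the endomorphism\<close>

lemma D_unique_function:
  assumes f: "f \<in> smooth_functions A"
  shows "unique_such_that
     (\<lambda>\<omega>. \<omega> \<in> forms E 1 \<and>
       (\<forall>V\<in>S. \<forall>x\<in>M.
          form_eval \<omega> [V] x = rho_derivative E V f x \<and>
          rho_derivative E V f x = differential A f x ((anchor E \<circ> V) x) \<and>
          differential A f x ((anchor E \<circ> V) x) =
            transpose_anchor E (differential A f x) (V x)))
     (D 0 (form_of_fun E f))"
  unfolding unique_such_that_def
proof (intro conjI allI impI ballI)
  have f0: "form_of_fun E f \<in> forms E 0"
    using form_of_fun_in_forms f smooth_functions_iff[OF A_sm] by blast
  show 1: "D 0 (form_of_fun E f) \<in> forms E 1" using D_in_forms[OF f0] by simp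
  fix V x assume "V \<in> S" "x \<in> M"
  then show "form_eval (D 0 (form_of_fun E f)) [V] x = rho_derivative E V f x"
    by (rule D_function[OF f])
  show "rho_derivative E V f x = differential A f x ((anchor E \<circ> V) x)"
    by (simp add: rho_derivative_def lie_derivative_def)
  show "differential A f x ((anchor E \<circ> V) x) = transpose_anchor E (differential A f x) (V x)"
    by (simp add: transpose_anchor_def)
next
  fix \<omega> assume \<omega>: "\<omega> \<in> forms E 1 \<and>
       (\<forall>V\<in>S. \<forall>x\<in>M.
          form_eval \<omega> [V] x = rho_derivative E V f x \<and>
          rho_derivative E V f x = differential A f x ((anchor E \<circ> V) x) \<and>
          differential A f x ((anchor E \<circ> V) x) =
            transpose_anchor E (differential A f x) (V x))"
  have "D 0 (form_of_fun E f) \<in> forms E 1"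
    using D_in_forms[of _ 0] form_of_fun_in_forms f smooth_functions_iff[OF A_sm] by simp
  then show "\<omega> = D 0 (form_of_fun E f)"
    using \<omega> D_function[OF f] by (intro form_eqI[of _ 1]) (auto simp: length_Suc_conv)
qed

lemma D_unique:
  assumes \<eta>: "\<eta> \<in> forms E p"
  shows "unique_such_that
     (\<lambda>\<omega>. \<omega> \<in> forms E (p + 1) \<and>
       (\<forall>Vs. length Vs = p + 1 \<and> set Vs \<subseteq> S \<longrightarrow>
         (\<forall>x\<in>M.
            form_eval \<omega> Vs x =
              (\<Sum>i\<le>p. (-1) ^ i * rho_derivative E (Vs ! i) (form_eval \<eta> (nths Vs (- {i}))) x) +
              (\<Sum>j\<le>p. \<Sum>i<j. (-1) ^ (i + j) *
                 form_eval \<eta> (bracket E (Vs ! i) (Vs ! j) # nths Vs (- {i, j})) x))))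
     (D p \<eta>)"
  unfolding unique_such_that_def
proof (intro conjI allI impI ballI)
  show "D p \<eta> \<in> forms E (p + 1)" using D_in_forms[OF \<eta>] by simp
  show "form_eval (D p \<eta>) Vs x =
      (\<Sum>i\<le>p. (-1) ^ i * rho_derivative E (Vs ! i) (form_eval \<eta> (nths Vs (- {i}))) x) +
      (\<Sum>j\<le>p. \<Sum>i<j. (-1) ^ (i + j) *
         form_eval \<eta> (bracket E (Vs ! i) (Vs ! j) # nths Vs (- {i, j})) x)"
    if "length Vs = p + 1 \<and> set Vs \<subseteq> S" "x \<in> M" for Vs x
    using that by (intro D_explicit[OF \<eta>]) auto
  fix \<omega> assume \<omega>: "\<omega> \<in> forms E (p + 1) \<and>
       (\<forall>Vs. length Vs = p + 1 \<and> set Vs \<subseteq> S \<longrightarrow>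
         (\<forall>x\<in>M.
            form_eval \<omega> Vs x =
              (\<Sum>i\<le>p. (-1) ^ i * rho_derivative E (Vs ! i) (form_eval \<eta> (nths Vs (- {i}))) x) +
              (\<Sum>j\<le>p. \<Sum>i<j. (-1) ^ (i + j) *
                 form_eval \<eta> (bracket E (Vs ! i) (Vs ! j) # nths Vs (- {i, j})) x)))"
  show "\<omega> = D p \<eta>"
  proof (rule form_eqI)
    show "\<omega> \<in> forms E (Suc p)" "D p \<eta> \<in> forms E (Suc p)" using \<omega> D_in_forms[OF \<eta>] by simp_all
    fix Vs x assume Vs: "Vs \<in> lists S" "length Vs = Suc p" and x: "x \<in> M"
    then have "length Vs = p + 1 \<and> set Vs \<subseteq> S" by auto
    then show "form_eval \<omega> Vs x = form_eval (D p \<eta>) Vs x"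
      unfolding D_explicit[OF \<eta> Vs x] using \<omega> x by blast
  qed
qed

lemma unique_such_thatD: "unique_such_that P w \<Longrightarrow> unique_such_that P w' \<Longrightarrow> w = w'"
  by (auto simp: unique_such_that_def)

text \<open>Each family has finitely many nonzero components; induction on a finite set containing
  their degrees splits off one homogeneous part at a time by linearity.\<close>

lemma graded_endomorphism_eqI:
  assumes d: "graded_endomorphism E 1 d" and d': "graded_endomorphism E 1 d'"
    and eq: "\<And>p \<eta>. \<eta> \<in> forms E p \<Longrightarrow> d (homogeneous p \<eta>) (p + 1) = d' (homogeneous p \<eta>) (p + 1)"
  shows "d = d'"
proof
  fix \<omega>
  have hom: "d (homogeneous p \<eta>) = d' (homogeneous p \<eta>)" if \<eta>: "\<eta> \<in> forms E p" for p \<eta>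
  proof -
    have "\<exists>\<theta>. e (homogeneous p \<eta>) = homogeneous (p + 1) \<theta>" if "graded_endomorphism E 1 e" for e
      using that \<eta> unfolding graded_endomorphism_def by blast
    \<comment> \<open>Both images are homogeneous of degree p + 1, so the component in that degree,
      the only one compared in \<open>eq\<close>, determines them.\<close>
    then obtain \<theta> \<theta>' where h: "d (homogeneous p \<eta>) = homogeneous (p + 1) \<theta>"
      "d' (homogeneous p \<eta>) = homogeneous (p + 1) \<theta>'" using d d' by blast
    have "\<theta> = \<theta>'" using eq[OF \<eta>] unfolding h homogeneous_at .
    then show ?thesis using h by simp
  qed
  have lin: "e (\<lambda>p x vs. a * \<omega> p x vs + b * \<theta> p x vs) = (\<lambda>p x vs. a * e \<omega> p x vs + b * e \<theta> p x vs)"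
    if "graded_endomorphism E 1 e" "\<omega> \<in> all_forms E" "\<theta> \<in> all_forms E" for e \<omega> \<theta> a b
    using that unfolding graded_endomorphism_def by blast
  have main: "\<omega> \<in> all_forms E \<Longrightarrow> {p. \<omega> p \<noteq> (\<lambda>x vs. 0)} \<subseteq> P \<Longrightarrow> d \<omega> = d' \<omega>" if "finite P" for P \<omega>
    using that
  proof (induction P arbitrary: \<omega>)
    case empty
    then have "\<omega> p = (\<lambda>x vs. 0)" for p by auto
    \<comment> \<open>The zero family is put in the shape of the linearity condition, which then
      gives the value 0.\<close>
    then have "\<omega> = (\<lambda>p x vs. 0 * \<omega> p x vs + 0 * \<omega> p x vs)" by auto
    then show ?case
      using lin[OF d empty(1) empty(1), of 0 0] lin[OF d' empty(1) empty(1), of 0 0] by simp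
  next
    case (insert p P)
    let ?h = "homogeneous p (\<omega> p)"
    \<comment> \<open>The remainder without its component of degree p; the coefficients 1 and -1 are
      kept so that the linearity lemma matches.\<close>
    let ?r = "\<lambda>q x vs. 1 * \<omega> q x vs + (-1) * ?h q x vs"
    have h: "?h \<in> all_forms E" by (rule homogeneous_in_all_forms[OF all_formsD[OF insert.prems(1)]])
    have r: "?r \<in> all_forms E" by (rule all_forms_linear[OF insert.prems(1) h])
    have "{q. ?r q \<noteq> (\<lambda>x vs. 0)} \<subseteq> P"
      using insert.prems(2) by (auto simp: homogeneous_def split: if_splits)
    then have "d ?r = d' ?r" by (rule insert.IH[OF r])
    moreover have "d ?h = d' ?h" by (rule hom[OF all_formsD[OF insert.prems(1)]])
    moreover have "\<omega> = (\<lambda>q x vs. 1 * ?r q x vs + 1 * ?h q x vs)" by simp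
    ultimately show ?case using lin[OF d r h, of 1 1] lin[OF d' r h, of 1 1] by metis
  qed
  show "d \<omega> = d' \<omega>"
  proof (cases "\<omega> \<in> all_forms E")
    case True
    then have "finite {p. \<omega> p \<noteq> (\<lambda>x vs. 0)}" by (simp add: all_forms_def)
    then show ?thesis using main True by blast
  next
    case False
    have "d \<in> all_forms E \<rightarrow>\<^sub>E all_forms E" "d' \<in> all_forms E \<rightarrow>\<^sub>E all_forms E"
      using d d' by (simp_all add: graded_endomorphism_def)
    then show ?thesis using False by (metis PiE_arb)
  qed
qed

end

theorem proposition5p2p1:
  fixes E :: "('m, 'a::real_inner, 'e, 'f::real_inner) anchored_bundle"
  assumes "lie_algebroid E"
  shows "\<exists>!d. graded_endomorphism E 1 d \<and>
    (\<forall>f\<in>smooth_functions (base_atlas E).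
       unique_such_that
         (\<lambda>\<omega>. \<omega> \<in> forms E 1 \<and>
           (\<forall>V\<in>sections E. \<forall>x\<in>points (base_atlas E).
              form_eval \<omega> [V] x = rho_derivative E V f x \<and>
              rho_derivative E V f x = differential (base_atlas E) f x ((anchor E \<circ> V) x) \<and>
              differential (base_atlas E) f x ((anchor E \<circ> V) x) =
                transpose_anchor E (differential (base_atlas E) f x) (V x)))
         (d (homogeneous 0 (form_of_fun E f)) 1)) \<and>
    (\<forall>p\<ge>1. \<forall>\<eta>\<in>forms E p.
       unique_such_that
         (\<lambda>\<omega>. \<omega> \<in> forms E (p + 1) \<and>
           (\<forall>Vs. length Vs = p + 1 \<and> set Vs \<subseteq> sections E \<longrightarrow>
             (\<forall>x\<in>points (base_atlas E).
                form_eval \<omega> Vs x =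
                  (\<Sum>i\<le>p. (-1) ^ i * rho_derivative E (Vs ! i) (form_eval \<eta> (nths Vs (- {i}))) x) +
                  (\<Sum>j\<le>p. \<Sum>i<j. (-1) ^ (i + j) *
                     form_eval \<eta> (bracket E (Vs ! i) (Vs ! j) # nths Vs (- {i, j})) x))))
         (d (homogeneous p \<eta>) (p + 1)))"
  (is "\<exists>!d. ?G d \<and> (\<forall>f\<in>smooth_functions (base_atlas E). unique_such_that (?P f) (?w d f)) \<and>
    (\<forall>p\<ge>1. \<forall>\<eta>\<in>forms E p. unique_such_that (?Q p \<eta>) (?v d p \<eta>))")
proof -
  interpret algebroid E by unfold_locales (rule assms)
  have f0: "form_of_fun E f \<in> forms E 0" if "f \<in> smooth_functions A" for f
    using form_of_fun_in_forms that smooth_functions_iff[OF A_sm] by blast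
  have P: "unique_such_that (?P f) (D 0 (form_of_fun E f))" if "f \<in> smooth_functions A" for f
    by (rule D_unique_function[OF that])
  have Q: "unique_such_that (?Q p \<eta>) (D p \<eta>)" if "\<eta> \<in> forms E p" for p \<eta>
    by (rule D_unique[OF that])
  have v0: "?w ext_d f = D 0 (form_of_fun E f)" if "f \<in> smooth_functions A" for f
    by (simp add: ext_d_homogeneous[OF f0[OF that]] homogeneous_at)
  have v: "?v ext_d p \<eta> = D p \<eta>" if "\<eta> \<in> forms E p" for p \<eta>
    by (simp add: ext_d_homogeneous[OF that] homogeneous_at)
  show ?thesis
  proof (rule ex1I[of _ ext_d], intro conjI ballI allI impI)
    show "?G ext_d" by (rule ext_d_graded)
    show "unique_such_that (?P f) (?w ext_d f)" if "f \<in> smooth_functions A" for f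
      unfolding v0[OF that] by (rule P[OF that])
    show "unique_such_that (?Q p \<eta>) (?v ext_d p \<eta>)" if "1 \<le> p" "\<eta> \<in> forms E p" for p \<eta>
      unfolding v[OF that(2)] by (rule Q[OF that(2)])
    fix d assume d: "?G d \<and> (\<forall>f\<in>smooth_functions A. unique_such_that (?P f) (?w d f)) \<and>
      (\<forall>p\<ge>1. \<forall>\<eta>\<in>forms E p. unique_such_that (?Q p \<eta>) (?v d p \<eta>))"
    show "d = ext_d"
    proof (rule graded_endomorphism_eqI)
      show "?G d" "?G ext_d" using d ext_d_graded by auto
      fix p \<eta> assume \<eta>: "\<eta> \<in> forms E p"
      show "d (homogeneous p \<eta>) (p + 1) = ext_d (homogeneous p \<eta>) (p + 1)"
      proof (cases "p = 0")
        case True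
        with \<eta> have "\<eta> \<in> forms E 0" by simp
        \<comment> \<open>Clause (i) ranges over functions, so the 0-form has to be recognised as
          one before it can be used.\<close>
        then obtain f where f: "f \<in> smooth_functions A" "\<eta> = form_of_fun E f" by (rule forms_0_obtain)
        have "unique_such_that (?P f) (?w d f)" using d f(1) by blast
        then have "?w d f = D 0 (form_of_fun E f)" using P[OF f(1)] by (rule unique_such_thatD)
        then show ?thesis using v0[OF f(1)] True f(2) by simp
      next
        case False
        then have "unique_such_that (?Q p \<eta>) (?v d p \<eta>)" using d \<eta> by simp
        then have "?v d p \<eta> = D p \<eta>" using Q[OF \<eta>] by (rule unique_such_thatD)
        then show ?thesis using v[OF \<eta>] by simp
      qed
    qed
  qed
qed

end
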